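(* For every positive integer $s$, $$\dim k\otimes_{G(4)}\mathscr{P}_A((P_4)_{2^{s+2}+2^{s+1}-3}^{*})=\begin{cases}0 & \text{if } s=2,\\ 1 & \text{if } s\neq 2.\end{cases}$$
   Context: $k=\mathbb{Z}/2$, $A$ is the mod 2 Steenrod algebra and $G(4)=GL_4(k)$. $P_4=k[x_1,\dots,x_4]$, $\deg x_i=1$, with the usual $A$-action and $G(4)$ acting by linear substitution; $(P_4)_n$ its degree-$n$ part. $(P_4)^*$ is the dual divided power algebra on $a_1^{(1)},\dots,a_4^{(1)}$ (dual to $x_1,\dots,x_4$) with the dual right $A$-action; $\mathscr{P}_A((P_4)_n^* )$ is the subspace of $(P_4)_n^*$ annihilated by all $Sq^i$, $i>0$, and $k\otimes_{G(4)}\mathscr{P}_A((P_4)_n^* )$ denotes its space of $G(4)$-coinvariants. *)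

theory Defs
  imports "HOL-Library.Z2" "HOL-Library.Poly_Mapping" "HOL-Library.Function_Algebras" "Jordan_Normal_Form.Matrix"
begin

(* The ground field k = Z/2 is the type bit.  Monomials in x_0,...,x_3 are
exponent vectors (nat \<Rightarrow>\<^sub>0 nat); polynomials are finitely supported
coefficient functions ((nat \<Rightarrow>\<^sub>0 nat) \<Rightarrow>\<^sub>0 bit), with the library ring structure. *)

type_synonym mono = "nat \<Rightarrow>\<^sub>0 nat"
type_synonym mpoly = "mono \<Rightarrow>\<^sub>0 bit"

definition Var :: "nat \<Rightarrow> mpoly" where
  "Var i = Poly_Mapping.single (Poly_Mapping.single i 1) 1"

definition const :: "bit \<Rightarrow> mpoly" where
  "const c = Poly_Mapping.single 0 c"

definition mdeg :: "mono \<Rightarrow> nat" where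
  "mdeg m = (\<Sum>i\<in>Poly_Mapping.keys m. Poly_Mapping.lookup m i)"

definition monos4 :: "nat \<Rightarrow> mono set" where
  "monos4 n = {m. Poly_Mapping.keys m \<subseteq> {..<4} \<and> mdeg m = n}"

definition P4deg :: "nat \<Rightarrow> mpoly set" where
  "P4deg n = {p. Poly_Mapping.keys p \<subseteq> monos4 n}"

definition subst :: "(nat \<Rightarrow> mpoly) \<Rightarrow> mpoly \<Rightarrow> mpoly" where
  "subst \<sigma> p = (\<Sum>m\<in>Poly_Mapping.keys p. const (Poly_Mapping.lookup p m) * (\<Prod>i\<in>Poly_Mapping.keys m. \<sigma> i ^ Poly_Mapping.lookup m i))"

definition component :: "nat \<Rightarrow> mpoly \<Rightarrow> mpoly" where
  "component d p = (\<Sum>m\<in>{m\<in>Poly_Mapping.keys p. mdeg m = d}. Poly_Mapping.single m (Poly_Mapping.lookup p m))"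

(* Steenrod squares: the total square Sq is the ring homomorphism with
Sq(x) = x + x^2 on each variable; Sq^k of a monomial of degree d is the degree
d+k component of its total square; extended linearly. *)
definition Sq :: "nat \<Rightarrow> mpoly \<Rightarrow> mpoly" where
  "Sq k p = (\<Sum>m\<in>Poly_Mapping.keys p. component (mdeg m + k)
              (subst (\<lambda>i. Var i + Var i ^ 2) (Poly_Mapping.single m (Poly_Mapping.lookup p m))))"

(* (P_4)_n^*: linear functionals on (P_4)_n, given by their values on the
monomial basis (i.e. coordinates in the dual basis a^(m)); zero off degree n. *)
definition dual4 :: "nat \<Rightarrow> (mono \<Rightarrow> bit) set" where
  "dual4 n = {f. \<forall>m. m \<notin> monos4 n \<longrightarrow> f m = 0}"

definition ev :: "(mono \<Rightarrow> bit) \<Rightarrow> mpoly \<Rightarrow> bit" where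
  "ev f p = (\<Sum>m\<in>Poly_Mapping.keys p. f m * Poly_Mapping.lookup p m)"

(* Primitives: f with f \<cdot> Sq^i = 0 for all i > 0, where (f \<cdot> Sq^i)(p) = f(Sq^i p)
for p in (P_4)_{n-i}.  (For i > n the target degree is negative, nothing to check.) *)
definition PA :: "nat \<Rightarrow> (mono \<Rightarrow> bit) set" where
  "PA n = {f \<in> dual4 n. \<forall>i. 0 < i \<and> i \<le> n \<longrightarrow> (\<forall>p\<in>P4deg (n - i). ev f (Sq i p) = 0)}"

definition GL4 :: "bit mat set" where
  "GL4 = {g \<in> carrier_mat 4 4. invertible_mat g}"

definition gsubst :: "bit mat \<Rightarrow> mpoly \<Rightarrow> mpoly" where
  "gsubst g = subst (\<lambda>j. \<Sum>i<4. const (g $$ (i, j)) * Var i)"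

definition gact :: "(mono \<Rightarrow> bit) \<Rightarrow> bit mat \<Rightarrow> (mono \<Rightarrow> bit)" where
  "gact f g = (\<lambda>m. if m \<in> monos4 (mdeg m) then ev f (gsubst g (Poly_Mapping.single m 1)) else 0)"

definition fscale :: "bit \<Rightarrow> (mono \<Rightarrow> bit) \<Rightarrow> (mono \<Rightarrow> bit)" where
  "fscale c f = (\<lambda>m. c * f m)"

lemma vector_space_fscale: "vector_space fscale"
  by unfold_locales (auto simp: fscale_def fun_eq_iff algebra_simps)

(* dim of the coinvariants k \<otimes>_{G(4)} M = M / span{f \<cdot> g - f}: dim M minus
dim of the span of the relations. *)
definition coinv_dim :: "nat \<Rightarrow> nat" where
  "coinv_dim n = vector_space.dim fscale (PA n)
     - vector_space.dim fscale {gact f g - f | f g. f \<in> PA n \<and> g \<in> GL4}"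

end

(* Proof idea.  The degrees d_0 = 3, d_(s+1) = 2 d_s + 3 are those of the statement.  For s > 0 a
primitive functional f of degree d_s kills every monomial with exactly one odd exponent (chi-trick), so it
is determined by its four slices f_i(m) = f(X_i m^2), X_i being the product of the variables other than
x_i.  The slices are primitive of degree d_(s-1), and the only further condition is that
sum_i f_i(x_i z) = 0 for all z.  Iterating, f becomes a function F from sets S of at most s indices to
primitives of degree 3, subject to sum_i F(S + i)(x_i z) = 0 for card S < s.  Every nonzero linear form
l_S = sum_(i in S) x_i yields solutions: F(T) = g if T is contained in S and F(T) = 0 otherwise, where g
vanishes on the multiples of l_S.  GL_4 is generated by transvections, which permute these solutions, and
modulo the relations each of them is a multiple, given by an invariant functional, of the dual f_0 of the
spike x_1^(2^(s+1)-1) x_2^(2^(s+1)-1) x_3^(2^(s+1)-1).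
For s >= 3 the primitives are the direct sum of these solution spaces over all S, so the coinvariants are
spanned by f_0 and nonzero.  For s <= 2 the sum is not direct, and its relations (l_S running over the
nonzero vectors of a subspace of dimension s + 1) force f_0 to vanish.  The solutions then span a
subspace of codimension 1 for s = 1, with trivial action on the quotient, and of codimension 4 for s = 2,
where the quotient has no coinvariants. *)

theory Submission
  imports Defs
begin

section \<open>Polynomials and the total square\<close>

abbreviation mon :: "mono \<Rightarrow> mpoly" where
  "mon m \<equiv> Poly_Mapping.single m 1"

abbreviation ex :: "nat \<Rightarrow> mono" where
  "ex i \<equiv> Poly_Mapping.single i 1"

declare add_bit_eq_xor [simp del] mult_bit_eq_and [simp del] power_bit_unfold [simp del] One_nat_def [simp del]

lemma bit_add_one_one [simp]: "1 + 1 = (0::bit)"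
  by (simp add: add_bit_eq_xor)

lemma bit_self_add [simp]: "x + x = (0::bit)" "x + (x + y) = (y::bit)"
  by (cases x; cases y; simp)+

lemma mpoly_add_self [simp]: "p + p = (0::mpoly)" "p + (p + q) = (q::mpoly)"
proof -
  show "p + p = 0" by (rule poly_mapping_eqI) (simp only: lookup_add bit_self_add lookup_zero)
  then show "p + (p + q) = q" by (simp flip: add.assoc)
qed

lemma mon_add: "mon (a + b) = mon a * mon b"
  by (simp add: mult_single)

lemma Var_mon: "Var i = mon (ex i)"
  by (simp add: Var_def)

lemma mpoly_sum_mons: "p = (\<Sum>m\<in>Poly_Mapping.keys p. mon m)" for p :: mpoly
proof (rule poly_mapping_eqI)
  fix k
  have "Poly_Mapping.lookup (\<Sum>m\<in>Poly_Mapping.keys p. mon m) k = (\<Sum>m\<in>Poly_Mapping.keys p. if m = k then 1 else 0)"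
    by (simp add: lookup_sum lookup_single when_def)
  also have "\<dots> = (if k \<in> Poly_Mapping.keys p then 1 else 0)"
    by (simp add: sum.delta)
  finally show "Poly_Mapping.lookup p k = Poly_Mapping.lookup (\<Sum>m\<in>Poly_Mapping.keys p. mon m) k"
    by (simp add: in_keys_iff)
qed

lemma mpoly_induct [case_names zero mon add]:
  fixes p :: mpoly
  assumes "P 0" and "\<And>m. P (mon m)" and "\<And>p q. P p \<Longrightarrow> P q \<Longrightarrow> P (p + q)"
  shows "P p"
proof -
  have "P (\<Sum>m\<in>A. mon m)" if "finite A" for A
    using that by (induction A) (auto intro: assms)
  then show ?thesis by (subst mpoly_sum_mons) simp
qed


lemma sum_over_keys_add:
  fixes F :: "mono \<Rightarrow> bit \<Rightarrow> 'b::comm_monoid_add"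
  assumes "\<And>m. F m 0 = 0" and "\<And>m a b. F m (a + b) = F m a + F m b"
  shows "(\<Sum>m\<in>Poly_Mapping.keys (p + q). F m (Poly_Mapping.lookup (p + q) m)) =
    (\<Sum>m\<in>Poly_Mapping.keys p. F m (Poly_Mapping.lookup p m)) +
    (\<Sum>m\<in>Poly_Mapping.keys q. F m (Poly_Mapping.lookup q m))"
proof -
  let ?K = "Poly_Mapping.keys p \<union> Poly_Mapping.keys q"
  have ext: "(\<Sum>m\<in>Poly_Mapping.keys r. F m (Poly_Mapping.lookup r m)) = (\<Sum>m\<in>?K. F m (Poly_Mapping.lookup r m))"
    if "Poly_Mapping.keys r \<subseteq> ?K" for r
    using that by (intro sum.mono_neutral_left) (auto simp: in_keys_iff assms)
  show ?thesis
    by (subst (1 2 3) ext) (auto simp: lookup_add assms sum.distrib dest: keys_add[THEN subsetD])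
qed

lemma bit_add_eq_0_iff [simp]: "a + b = 0 \<longleftrightarrow> a = (b::bit)"
  by (cases a; cases b) simp_all

lemma const_add: "const (a + b) = const a + const b" and const_0 [simp]: "const 0 = 0"
  and const_1 [simp]: "const 1 = 1"
  by (auto simp: const_def single_add)

lemma ev_add: "ev f (p + q) = ev f p + ev f q"
  unfolding ev_def by (rule sum_over_keys_add) (auto simp: algebra_simps)

lemma ev_0 [simp]: "ev f 0 = 0" by (simp add: ev_def)

lemma ev_mon [simp]: "ev f (mon m) = f m" by (simp add: ev_def)

lemma ev_sum: "ev f (sum g A) = (\<Sum>x\<in>A. ev f (g x))"
  by (induction A rule: infinite_finite_induct) (auto simp: ev_add)

lemma ev_eqI: "(\<And>m. m \<in> Poly_Mapping.keys p \<Longrightarrow> f m = g m) \<Longrightarrow> ev f p = ev g p"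
  by (simp add: ev_def)

lemma ev_plus: "ev (f + g) p = ev f p + ev g p"
  by (simp add: ev_def sum.distrib algebra_simps)

lemma ev_zero_fun [simp]: "ev 0 p = 0" "ev (\<lambda>m. 0) p = 0"
  by (simp_all add: ev_def)

lemma subst_add: "subst s (p + q) = subst s p + subst s q"
  unfolding subst_def
  by (rule sum_over_keys_add[of "\<lambda>m c. const c * (\<Prod>i\<in>Poly_Mapping.keys m. s i ^ Poly_Mapping.lookup m i)"])
     (auto simp: const_add algebra_simps)

lemma subst_0 [simp]: "subst s 0 = 0" by (simp add: subst_def)

lemma subst_mon: "subst s (mon m) = (\<Prod>i\<in>Poly_Mapping.keys m. s i ^ Poly_Mapping.lookup m i)"
  by (simp add: subst_def)

lemma subst_mon_add: "subst s (mon (a + b)) = subst s (mon a) * subst s (mon b)"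
proof -
  let ?K = "Poly_Mapping.keys a \<union> Poly_Mapping.keys b"
  have ext: "(\<Prod>i\<in>Poly_Mapping.keys m. s i ^ Poly_Mapping.lookup m i) = (\<Prod>i\<in>?K. s i ^ Poly_Mapping.lookup m i)"
    if "Poly_Mapping.keys m \<subseteq> ?K" for m
    using that by (intro prod.mono_neutral_left) (auto simp: in_keys_iff)
  show ?thesis
    unfolding subst_mon
    by (subst (1 2 3) ext) (auto simp: lookup_add power_add prod.distrib dest: keys_add[THEN subsetD])
qed

lemma subst_mult: "subst s (p * q) = subst s p * subst s q"
proof (induction p rule: mpoly_induct)
  case (mon m)
  show ?case
    by (induction q rule: mpoly_induct) (simp_all add: subst_add distrib_left subst_mon_add flip: mon_add)
qed (simp_all add: subst_add distrib_right)

lemma subst_1 [simp]: "subst s 1 = 1"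
  using subst_mon[of s 0] by simp

lemma subst_power: "subst s (p ^ n) = subst s p ^ n"
  by (induction n) (auto simp: subst_mult)

lemma subst_Var [simp]: "subst s (Var i) = s i"
  by (simp add: Var_mon subst_mon)

lemma subst_sum: "subst s (sum g A) = (\<Sum>x\<in>A. subst s (g x))"
  by (induction A rule: infinite_finite_induct) (auto simp: subst_add)

lemma subst_prod: "subst s (prod g A) = (\<Prod>x\<in>A. subst s (g x))"
  by (induction A rule: infinite_finite_induct) (auto simp: subst_mult)

lemma subst_const [simp]: "subst s (const c) = const c"
  by (cases c) simp_all

lemma subst_subst: "subst s (subst t p) = subst (\<lambda>i. subst s (t i)) p"
  by (induction p rule: mpoly_induct) (simp_all add: subst_add subst_mon subst_prod subst_power)

lemma subst_cong_mon:
  "(\<And>i. i \<in> Poly_Mapping.keys m \<Longrightarrow> s i = t i) \<Longrightarrow> subst s (mon m) = subst t (mon m)"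
  by (simp add: subst_mon)

lemma square_add: "(p + q)^2 = p^2 + q^2" for p q :: mpoly
  by (simp add: power2_eq_square algebra_simps)

lemma square_sum: "(sum g A)^2 = (\<Sum>x\<in>A. (g x)^2)" for g :: "'a \<Rightarrow> mpoly"
  by (induction A rule: infinite_finite_induct) (auto simp: square_add)

lemma mon_square: "(mon m)^2 = mon (m + m)"
  by (simp add: power2_eq_square mon_add)

lemma ev_mon_square: "ev f (mon k * r^2) = ev (\<lambda>m. f (k + (m + m))) r"
  by (induction r rule: mpoly_induct)
     (simp_all add: ev_add square_add distrib_left mon_square flip: mon_add)

abbreviation four :: "mono \<Rightarrow> bool" where
  "four m \<equiv> Poly_Mapping.keys m \<subseteq> {..<4}"

lemma mdeg_eq: "four m \<Longrightarrow> mdeg m = (\<Sum>i<4. Poly_Mapping.lookup m i)"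
  unfolding mdeg_def by (rule sum.mono_neutral_left) (auto simp: in_keys_iff)

lemma mdeg_add: "mdeg (a + b) = mdeg a + mdeg b"
proof -
  let ?K = "Poly_Mapping.keys a \<union> Poly_Mapping.keys b"
  have ext: "mdeg m = (\<Sum>i\<in>?K. Poly_Mapping.lookup m i)" if "Poly_Mapping.keys m \<subseteq> ?K" for m
    unfolding mdeg_def using that by (intro sum.mono_neutral_left) (auto simp: in_keys_iff)
  show ?thesis
    by (subst (1 2 3) ext) (auto simp: lookup_add sum.distrib dest: keys_add[THEN subsetD])
qed

lemma mdeg_0 [simp]: "mdeg 0 = 0" by (simp add: mdeg_def)
lemma mdeg_ex [simp]: "mdeg (ex i) = 1" by (simp add: mdeg_def)

lemma keys_plus_nat: "Poly_Mapping.keys (a + b) = Poly_Mapping.keys a \<union> Poly_Mapping.keys b" for a b :: mono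
  by (auto simp: in_keys_iff lookup_add)

text \<open>On a functional supported in degree \<open>n\<close> the individual squares are recovered from the total square,
  since \<open>ev\<close> only sees the component of degree \<open>n\<close> (lemma \<open>ev_Sq\<close>).\<close>

definition tot :: "mpoly \<Rightarrow> mpoly" where
  "tot = subst (\<lambda>i. Var i + Var i ^ 2)"

lemma ev_component:
  assumes "f \<in> dual4 n" shows "ev f (component n p) = ev f p"
proof -
  have c: "component n p = (\<Sum>m\<in>{m\<in>Poly_Mapping.keys p. mdeg m = n}. mon m)"
    unfolding component_def by (rule sum.cong) (auto simp: in_keys_iff)
  have "ev f p = (\<Sum>m\<in>Poly_Mapping.keys p. f m)"
    unfolding ev_def by (rule sum.cong) (auto simp: in_keys_iff)
  also have "\<dots> = (\<Sum>m\<in>{m\<in>Poly_Mapping.keys p. mdeg m = n}. f m)"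
    using assms by (intro sum.mono_neutral_right) (auto simp: dual4_def monos4_def)
  finally show ?thesis by (simp add: c ev_sum)
qed

lemma ev_Sq:
  assumes "f \<in> dual4 n" "i \<le> n" "p \<in> P4deg (n - i)"
  shows "ev f (Sq i p) = ev f (tot p)"
proof -
  have "ev f (Sq i p) = (\<Sum>m\<in>Poly_Mapping.keys p. ev f (tot (Poly_Mapping.single m (Poly_Mapping.lookup p m))))"
    unfolding Sq_def ev_sum tot_def using assms
    by (intro sum.cong refl) (auto simp: P4deg_def monos4_def ev_component subset_iff)
  also have "\<dots> = (\<Sum>m\<in>Poly_Mapping.keys p. ev f (tot (mon m)))"
    by (rule sum.cong) (auto simp: in_keys_iff)
  also have "\<dots> = ev f (tot p)"
    by (subst (2) mpoly_sum_mons) (simp add: tot_def subst_sum ev_sum)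
  finally show ?thesis .
qed

lemma PA_iff:
  "f \<in> PA n \<longleftrightarrow> f \<in> dual4 n \<and> (\<forall>m. four m \<and> mdeg m < n \<longrightarrow> ev f (tot (mon m)) = 0)"
proof safe
  assume f: "f \<in> PA n"
  then show d: "f \<in> dual4 n" by (simp add: PA_def)
  fix m assume m: "four m" "mdeg m < n"
  have "mon m \<in> P4deg (n - (n - mdeg m))" using m by (simp add: P4deg_def monos4_def)
  moreover have "0 < n - mdeg m" "n - mdeg m \<le> n" using m by auto
  ultimately have "ev f (Sq (n - mdeg m) (mon m)) = 0"
    using f unfolding PA_def by blast
  then show "ev f (tot (mon m)) = 0"
    using ev_Sq[OF d, of "n - mdeg m" "mon m"] m by (simp add: P4deg_def monos4_def)
next
  assume d: "f \<in> dual4 n" and *: "\<forall>m. four m \<and> mdeg m < n \<longrightarrow> ev f (tot (mon m)) = 0"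
  have "ev f (Sq i p) = 0" if i: "0 < i" "i \<le> n" and p: "p \<in> P4deg (n - i)" for i p
  proof -
    have "ev f (Sq i p) = ev f (tot (\<Sum>m\<in>Poly_Mapping.keys p. mon m))"
      using ev_Sq[OF d i(2) p] mpoly_sum_mons[of p] by simp
    also have "\<dots> = (\<Sum>m\<in>Poly_Mapping.keys p. ev f (tot (mon m)))"
      by (simp add: tot_def subst_sum ev_sum)
    also have "\<dots> = 0"
      using p i * by (intro sum.neutral) (force simp: P4deg_def monos4_def)
    finally show ?thesis .
  qed
  with d show "f \<in> PA n" by (simp add: PA_def)
qed

section \<open>Slices of primitive functionals\<close>

declare single_one [simp del]

lemma mon_0 [simp]: "mon 0 = 1"
  by (rule single_one)

lemma mono_induct [case_names zero ex]:
  fixes m :: mono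
  assumes "P 0" and "\<And>i m. P m \<Longrightarrow> P (ex i + m)"
  shows "P m"
proof (induction "mdeg m" arbitrary: m rule: less_induct)
  case less
  show ?case
  proof (cases "m = 0")
    case False
    then obtain i where i: "Poly_Mapping.lookup m i \<noteq> 0"
      by (auto simp: poly_mapping_eq_iff fun_eq_iff)
    have m: "m = ex i + (m - ex i)"
      using i by (intro poly_mapping_eqI) (auto simp: lookup_add lookup_minus lookup_single when_def)
    then have "mdeg m = 1 + mdeg (m - ex i)"
      by (metis mdeg_add mdeg_ex)
    then have "P (m - ex i)" by (intro less) simp
    then show ?thesis by (subst m) (rule assms(2))
  qed (simp add: assms(1))
qed

lemma tot_add: "tot (p + q) = tot p + tot q" and tot_mult: "tot (p * q) = tot p * tot q"
  and tot_power: "tot (p ^ n) = tot p ^ n" and tot_sum: "tot (sum g A) = (\<Sum>x\<in>A. tot (g x))"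
  and tot_0 [simp]: "tot 0 = 0" and tot_1 [simp]: "tot 1 = 1"
  and tot_Var: "tot (Var i) = Var i + Var i ^ 2"
  by (simp_all add: tot_def subst_add subst_mult subst_power subst_sum)

lemma tot_ex: "tot (mon (ex i)) = mon (ex i) + (mon (ex i))^2"
  using tot_Var by (simp add: Var_mon)

lemma keys_mon_mult: "k \<in> Poly_Mapping.keys (mon a * p) \<Longrightarrow> \<exists>b\<in>Poly_Mapping.keys p. k = a + b"
  using keys_mult[of "mon a" p] by auto

lemma tot_mon_low: "m \<in> Poly_Mapping.keys (tot (mon w) + mon w) \<Longrightarrow> mdeg w < mdeg m"
proof (induction w arbitrary: m rule: mono_induct)
  case zero
  then show ?case by simp
next
  case (ex i w)
  let ?q = "tot (mon w) + mon w"
  have "tot (mon (ex i + w)) + mon (ex i + w) =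
      mon (ex i) * ?q + (mon (ex i + ex i) * ?q + mon (ex i + (ex i + w)))"
    by (simp add: mon_add tot_mult tot_ex power2_eq_square algebra_simps)
  then have "m \<in> Poly_Mapping.keys (mon (ex i) * ?q) \<union>
      (Poly_Mapping.keys (mon (ex i + ex i) * ?q) \<union> {ex i + (ex i + w)})"
    using ex.prems by (auto dest!: keys_add[THEN subsetD])
  then show ?case
    using ex.IH by (fastforce dest!: keys_mon_mult simp: mdeg_add)
qed

lemma tot_mon_top: "m \<in> Poly_Mapping.keys (tot (mon w) + mon (w + w)) \<Longrightarrow> mdeg m < 2 * mdeg w"
proof (induction w arbitrary: m rule: mono_induct)
  case zero
  then show ?case by simp
next
  case (ex i w)
  let ?q = "tot (mon w) + mon (w + w)"
  have "tot (mon (ex i + w)) + mon ((ex i + w) + (ex i + w)) =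
      mon (ex i) * ?q + (mon (ex i + ex i) * ?q + mon (ex i + (w + w)))"
    by (simp add: mon_add tot_mult tot_ex power2_eq_square algebra_simps)
  then have "m \<in> Poly_Mapping.keys (mon (ex i) * ?q) \<union>
      (Poly_Mapping.keys (mon (ex i + ex i) * ?q) \<union> {ex i + (w + w)})"
    using ex.prems by (auto dest!: keys_add[THEN subsetD])
  then show ?case
    using ex.IH by (fastforce dest!: keys_mon_mult simp: mdeg_add)
qed

lemma dual4_0: "f \<in> dual4 n \<Longrightarrow> \<not> (four m \<and> mdeg m = n) \<Longrightarrow> f m = 0"
  by (auto simp: dual4_def monos4_def)

lemma ev_dual4_0:
  assumes "f \<in> dual4 n" "\<And>m. m \<in> Poly_Mapping.keys p \<Longrightarrow> mdeg m \<noteq> n"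
  shows "ev f p = 0"
  using ev_eqI[of p f 0] assms by (simp add: dual4_0)

lemma ev_tot_ge:
  assumes "f \<in> dual4 n" "n \<le> mdeg m"
  shows "ev f (tot (mon m)) = f m"
proof -
  have "ev f (tot (mon m) + mon m) = 0"
    using assms tot_mon_low by (intro ev_dual4_0[OF assms(1)]) fastforce
  then show ?thesis by (simp add: ev_add)
qed

lemma frobenius_power: "(p + q) ^ (2 ^ k) = p ^ (2 ^ k) + q ^ (2 ^ k)" for p q :: mpoly
  by (induction k) (simp_all add: power_mult square_add mult.commute[of 2])

lemma Var_power: "Var a ^ n = mon (Poly_Mapping.single a n)"
  by (induction n) (simp_all add: Var_mon mult_single plus_1_eq_Suc flip: single_add)

lemma mdeg_single [simp]: "mdeg (Poly_Mapping.single a n) = n"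
  by (cases "n = 0") (simp_all add: mdeg_def)

text \<open>In the completed ring \<open>x = Sq (x + x^2 + x^4 + \<dots>)\<close>, so \<open>x * Sq z\<close> is the total square of
  \<open>(x + x^2 + x^4 + \<dots>) * z\<close>, and \<open>x * z^2\<close> is the component of \<open>x * Sq z\<close> of degree \<open>2 * deg z + 1\<close>.\<close>

lemma PA_single_odd:
  assumes f: "f \<in> PA (2 * k + 1)" and a: "a < 4" and k: "\<And>j. k + 1 \<noteq> 2 ^ j"
  shows "f (ex a + (z + z)) = 0"
proof (cases "four z \<and> mdeg z = k")
  case True
  let ?n = "2 * k + 1"
  have d: "f \<in> dual4 ?n" using f by (simp add: PA_iff)
  define T where "T = (\<Sum>j\<le>?n. Var a ^ (2 ^ j))"
  have totT: "tot T = Var a + Var a ^ (2 ^ (?n + 1))"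
  proof -
    have "tot (\<Sum>j\<le>N. Var a ^ (2 ^ j)) = Var a + Var a ^ (2 ^ Suc N)" for N
    proof (induction N)
      case (Suc N)
      have "tot (Var a ^ (2 ^ Suc N)) = Var a ^ (2 ^ Suc N) + Var a ^ (2 ^ Suc (Suc N))"
        unfolding tot_power tot_Var frobenius_power by (simp only: power_mult[symmetric] power_Suc mult.commute[of _ 2])
      then show ?case using Suc by (simp add: tot_add add.assoc)
    qed (simp add: tot_Var)
    then have "tot T = Var a + Var a ^ (2 ^ Suc ?n)" unfolding T_def .
    then show ?thesis unfolding Suc_eq_plus1 .
  qed
  have "ev f (tot (T * mon z)) = (\<Sum>j\<le>?n. ev f (tot (mon (Poly_Mapping.single a (2 ^ j) + z))))"
    unfolding T_def sum_distrib_right tot_sum ev_sum by (simp add: Var_power mon_add)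
  also have "\<dots> = 0"
  proof (rule sum.neutral, safe)
    fix j
    let ?w = "Poly_Mapping.single a (2 ^ j) + z"
    have w: "mdeg ?w = 2 ^ j + k" "four ?w" using True a by (auto simp: mdeg_add keys_plus_nat)
    show "ev f (tot (mon ?w)) = 0"
    proof (cases "mdeg ?w < ?n")
      case True
      then show ?thesis using f w by (simp add: PA_iff)
    next
      case False
      then have "ev f (tot (mon ?w)) = f ?w" using d by (intro ev_tot_ge) auto
      also have "\<dots> = 0" using d k[of j] w by (intro dual4_0[of f ?n]) auto
      finally show ?thesis .
    qed
  qed
  finally have "ev f (Var a * tot (mon z)) + ev f (Var a ^ (2 ^ (?n + 1)) * tot (mon z)) = 0"
    by (simp add: tot_mult totT ev_add distrib_right)
  moreover have "ev f (Var a ^ (2 ^ (?n + 1)) * tot (mon z)) = 0"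
  proof (rule ev_dual4_0[OF d])
    fix m assume "m \<in> Poly_Mapping.keys (Var a ^ (2 ^ (?n + 1)) * tot (mon z))"
    then obtain b where "m = Poly_Mapping.single a (2 ^ (?n + 1)) + b"
      unfolding Var_power using keys_mon_mult by blast
    then have "2 ^ (?n + 1) \<le> mdeg m" by (simp add: mdeg_add)
    moreover have "?n + 1 < 2 ^ (?n + 1)" by (rule less_exp)
    ultimately show "mdeg m \<noteq> ?n" by linarith
  qed
  moreover have "ev f (Var a * (tot (mon z) + mon (z + z))) = 0"
    using True by (intro ev_dual4_0[OF d]) (auto simp: Var_mon mdeg_add dest!: keys_mon_mult tot_mon_top)
  ultimately have "ev f (Var a * mon (z + z)) = 0"
    by (simp add: distrib_left ev_add)
  then show ?thesis by (simp add: Var_mon flip: mon_add)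
next
  case False
  have "f \<in> dual4 (2 * k + 1)" using f by (simp add: PA_iff)
  then show ?thesis
    using False by (intro dual4_0) (auto simp: mdeg_add keys_plus_nat)
qed

definition quad :: "nat \<Rightarrow> nat \<Rightarrow> nat \<Rightarrow> nat \<Rightarrow> bool" where
  "quad a b c d \<longleftrightarrow> distinct [a, b, c, d] \<and> {..<4} = {a, b, c, d}"

lemma quad_exists2: "a < 4 \<Longrightarrow> b < 4 \<Longrightarrow> a \<noteq> b \<Longrightarrow> \<exists>c d. quad a b c d"
proof -
  assume "a < 4" "b < 4" "a \<noteq> b"
  then have "card ({..<4} - {a, b}) = 2" by (subst card_Diff_subset) auto
  then obtain c d where "{..<4} - {a, b} = {c, d}" "c \<noteq> d" by (auto simp: card_2_iff)
  moreover have "{..<4} = {a, b} \<union> ({..<4} - {a, b})" using \<open>a < 4\<close> \<open>b < 4\<close> by auto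
  moreover have "c \<notin> {a, b}" "d \<notin> {a, b}" using calculation(1) by blast+
  ultimately have "quad a b c d" using \<open>a \<noteq> b\<close> unfolding quad_def by auto
  then show ?thesis by blast
qed

lemma quad_exists1: "a < 4 \<Longrightarrow> \<exists>b c d. quad a b c d"
  using quad_exists2[of a 0] quad_exists2[of a 1] by (cases "a = 0") auto

lemma quad_exists3:
  assumes "a < 4" "b < 4" "c < 4" "a \<noteq> b" "a \<noteq> c" "b \<noteq> c"
  shows "\<exists>d. quad a b c d"
proof -
  obtain x y where q: "quad a b x y" using quad_exists2 assms by blast
  then have "c = x \<or> c = y" using assms by (auto simp: quad_def set_eq_iff)
  moreover have "quad a b y x" using q by (auto simp: quad_def)
  ultimately show ?thesis using q by blast
qed

lemma quadD:
  assumes "quad a b c d"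
  shows "a < 4" "b < 4" "c < 4" "d < 4" "a \<noteq> b" "a \<noteq> c" "a \<noteq> d" "b \<noteq> c" "b \<noteq> d" "c \<noteq> d"
    "b \<noteq> a" "c \<noteq> a" "d \<noteq> a" "c \<noteq> b" "d \<noteq> b" "d \<noteq> c"
  using assms by (auto simp: quad_def)

lemma quad_perm:
  assumes "quad a b c d"
  shows "quad a b d c" "quad a c b d" "quad b a c d" "quad a c d b" "quad a d b c" "quad a d c b"
    "quad b a d c" "quad b c a d" "quad b c d a" "quad b d a c" "quad b d c a"
    "quad c a b d" "quad c a d b" "quad c b a d" "quad c b d a" "quad c d a b" "quad c d b a"
    "quad d a b c" "quad d a c b" "quad d b a c" "quad d b c a" "quad d c a b" "quad d c b a"
  using assms by (auto simp: quad_def)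

lemma quad_cases: "quad a b c d \<Longrightarrow> i < 4 \<longleftrightarrow> i = a \<or> i = b \<or> i = c \<or> i = d"
  by (auto simp: quad_def set_eq_iff)

lemma quad_sum:
  assumes "quad a b c d"
  shows "(\<Sum>i<4. g i) = g a + (g b + (g c + g d))"
  using assms by (auto simp: quad_def)

definition X3 :: "nat \<Rightarrow> mono" where
  "X3 i = (\<Sum>j\<in>{..<4}-{i}. ex j)"

lemma X3_quad:
  assumes "quad a b c d" shows "X3 d = ex a + (ex b + ex c)"
proof -
  have "{..<4} - {d} = {a, b, c}" using assms by (auto simp: quad_def)
  then show ?thesis using quadD[OF assms] by (simp add: X3_def)
qed

lemma lookup_X3: "i < 4 \<Longrightarrow> Poly_Mapping.lookup (X3 i) j = (if j < 4 \<and> j \<noteq> i then 1 else 0)"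
  by (auto simp: X3_def lookup_sum lookup_single when_def sum.delta)

lemma four_X3: "four (X3 i)"
  unfolding X3_def by (rule order.trans[OF keys_sum]) auto

lemma mdeg_X3: "i < 4 \<Longrightarrow> mdeg (X3 i) = 3"
proof -
  assume "i < 4"
  then obtain b c d where "quad i b c d" using quad_exists1 by blast
  then have q: "quad b c d i" by (rule quad_perm)
  show ?thesis by (simp add: X3_quad[OF q] mdeg_add)
qed

definition slice :: "nat \<Rightarrow> (mono \<Rightarrow> bit) \<Rightarrow> mono \<Rightarrow> bit" where
  "slice i f = (\<lambda>m. f (X3 i + (m + m)))"

definition all4 :: mono where "all4 = (\<Sum>i<4. ex i)"

lemma all4_quad: "quad a b c d \<Longrightarrow> all4 = ex a + (ex b + (ex c + ex d))"
  unfolding all4_def by (rule quad_sum)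

lemma mdeg_all4 [simp]: "mdeg all4 = 4"
proof -
  obtain b c d where q: "quad 0 b c d" using quad_exists1[of 0] by auto
  show ?thesis by (simp add: all4_quad[OF q] mdeg_add)
qed

lemma four_cases:
  assumes "four m"
  obtains (even) y where "four y" "m = y + y"
  | (one) a y where "a < 4" "four y" "m = ex a + (y + y)"
  | (two) a b c d y where "quad a b c d" "four y" "m = ex a + (ex b + (y + y))"
  | (three) i y where "i < 4" "four y" "m = X3 i + (y + y)"
  | (four) y where "four y" "m = all4 + (y + y)"
proof -
  define y where "y = (\<Sum>i<4. Poly_Mapping.single i (Poly_Mapping.lookup m i div 2))"
  define D where "D = {i. i < 4 \<and> odd (Poly_Mapping.lookup m i)}"
  have y4: "four y" unfolding y_def by (rule order.trans[OF keys_sum]) auto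
  have ly: "Poly_Mapping.lookup y i = Poly_Mapping.lookup m i div 2" for i
  proof -
    have "Poly_Mapping.lookup m i = 0" if "\<not> i < 4" using assms that by (auto simp: in_keys_iff)
    then show ?thesis by (simp add: y_def lookup_sum lookup_single when_def sum.delta)
  qed
  have m: "m = (\<Sum>i\<in>D. ex i) + (y + y)"
  proof (rule poly_mapping_eqI)
    fix i
    have "finite D" by (simp add: D_def)
    then have "Poly_Mapping.lookup (\<Sum>i\<in>D. ex i) i = of_bool (i \<in> D)"
      by (simp add: lookup_sum lookup_single when_def sum.delta)
    moreover have "Poly_Mapping.lookup m i = 0" if "\<not> i < 4"
      using assms that by (auto simp: in_keys_iff)
    ultimately show "Poly_Mapping.lookup m i = Poly_Mapping.lookup ((\<Sum>i\<in>D. ex i) + (y + y)) i"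
      by (auto simp: lookup_add ly D_def) presburger+
  qed
  have D: "D \<subseteq> {..<4}" by (auto simp: D_def)
  have "card D \<le> 4" using card_mono[OF _ D] by simp
  then consider "card D = 0" | "card D = 1" | "card D = 2" | "card D = 3" | "card D = 4" by linarith
  then show ?thesis
  proof cases
    case 1
    then have "D = {}" using D finite_subset[OF D] by simp
    then show ?thesis using m y4 even by simp
  next
    case 2
    then obtain a where "D = {a}" by (rule card_1_singletonE)
    then show ?thesis using m y4 one[of a y] D by simp
  next
    case 3
    then obtain a b where ab: "D = {a, b}" "a \<noteq> b" by (auto simp: card_2_iff)
    then obtain c d where "quad a b c d" using quad_exists2[of a b] D by auto
    then show ?thesis using m y4 two[of a b c d y] ab by (simp add: add.assoc)
  next
    case 4
    then have "card ({..<4} - D) = 1" using D by (subst card_Diff_subset) (auto intro: finite_subset)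
    then obtain i where i: "{..<4} - D = {i}" by (rule card_1_singletonE)
    then have "D = {..<4} - {i}" "i < 4" using D by auto
    then show ?thesis using m y4 three[of i y] by (simp add: X3_def)
  next
    case 5
    then have "D = {..<4}" using D by (intro card_subset_eq) auto
    then show ?thesis using m y4 four[of y] by (simp add: all4_def)
  qed
qed

text \<open>The odd degree makes every monomial with an even number of odd exponents invisible, so only the
  monomials \<open>X3 i * y^2\<close> contribute to \<open>good\<close> functionals.\<close>

definition good :: "(mono \<Rightarrow> bit) \<Rightarrow> bool" where
  "good f \<longleftrightarrow> (\<exists>k. f \<in> dual4 (2 * k + 3)) \<and> (\<forall>a z. a < 4 \<longrightarrow> f (ex a + (z + z)) = 0)"

lemma good_even: "good f \<Longrightarrow> even (mdeg m) \<Longrightarrow> f m = 0"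
  unfolding good_def by (metis dual4_0 even_add even_mult_iff even_numeral odd_numeral)

lemma good_ev:
  assumes "good f"
  shows "ev f (r^2) = 0" "a < 4 \<Longrightarrow> ev f (mon (ex a) * r^2) = 0"
    "ev f (mon (ex a) * mon (ex b) * r^2) = 0"
    "ev f (mon (ex a) * mon (ex b) * mon (ex c) * mon (ex d) * r^2) = 0"
    "quad a b c d \<Longrightarrow> ev f (mon (ex a) * mon (ex b) * mon (ex c) * r^2) = ev (slice d f) r"
proof -
  show "ev f (r^2) = 0"
    using ev_mon_square[of f 0 r] assms by (simp add: good_even mdeg_add)
  show "a < 4 \<Longrightarrow> ev f (mon (ex a) * r^2) = 0"
    using ev_mon_square[of f "ex a" r] assms by (simp add: good_def)
  show "ev f (mon (ex a) * mon (ex b) * r^2) = 0"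
    using ev_mon_square[of f "ex a + ex b" r] assms by (simp add: good_even mdeg_add mon_add)
  show "ev f (mon (ex a) * mon (ex b) * mon (ex c) * mon (ex d) * r^2) = 0"
    using ev_mon_square[of f "ex a + ex b + ex c + ex d" r] assms by (simp add: good_even mdeg_add mon_add)
  show "ev f (mon (ex a) * mon (ex b) * mon (ex c) * r^2) = ev (slice d f) r" if "quad a b c d"
    using ev_mon_square[of f "ex a + ex b + ex c" r] X3_quad[OF that]
    by (simp add: slice_def mon_add add.assoc mult.assoc)
qed

lemma expand3:
  fixes a b c r :: "'a::comm_ring_1"
  shows "(a + a^2) * (b + b^2) * (c + c^2) * r^2 = a * b * c * r^2 + a * b * (c * r)^2 + a * c * (b * r)^2
      + b * c * (a * r)^2 + a * (b * c * r)^2 + b * (a * c * r)^2 + c * (a * b * r)^2 + (a * b * c * r)^2"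
  by (simp add: power2_eq_square algebra_simps)

lemma expand4:
  fixes a b c d r :: "'a::comm_ring_1"
  shows "(a + a^2) * (b + b^2) * (c + c^2) * (d + d^2) * r^2 =
      a * b * c * d * r^2 + a * b * c * (d * r)^2 + a * b * d * (c * r)^2
      + a * c * d * (b * r)^2 + b * c * d * (a * r)^2
      + a * b * (c * d * r)^2 + a * c * (b * d * r)^2 + a * d * (b * c * r)^2
      + b * c * (a * d * r)^2 + b * d * (a * c * r)^2 + c * d * (a * b * r)^2
      + a * (b * c * d * r)^2 + b * (a * c * d * r)^2
      + c * (a * b * d * r)^2 + d * (a * b * c * r)^2 + (a * b * c * d * r)^2"
  by (simp add: power2_eq_square algebra_simps)

lemma good_ev_X3:
  assumes f: "good f" and i: "i < 4"
  shows "ev f (tot (mon (X3 i + (y + y)))) = ev (slice i f) (tot (mon y))"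
proof -
  obtain a b c where q: "quad a b c i" using quad_exists1[OF i] quad_perm by blast
  note q' = quadD[OF q]
  define x where "x j = mon (ex j)" for j
  define r where "r = tot (mon y)"
  have "tot (mon (X3 i + (y + y))) = (x a + (x a)^2) * (x b + (x b)^2) * (x c + (x c)^2) * r^2"
    by (simp add: X3_quad[OF q] mon_add tot_mult tot_ex x_def r_def power2_eq_square mult.assoc)
  also have "\<dots> = x a * x b * x c * r^2 + x a * x b * (x c * r)^2 + x a * x c * (x b * r)^2
      + x b * x c * (x a * r)^2 + x a * (x b * x c * r)^2 + x b * (x a * x c * r)^2
      + x c * (x a * x b * r)^2 + (x a * x b * x c * r)^2"
    by (rule expand3)
  also have "ev f \<dots> = ev (slice i f) r"
    unfolding ev_add x_def good_ev(1)[OF f] good_ev(3)[OF f] good_ev(2)[OF f q'(1)]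
      good_ev(2)[OF f q'(2)] good_ev(2)[OF f q'(3)] good_ev(5)[OF f q] by simp
  finally show ?thesis by (simp add: r_def)
qed

lemma good_ev_all4:
  assumes f: "good f"
  shows "ev f (tot (mon (all4 + (y + y)))) = (\<Sum>i<4. ev (slice i f) (mon (ex i) * tot (mon y)))"
proof -
  obtain a b c d where q: "quad a b c d" using quad_exists1[of 0] by auto
  note q' = quadD[OF q]
  define x where "x j = mon (ex j)" for j
  define r where "r = tot (mon y)"
  have "tot (mon (all4 + (y + y))) =
      (x a + (x a)^2) * (x b + (x b)^2) * (x c + (x c)^2) * (x d + (x d)^2) * r^2"
    by (simp add: all4_quad[OF q] mon_add tot_mult tot_ex x_def r_def power2_eq_square mult.assoc)
  also have "\<dots> = x a * x b * x c * x d * r^2 + x a * x b * x c * (x d * r)^2 + x a * x b * x d * (x c * r)^2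
      + x a * x c * x d * (x b * r)^2 + x b * x c * x d * (x a * r)^2
      + x a * x b * (x c * x d * r)^2 + x a * x c * (x b * x d * r)^2 + x a * x d * (x b * x c * r)^2
      + x b * x c * (x a * x d * r)^2 + x b * x d * (x a * x c * r)^2 + x c * x d * (x a * x b * r)^2
      + x a * (x b * x c * x d * r)^2 + x b * (x a * x c * x d * r)^2
      + x c * (x a * x b * x d * r)^2 + x d * (x a * x b * x c * r)^2 + (x a * x b * x c * x d * r)^2"
    by (rule expand4)
  also have "ev f \<dots> = (\<Sum>i<4. ev (slice i f) (mon (ex i) * r))"
    unfolding ev_add x_def good_ev(1)[OF f] good_ev(3,4)[OF f] good_ev(2)[OF f q'(1)]
      good_ev(2)[OF f q'(2)] good_ev(2)[OF f q'(3)] good_ev(2)[OF f q'(4)] good_ev(5)[OF f q]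
      good_ev(5)[OF f quad_perm(1)[OF q]] good_ev(5)[OF f quad_perm(4)[OF q]] good_ev(5)[OF f quad_perm(9)[OF q]]
      quad_sum[OF q] by (simp add: ac_simps)
  finally show ?thesis by (simp add: r_def)
qed

lemma good_ev_even:
  assumes f: "good f"
  shows "ev f (tot (mon (y + y))) = 0"
    "a < 4 \<Longrightarrow> ev f (tot (mon (ex a + (y + y)))) = 0"
    "a < 4 \<Longrightarrow> b < 4 \<Longrightarrow> ev f (tot (mon (ex a + (ex b + (y + y))))) = 0"
proof -
  define x where "x j = mon (ex j)" for j
  define r where "r = tot (mon y)"
  show "ev f (tot (mon (y + y))) = 0"
    using good_ev(1)[OF f, of r] by (simp add: mon_add tot_mult r_def power2_eq_square)
  have "tot (mon (ex a + (y + y))) = x a * r^2 + (x a * r)^2"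
    by (simp add: mon_add tot_mult r_def x_def tot_ex power2_eq_square algebra_simps)
  then show "a < 4 \<Longrightarrow> ev f (tot (mon (ex a + (y + y)))) = 0"
    using good_ev(1,2)[OF f] by (simp add: ev_add x_def)
  have "tot (mon (ex a + (ex b + (y + y)))) = x a * x b * r^2 + x a * (x b * r)^2 + x b * (x a * r)^2 + (x a * x b * r)^2"
    by (simp add: mon_add tot_mult r_def x_def tot_ex power2_eq_square algebra_simps)
  then show "a < 4 \<Longrightarrow> b < 4 \<Longrightarrow> ev f (tot (mon (ex a + (ex b + (y + y))))) = 0"
    using good_ev(1,2,3)[OF f] by (simp add: ev_add x_def)
qed

definition Glue :: "(nat \<Rightarrow> mono \<Rightarrow> bit) \<Rightarrow> bool" where
  "Glue h \<longleftrightarrow> (\<forall>z. (\<Sum>i<4. h i (ex i + z)) = 0)"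

lemma Glue_ev:
  assumes "Glue h" shows "(\<Sum>i<4. ev (h i) (mon (ex i) * p)) = 0"
proof (induction p rule: mpoly_induct)
  case (mon m)
  then show ?case using assms by (simp add: Glue_def flip: mon_add)
qed (simp_all add: distrib_left ev_add sum.distrib)

lemma PA_step:
  assumes k: "\<And>j. k + 2 \<noteq> 2 ^ j"
  shows "f \<in> PA (2 * k + 3) \<longleftrightarrow> f \<in> dual4 (2 * k + 3) \<and> (\<forall>a z. a < 4 \<longrightarrow> f (ex a + (z + z)) = 0)
    \<and> (\<forall>i<4. slice i f \<in> PA k) \<and> Glue (\<lambda>i. slice i f)" (is "_ \<longleftrightarrow> ?R")
proof
  assume f: "f \<in> PA (2 * k + 3)"
  let ?n = "2 * k + 3"
  have d: "f \<in> dual4 ?n" using f by (simp add: PA_iff)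
  have s: "f (ex a + (z + z)) = 0" if "a < 4" for a z
  proof -
    have "2 * (k + 1) + 1 = 2 * k + 3" "k + 1 + 1 = k + 2" by simp_all
    then show ?thesis using PA_single_odd[of f "k + 1" a z] f k that by metis
  qed
  have g: "good f" using d s by (auto simp: good_def)
  have dc: "slice i f \<in> dual4 k" if "i < 4" for i
    using that d unfolding dual4_def slice_def monos4_def
    by (auto simp: mdeg_add mdeg_X3 keys_plus_nat)
  have c: "slice i f \<in> PA k" if i: "i < 4" for i
    unfolding PA_iff
  proof (intro conjI allI impI)
    fix m assume "four m \<and> mdeg m < k"
    then have "four (X3 i + (m + m)) \<and> mdeg (X3 i + (m + m)) < ?n"
      using i four_X3 by (auto simp: keys_plus_nat mdeg_add mdeg_X3)
    then have "ev f (tot (mon (X3 i + (m + m)))) = 0" using f by (simp add: PA_iff)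
    then show "ev (slice i f) (tot (mon m)) = 0" by (simp add: good_ev_X3[OF g i])
  qed (rule dc[OF i])
  have "Glue (\<lambda>i. slice i f)"
    unfolding Glue_def
  proof
    fix z
    show "(\<Sum>i<4. slice i f (ex i + z)) = 0"
    proof (cases "four z \<and> mdeg z + 1 = k")
      case True
      have "four all4" unfolding all4_def by (rule order.trans[OF keys_sum]) auto
      then have z4: "four (all4 + (z + z))" using True by (auto simp: keys_plus_nat)
      then have "mdeg (all4 + (z + z)) < ?n" using True by (auto simp: mdeg_add)
      then have "ev f (tot (mon (all4 + (z + z)))) = 0" using f z4 unfolding PA_iff by blast
      then have "(\<Sum>i<4. ev (slice i f) (mon (ex i) * tot (mon z))) = 0"
        by (simp add: good_ev_all4[OF g])
      moreover have "ev (slice i f) (mon (ex i) * tot (mon z)) = slice i f (ex i + z)" if "i < 4" for i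
      proof -
        have "ev (slice i f) (mon (ex i) * (tot (mon z) + mon z)) = 0"
          using True by (intro ev_dual4_0[OF dc[OF that]]) (auto simp: mdeg_add dest!: keys_mon_mult tot_mon_low)
        then show ?thesis
          by (simp add: distrib_left ev_add flip: mon_add)
      qed
      ultimately show ?thesis by simp
    next
      case False
      then have "slice i f (ex i + z) = 0" if "i < 4" for i
        using that by (intro dual4_0[OF dc[OF that]]) (auto simp: keys_plus_nat mdeg_add)
      then show ?thesis by simp
    qed
  qed
  then show ?R using d s c by blast
next
  assume r: ?R
  then have g: "good f" by (auto simp: good_def)
  show "f \<in> PA (2 * k + 3)"
    unfolding PA_iff
  proof (intro conjI allI impI)
    show "f \<in> dual4 (2 * k + 3)" using r by blast
    fix m assume m: "four m \<and> mdeg m < 2 * k + 3"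
    then have "four m" by simp
    then show "ev f (tot (mon m)) = 0"
    proof (cases rule: four_cases)
      case (three i y)
      then have "mdeg y < k" using m by (simp add: mdeg_add mdeg_X3)
      then show ?thesis using r three by (simp add: good_ev_X3[OF g] PA_iff)
    next
      case (four y)
      then show ?thesis using Glue_ev[of "\<lambda>i. slice i f"] r by (simp add: good_ev_all4[OF g])
    qed (use good_ev_even[OF g] quadD in auto)
  qed
qed

lemma good_eqI:
  assumes "good f" "good g" "\<And>i. i < 4 \<Longrightarrow> slice i f = slice i g"
  shows "f = g"
proof
  fix m
  show "f m = g m"
  proof (cases "four m")
    case True
    then show ?thesis
    proof (cases rule: four_cases)
      case (three i y)
      then show ?thesis using assms(3)[of i] by (auto simp: slice_def dest: fun_cong)
    next
      case (four y)
      then show ?thesis using four assms by (simp add: good_even mdeg_add)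
    next
      case (one a y)
      then show ?thesis using assms by (simp add: good_def)
    qed (use assms in \<open>auto simp: good_even mdeg_add\<close>)
  next
    case False
    then show ?thesis using assms(1,2) unfolding good_def by (metis dual4_0)
  qed
qed

definition glue :: "(nat \<Rightarrow> mono \<Rightarrow> bit) \<Rightarrow> mono \<Rightarrow> bit" where
  "glue h m = (\<Sum>i<4. if m \<in> range (\<lambda>y. X3 i + (y + y)) then h i (inv_into UNIV (\<lambda>y. X3 i + (y + y)) m) else 0)"

lemma inj_X3: "inj (\<lambda>y. X3 i + (y + y))"
proof (rule injI)
  fix y z :: mono assume "X3 i + (y + y) = X3 i + (z + z)"
  then have "y + y = z + z" by simp
  then have "Poly_Mapping.lookup y j + Poly_Mapping.lookup y j = Poly_Mapping.lookup z j + Poly_Mapping.lookup z j" for j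
    by (metis lookup_add)
  then show "y = z" by (intro poly_mapping_eqI) (metis mult_2 mult_cancel1 zero_neq_numeral)
qed

lemma X3_parity:
  assumes "X3 i + (y + y) = X3 j + (z + z)" "i < 4" "j < 4" shows "i = j"
proof (rule ccontr)
  assume "i \<noteq> j"
  have "Poly_Mapping.lookup (X3 i + (y + y)) i = Poly_Mapping.lookup (X3 j + (z + z)) i"
    using assms by simp
  then have "2 * Poly_Mapping.lookup y i = 2 * Poly_Mapping.lookup z i + 1"
    using assms(2,3) \<open>i \<noteq> j\<close> unfolding lookup_add lookup_X3[OF assms(2)] lookup_X3[OF assms(3)] by simp
  then show False by presburger
qed

lemma slice_glue: "i < 4 \<Longrightarrow> slice i (glue h) = h i"
proof
  fix m assume i: "i < 4"
  have "slice i (glue h) m = (\<Sum>j<4. if j = i then h i m else 0)"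
    unfolding slice_def glue_def using i
    by (intro sum.cong refl) (auto simp: inv_f_f[OF inj_X3] dest: X3_parity)
  then show "slice i (glue h) m = h i m" using i by simp
qed

lemma glue_dual4:
  assumes "\<And>i. i < 4 \<Longrightarrow> h i \<in> dual4 k" shows "glue h \<in> dual4 (2 * k + 3)"
proof -
  have "glue h m = 0" if m: "m \<notin> monos4 (2 * k + 3)" for m
    unfolding glue_def
  proof (intro sum.neutral ballI)
    fix i :: nat assume "i \<in> {..<4}"
    then have i: "i < 4" by simp
    show "(if m \<in> range (\<lambda>y. X3 i + (y + y)) then h i (inv_into UNIV (\<lambda>y. X3 i + (y + y)) m) else 0) = 0"
    proof (cases "m \<in> range (\<lambda>y. X3 i + (y + y))")
      case True
      then obtain y where y: "m = X3 i + (y + y)" by blast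
      then have "\<not> (four y \<and> mdeg y = k)"
        using m i four_X3 by (auto simp: monos4_def mdeg_add mdeg_X3 keys_plus_nat)
      then have "h i y = 0" using assms[OF i] by (rule dual4_0[rotated])
      then show ?thesis using y by (simp add: inv_f_f[OF inj_X3])
    qed simp
  qed
  then show ?thesis by (simp add: dual4_def)
qed

lemma glue_single: "a < 4 \<Longrightarrow> glue h (ex a + (z + z)) = 0"
  unfolding glue_def
proof (intro sum.neutral ballI)
  fix i :: nat assume i: "i \<in> {..<4}" and a: "a < 4"
  obtain j where j: "j < 4" "j \<noteq> a" "j \<noteq> i"
  proof -
    have "card {a, i} \<le> 2" by (cases "a = i") auto
    then have "\<not> {..<4} \<subseteq> {a, i}" using card_mono[of "{a, i}" "{..<4::nat}"] by auto
    then show ?thesis using that by blast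
  qed
  have "ex a + (z + z) \<noteq> X3 i + (y + y)" for y
  proof
    assume "ex a + (z + z) = X3 i + (y + y)"
    then have "Poly_Mapping.lookup (ex a + (z + z)) j = Poly_Mapping.lookup (X3 i + (y + y)) j" by simp
    then have "2 * Poly_Mapping.lookup z j = 2 * Poly_Mapping.lookup y j + 1"
      using i j by (simp add: lookup_add lookup_X3 lookup_single)
    then show False by presburger
  qed
  then show "(if ex a + (z + z) \<in> range (\<lambda>y. X3 i + (y + y)) then h i (inv_into UNIV (\<lambda>y. X3 i + (y + y)) (ex a + (z + z))) else 0) = 0"
    by auto
qed

lemma glue_PA:
  assumes k: "\<And>j. k + 2 \<noteq> 2 ^ j" and h: "\<And>i. i < 4 \<Longrightarrow> h i \<in> PA k" and "Glue h"
  shows "glue h \<in> PA (2 * k + 3)"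
proof -
  have "glue h \<in> dual4 (2 * k + 3)" using h by (intro glue_dual4) (simp add: PA_iff)
  moreover have "Glue (\<lambda>i. slice i (glue h))" using assms(3) by (simp add: Glue_def slice_glue)
  ultimately show ?thesis
    by (simp add: PA_step[OF k] glue_single slice_glue h)
qed

section \<open>The solutions attached to linear forms\<close>

fun dg :: "nat \<Rightarrow> nat" where
  "dg 0 = 3" | "dg (Suc s) = 2 * dg s + 3"

lemma dg_eq: "dg s + 3 = 3 * 2 ^ (s + 1)"
  by (induction s) auto

declare dg.simps(2) [simp del]

lemma dg_not_power: "dg s + 2 \<noteq> 2 ^ j"
proof
  assume "dg s + 2 = 2 ^ j"
  then have j: "2 ^ j + 1 = (3 * 2 ^ (s + 1) :: nat)" using dg_eq[of s] by linarith
  have "even (3 * 2 ^ (s + 1) :: nat)" by simp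
  then have "odd (2 ^ j :: nat)" unfolding j[symmetric] by simp
  then have "j = 0" by simp
  then have "3 * 2 ^ (s + 1) = (2 :: nat)" using j by simp
  moreover have "(2::nat) ^ 1 \<le> 2 ^ (s + 1)" by (intro power_increasing) auto
  ultimately show False by simp
qed

abbreviation V :: "nat \<Rightarrow> (mono \<Rightarrow> bit) set" where
  "V s \<equiv> PA (dg s)"

lemma V_Suc: "f \<in> V (Suc s) \<longleftrightarrow> f \<in> dual4 (dg (Suc s)) \<and> (\<forall>a z. a < 4 \<longrightarrow> f (ex a + (z + z)) = 0)
    \<and> (\<forall>i<4. slice i f \<in> V s) \<and> Glue (\<lambda>i. slice i f)"
  using PA_step[of "dg s" f] dg_not_power by (simp add: dg.simps)

lemma V_good: "f \<in> V (Suc s) \<Longrightarrow> good f"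
  unfolding good_def V_Suc by (auto simp: dg.simps)

lemma V_slice: "f \<in> V (Suc s) \<Longrightarrow> i < 4 \<Longrightarrow> slice i f \<in> V s"
  by (simp add: V_Suc)

lemma V_Glue: "f \<in> V (Suc s) \<Longrightarrow> Glue (\<lambda>i. slice i f)"
  by (simp add: V_Suc)

lemma glue_V: "(\<And>i. i < 4 \<Longrightarrow> h i \<in> V s) \<Longrightarrow> Glue h \<Longrightarrow> glue h \<in> V (Suc s)"
  using glue_PA[of "dg s" h] dg_not_power by (simp add: dg.simps)

lemma V_eqI:
  assumes "f \<in> V (Suc s)" "g \<in> V (Suc s)" "\<And>i. i < 4 \<Longrightarrow> slice i f = slice i g"
  shows "f = g"
  using good_eqI[OF V_good[OF assms(1)] V_good[OF assms(2)]] assms(3) by blast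

lemma PA_add: "f \<in> PA n \<Longrightarrow> g \<in> PA n \<Longrightarrow> f + g \<in> PA n"
  unfolding PA_iff by (auto simp: dual4_def ev_plus)

lemma PA_0 [simp]: "0 \<in> PA n"
  unfolding PA_iff by (auto simp: dual4_def)

lemma slice_add: "slice i (f + g) = slice i f + slice i g"
  by (simp add: slice_def fun_eq_iff)

lemma slice_0 [simp]: "slice i 0 = 0"
  by (simp add: slice_def fun_eq_iff)

lemma good_nonfour: "good f \<Longrightarrow> \<not> four m \<Longrightarrow> f m = 0"
  unfolding good_def by (metis dual4_0)

lemma good_two:
  assumes f: "good f" and q: "quad a b c d"
  shows "f (ex a + (ex a + (ex b + (y + y)))) = 0" "f (ex b + (ex a + (ex b + (y + y)))) = 0"
    "f (ex c + (ex a + (ex b + (y + y)))) = slice d f y"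
proof -
  have "ex a + (ex a + (ex b + (y + y))) = ex b + ((ex a + y) + (ex a + y))"
    "ex b + (ex a + (ex b + (y + y))) = ex a + ((ex b + y) + (ex b + y))" by (simp_all add: ac_simps)
  then show "f (ex a + (ex a + (ex b + (y + y)))) = 0" "f (ex b + (ex a + (ex b + (y + y)))) = 0"
    using f quadD[OF q] unfolding good_def by metis+
  show "f (ex c + (ex a + (ex b + (y + y)))) = slice d f y"
    by (simp add: slice_def X3_quad[OF quad_perm(13)[OF q]] X3_quad[OF q] ac_simps)
qed

text \<open>Sorting \<open>z\<close> by the parities of its exponents turns the gluing condition into symmetry of the iterated
  slices together with the same condition one level down.\<close>

lemma Glue_iff:
  assumes h: "\<And>i. i < 4 \<Longrightarrow> good (h i)"
  shows "Glue h \<longleftrightarrow> (\<forall>c<4. \<forall>d<4. c \<noteq> d \<longrightarrow> slice d (h c) = slice c (h d)) \<and> Glue (\<lambda>i. slice i (h i))"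
    (is "_ \<longleftrightarrow> ?S \<and> ?G")
proof -
  have two: "(\<Sum>i<4. h i (ex i + (ex a + (ex b + (y + y))))) = slice d (h c) y + slice c (h d) y"
    if q: "quad a b c d" for a b c d y
    unfolding quad_sum[OF q]
    using good_two[OF h q, of a y] good_two[OF h q, of b y] good_two[OF h q, of c y]
      good_two[OF h quad_perm(1)[OF q], of d y] quadD[OF q] by simp
  have four: "(\<Sum>i<4. h i (ex i + (all4 + (y + y)))) = (\<Sum>i<4. slice i (h i) (ex i + y))" for y
  proof (rule sum.cong)
    fix i :: nat assume "i \<in> {..<4}"
    then have "all4 = ex i + X3 i" unfolding all4_def X3_def by (subst sum.remove[of _ i]) auto
    then show "h i (ex i + (all4 + (y + y))) = slice i (h i) (ex i + y)"
      by (simp add: slice_def ac_simps)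
  qed simp
  note sums = two four
  show ?thesis
  proof
    assume g: "Glue h"
    have ?S
    proof (intro allI impI)
      fix c d :: nat assume "c < 4" "d < 4" "c \<noteq> d"
      then obtain a b where "quad c d a b" using quad_exists2 by blast
      then have q: "quad a b c d" by (rule quad_perm)
      show "slice d (h c) = slice c (h d)"
      proof
        fix y show "slice d (h c) y = slice c (h d) y"
          using g two[OF q, of y] unfolding Glue_def by simp
      qed
    qed
    moreover have ?G using g four unfolding Glue_def by simp
    ultimately show "?S \<and> ?G" ..
  next
    assume r: "?S \<and> ?G"
    show "Glue h"
      unfolding Glue_def
    proof
      fix z
      show "(\<Sum>i<4. h i (ex i + z)) = 0"
      proof (cases "four z")
        case True
        then show ?thesis
        proof (cases rule: four_cases)
          case (even y)
          then show ?thesis using h by (intro sum.neutral) (auto simp: good_def)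
        next
          case (one a y)
          then show ?thesis using h by (intro sum.neutral) (auto simp: good_even mdeg_add)
        next
          case (two a b c d y)
          then show ?thesis using r sums(1)[OF two(1), of y] quadD[OF two(1)] by simp
        next
          case (three i y)
          then show ?thesis using h by (intro sum.neutral) (auto simp: good_even mdeg_add mdeg_X3)
        next
          case (four y)
          then show ?thesis using r sums(2)[of y] by (simp add: Glue_def)
        qed
      next
        case False
        then show ?thesis using h by (intro sum.neutral) (auto simp: good_nonfour keys_plus_nat)
      qed
    qed
  qed
qed

lemma V_slice_commute:
  assumes "f \<in> V (Suc (Suc s))" "i < 4" "j < 4"
  shows "slice i (slice j f) = slice j (slice i f)"
  using Glue_iff[of "\<lambda>i. slice i f"] V_Glue[OF assms(1)] V_slice[OF assms(1)] V_good assms by metis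

lemma V_Glue_diag: "f \<in> V (Suc (Suc s)) \<Longrightarrow> Glue (\<lambda>i. slice i (slice i f))"
  using Glue_iff[of "\<lambda>i. slice i f"] V_Glue[of f "Suc s"] V_slice[of f "Suc s"] V_good by auto

lemma mono_Suc:
  assumes "four m" "mdeg m = Suc n"
  obtains i z where "i < 4" "m = ex i + z" "four z" "mdeg z = n"
proof -
  have "m \<noteq> 0" using assms by auto
  then obtain i where i: "Poly_Mapping.lookup m i \<noteq> 0"
    by (auto simp: poly_mapping_eq_iff fun_eq_iff)
  have m: "m = ex i + (m - ex i)"
    using i by (intro poly_mapping_eqI) (auto simp: lookup_add lookup_minus lookup_single when_def)
  have "i < 4" using i assms(1) by (auto simp: in_keys_iff subset_iff)
  moreover have "four (m - ex i)" using assms(1) by (subst (asm) m) (simp add: keys_plus_nat)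
  moreover have "mdeg (m - ex i) = n" using assms(2) by (subst (asm) m) (simp add: mdeg_add plus_1_eq_Suc)
  ultimately show ?thesis using that m by blast
qed

lemma mono_deg2:
  assumes "four m" "mdeg m = 2"
  obtains i j where "i < 4" "j < 4" "m = ex i + ex j"
proof -
  have "mdeg m = Suc (Suc 0)" using assms by simp
  from assms(1) this obtain i z where i: "i < 4" "m = ex i + z" "four z" "mdeg z = Suc 0" by (rule mono_Suc)
  from i(3,4) obtain j w where "j < 4" "z = ex j + w" "four w" "mdeg w = 0" by (rule mono_Suc)
  moreover from this have "w = 0" by (auto simp: mdeg_def poly_mapping_eq_iff fun_eq_iff in_keys_iff)
  ultimately show ?thesis using that i by simp
qed

lemma mono_deg3:
  assumes "four m" "mdeg m = 3"
  obtains i j k where "i < 4" "j < 4" "k < 4" "m = ex i + (ex j + ex k)"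
proof -
  have "mdeg m = Suc 2" using assms by simp
  from assms(1) this obtain i z where i: "i < 4" "m = ex i + z" "four z" "mdeg z = 2" by (rule mono_Suc)
  then show ?thesis using that by (metis mono_deg2)
qed

lemma dual4_3_eqI:
  assumes "f \<in> dual4 3" "g \<in> dual4 3"
    "\<And>i j k. i < 4 \<Longrightarrow> j < 4 \<Longrightarrow> k < 4 \<Longrightarrow> f (ex i + (ex j + ex k)) = g (ex i + (ex j + ex k))"
  shows "f = g"
proof
  fix m show "f m = g m"
  proof (cases "four m \<and> mdeg m = 3")
    case True
    then show ?thesis using assms(3) by (metis mono_deg3)
  qed (use assms(1,2) in \<open>auto simp: dual4_0\<close>)
qed

lemma PA3_iff:
  "f \<in> PA 3 \<longleftrightarrow> f \<in> dual4 3 \<and> (\<forall>i<4. \<forall>j<4. f (ex i + (ex i + ex j)) = f (ex i + (ex j + ex j)))"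
proof -
  have deg2: "ev f (tot (mon (ex i + ex j))) = f (ex i + (ex i + ex j)) + f (ex i + (ex j + ex j))"
    if d: "f \<in> dual4 3" for i j
  proof -
    have "tot (mon (ex i + ex j)) =
        mon (ex i + ex j) + mon (ex i + (ex i + ex j)) + mon (ex i + (ex j + ex j)) + mon (ex i + (ex i + (ex j + ex j)))"
      by (simp add: mon_add tot_mult tot_ex power2_eq_square algebra_simps)
    moreover have "f (ex i + ex j) = 0" "f (ex i + (ex i + (ex j + ex j))) = 0"
      using d by (auto intro!: dual4_0[OF d] simp: mdeg_add)
    ultimately show ?thesis by (simp add: ev_add)
  qed
  have low: "ev f (tot (mon m)) = 0" if d: "f \<in> dual4 3" and m: "mdeg m < 2" for m
  proof -
    have "ev f (tot (mon m) + mon (m + m)) = 0"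
      by (rule ev_dual4_0[OF d]) (use tot_mon_top m in fastforce)
    moreover have "f (m + m) = 0" using m by (intro dual4_0[OF d]) (auto simp: mdeg_add)
    ultimately show ?thesis by (simp add: ev_add)
  qed
  show ?thesis
  proof
    assume f: "f \<in> PA 3"
    then have d: "f \<in> dual4 3" by (simp add: PA_iff)
    have "f (ex i + (ex i + ex j)) = f (ex i + (ex j + ex j))" if "i < 4" "j < 4" for i j
    proof -
      have "ev f (tot (mon (ex i + ex j))) = 0"
        using f that unfolding PA_iff by (auto simp: keys_plus_nat mdeg_add)
      then show ?thesis by (simp add: deg2[OF d])
    qed
    with d show "f \<in> dual4 3 \<and> (\<forall>i<4. \<forall>j<4. f (ex i + (ex i + ex j)) = f (ex i + (ex j + ex j)))" by blast
  next
    assume r: "f \<in> dual4 3 \<and> (\<forall>i<4. \<forall>j<4. f (ex i + (ex i + ex j)) = f (ex i + (ex j + ex j)))"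
    show "f \<in> PA 3" unfolding PA_iff
    proof (intro conjI allI impI)
      show "f \<in> dual4 3" using r ..
      fix m assume m: "four m \<and> mdeg m < 3"
      show "ev f (tot (mon m)) = 0"
      proof (cases "mdeg m = 2")
        case True
        then obtain i j where "i < 4" "j < 4" "m = ex i + ex j" using m mono_deg2 by blast
        moreover from this have "f (ex i + (ex i + ex j)) = f (ex i + (ex j + ex j))" using r by blast
        ultimately show ?thesis using r deg2[of i j] by (simp only: bit_self_add)
      qed (use low m r in auto)
    qed
  qed
qed

text \<open>A primitive of degree 3 is given by its ten values \<open>qv f i j\<close> on the \<open>x_i^2 * x_j\<close>, symmetric in
  \<open>i\<close> and \<open>j\<close>, and its four values \<open>rv f i\<close> on the products of three distinct variables.\<close>

definition qv :: "(mono \<Rightarrow> bit) \<Rightarrow> nat \<Rightarrow> nat \<Rightarrow> bit" where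
  "qv f i j = f (ex i + (ex i + ex j))"

definition rv :: "(mono \<Rightarrow> bit) \<Rightarrow> nat \<Rightarrow> bit" where
  "rv f i = f (X3 i)"

lemma qv_add [simp]: "qv (f + g) i j = qv f i j + qv g i j" and rv_add [simp]: "rv (f + g) i = rv f i + rv g i"
  and qv_0 [simp]: "qv 0 i j = 0" and rv_0 [simp]: "rv 0 i = 0"
  by (simp_all add: qv_def rv_def)

lemma qv_sym: "f \<in> PA 3 \<Longrightarrow> i < 4 \<Longrightarrow> j < 4 \<Longrightarrow> qv f i j = qv f j i"
  unfolding PA3_iff qv_def by (metis add.commute add.left_commute)

lemma val_same:
  assumes "f \<in> PA 3" "i < 4" "j < 4"
  shows "f (ex i + (ex i + ex j)) = qv f i j" "f (ex i + (ex j + ex i)) = qv f i j" "f (ex i + (ex j + ex j)) = qv f i j"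
  using assms unfolding qv_def PA3_iff by (metis add.commute)+

lemma val_dist:
  assumes "quad a b c d" shows "f (ex a + (ex b + ex c)) = rv f d"
  by (simp add: rv_def X3_quad[OF assms])

lemma PA3_eqI:
  assumes f: "f \<in> PA 3" and g: "g \<in> PA 3"
    and q: "\<And>i j. i < 4 \<Longrightarrow> j < 4 \<Longrightarrow> qv f i j = qv g i j" and r: "\<And>i. i < 4 \<Longrightarrow> rv f i = rv g i"
  shows "f = g"
proof (rule dual4_3_eqI)
  show "f \<in> dual4 3" "g \<in> dual4 3" using f g by (auto simp: PA_iff)
  fix i j k :: nat assume *: "i < 4" "j < 4" "k < 4"
  show "f (ex i + (ex j + ex k)) = g (ex i + (ex j + ex k))"
  proof (cases "i = j \<or> i = k \<or> j = k")
    case True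
    then show ?thesis using * q f g by (auto simp: val_same)
  next
    case False
    then obtain l where "quad i j k l" using quad_exists3 * by blast
    then show ?thesis using r quadD by (simp add: val_dist)
  qed
qed

definition lin :: "nat set \<Rightarrow> mpoly" where
  "lin S = (\<Sum>i\<in>S. mon (ex i))"

text \<open>\<open>M S\<close> is dual to degree 3 of the quotient of the hit problem by the linear form \<open>lin S\<close>, that is, to
  the hit problem in three variables.\<close>

definition M :: "nat set \<Rightarrow> (mono \<Rightarrow> bit) set" where
  "M S = {f \<in> PA 3. \<forall>z. (\<Sum>i\<in>S. f (ex i + z)) = 0}"

lemma M_PA: "f \<in> M S \<Longrightarrow> f \<in> PA 3" by (simp add: M_def)

lemma M_add: "f \<in> M S \<Longrightarrow> g \<in> M S \<Longrightarrow> f + g \<in> M S"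
  by (auto simp: M_def PA_add sum.distrib)

lemma M_0 [simp]: "0 \<in> M S" by (simp add: M_def)

lemma M_lin: "f \<in> M S \<longleftrightarrow> f \<in> PA 3 \<and> (\<forall>p. ev f (lin S * p) = 0)"
proof -
  have *: "ev f (lin S * mon z) = (\<Sum>i\<in>S. f (ex i + z))" for z
    by (simp add: lin_def sum_distrib_right ev_sum flip: mon_add)
  have "(\<forall>z. ev f (lin S * mon z) = 0) \<longleftrightarrow> (\<forall>p. ev f (lin S * p) = 0)"
  proof
    assume a: "\<forall>z. ev f (lin S * mon z) = 0"
    show "\<forall>p. ev f (lin S * p) = 0"
    proof
      fix p show "ev f (lin S * p) = 0"
        by (induction p rule: mpoly_induct) (use a in \<open>simp_all add: ev_add distrib_left\<close>)
    qed
  qed simp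
  then show ?thesis by (simp add: M_def *)
qed

lemma M_iff:
  assumes "S \<subseteq> {..<4}"
  shows "f \<in> M S \<longleftrightarrow> f \<in> PA 3 \<and> (\<forall>j<4. (\<Sum>i\<in>S. qv f i j) = 0) \<and>
    (\<forall>a b c d. quad a b c d \<longrightarrow> (if a \<in> S then qv f a b else 0) + (if b \<in> S then qv f a b else 0) +
      (if c \<in> S then rv f d else 0) + (if d \<in> S then rv f c else 0) = 0)"
    (is "_ \<longleftrightarrow> _ \<and> ?A \<and> ?B")
proof -
  have fin: "finite S" using assms finite_subset by blast
  have A: "(\<Sum>i\<in>S. f (ex i + (ex j + ex j))) = (\<Sum>i\<in>S. qv f i j)" if "f \<in> PA 3" "j < 4" for j
    using assms that by (intro sum.cong) (auto simp: val_same)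
  have B: "(\<Sum>i\<in>S. f (ex i + (ex a + ex b))) = (if a \<in> S then qv f a b else 0) + (if b \<in> S then qv f a b else 0) +
      (if c \<in> S then rv f d else 0) + (if d \<in> S then rv f c else 0)" if f: "f \<in> PA 3" and q: "quad a b c d" for a b c d
  proof -
    note q' = quadD[OF q]
    have "(\<Sum>i\<in>S. f (ex i + (ex a + ex b))) = (\<Sum>i<4. if i \<in> S then f (ex i + (ex a + ex b)) else 0)"
      using assms by (simp add: sum.If_cases Int_absorb1)
    also have "\<dots> = (if a \<in> S then qv f a b else 0) + (if b \<in> S then qv f a b else 0) +
      (if c \<in> S then rv f d else 0) + (if d \<in> S then rv f c else 0)"
      unfolding quad_sum[OF q] using val_same(1)[OF f q'(1,2)] val_same(2)[OF f q'(2,1)]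
        val_dist[OF quad_perm(13)[OF q], of f] val_dist[OF quad_perm(19)[OF q], of f] qv_sym[OF f q'(1,2)]
        quad_perm[OF q] val_dist by (simp add: ac_simps)
    finally show ?thesis .
  qed
  show ?thesis
  proof
    assume m: "f \<in> M S"
    then have f: "f \<in> PA 3" by (rule M_PA)
    show "f \<in> PA 3 \<and> ?A \<and> ?B" using m f A[OF f] B[OF f] unfolding M_def by simp
  next
    assume r: "f \<in> PA 3 \<and> ?A \<and> ?B"
    then have f: "f \<in> PA 3" ..
    have "(\<Sum>i\<in>S. f (ex i + z)) = 0" for z
    proof (cases "four z \<and> mdeg z = 2")
      case True
      then obtain a b where ab: "a < 4" "b < 4" "z = ex a + ex b" by (metis mono_deg2)
      show ?thesis
      proof (cases "a = b")
        case True
        then show ?thesis using r A[OF f] ab by simp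
      next
        case False
        then obtain c d where "quad a b c d" using quad_exists2 ab by blast
        then show ?thesis using r B[OF f] ab by simp
      qed
    next
      case False
      moreover have "f \<in> dual4 3" using f by (simp add: PA_iff)
      ultimately show ?thesis by (intro sum.neutral) (auto intro!: dual4_0 simp: keys_plus_nat mdeg_add)
    qed
    then show "f \<in> M S" using f by (simp add: M_def)
  qed
qed

fun theta :: "nat \<Rightarrow> nat set \<Rightarrow> (mono \<Rightarrow> bit) \<Rightarrow> mono \<Rightarrow> bit" where
  "theta 0 S f = f"
| "theta (Suc s) S f = glue (\<lambda>i. if i \<in> S then theta s S f else 0)"

lemma slice_theta [simp]: "i < 4 \<Longrightarrow> slice i (theta (Suc s) S f) = (if i \<in> S then theta s S f else 0)"
  by (simp add: slice_glue)

lemma Glue_ind: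
  assumes "S \<subseteq> {..<4}"
  shows "Glue (\<lambda>i. if i \<in> S then f else 0) \<longleftrightarrow> (\<forall>z. (\<Sum>i\<in>S. f (ex i + z)) = 0)"
proof -
  have "(\<Sum>i<4. (if i \<in> S then f else 0) (ex i + z)) = (\<Sum>i\<in>S. f (ex i + z))" for z
    using assms by (intro sum.mono_neutral_cong_right) auto
  then show ?thesis by (simp add: Glue_def)
qed

lemma theta_V_Glue:
  assumes S: "S \<subseteq> {..<4}" and f: "f \<in> M S"
  shows "theta s S f \<in> V s \<and> Glue (\<lambda>i. if i \<in> S then theta s S f else 0)"
proof (induction s)
  case 0
  then show ?case using f by (simp add: Glue_ind[OF S] M_def)
next
  case (Suc s)
  have v: "theta (Suc s) S f \<in> V (Suc s)"
    unfolding theta.simps using Suc by (intro glue_V) auto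
  have g: "good (if i \<in> S then theta (Suc s) S f else 0)" for i
    using V_good[OF v] V_good[of 0 s] by auto
  have "Glue (\<lambda>i. if i \<in> S then theta (Suc s) S f else 0)"
    unfolding Glue_iff[OF g]
  proof (intro conjI allI impI)
    fix c d :: nat assume "c < 4" "d < 4" "c \<noteq> d"
    then show "slice d (if c \<in> S then theta (Suc s) S f else 0) = slice c (if d \<in> S then theta (Suc s) S f else 0)"
      by (simp del: theta.simps)
  next
    have "Glue (\<lambda>i. slice i (if i \<in> S then theta (Suc s) S f else 0)) \<longleftrightarrow> Glue (\<lambda>i. if i \<in> S then theta s S f else 0)"
      unfolding Glue_def by (intro all_cong1 arg_cong[where f = "\<lambda>x. x = 0"] sum.cong) (auto simp del: theta.simps)
    then show "Glue (\<lambda>i. slice i (if i \<in> S then theta (Suc s) S f else 0))" using Suc by simp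
  qed
  with v show ?case by simp
qed

lemma theta_V: "S \<subseteq> {..<4} \<Longrightarrow> f \<in> M S \<Longrightarrow> theta s S f \<in> V s"
  using theta_V_Glue by blast

lemma theta_add:
  assumes "S \<subseteq> {..<4}" "f \<in> M S" "g \<in> M S"
  shows "theta s S (f + g) = theta s S f + theta s S g"
proof (induction s)
  case (Suc s)
  show ?case
  proof (rule V_eqI)
    show "theta (Suc s) S (f + g) \<in> V (Suc s)"
      by (rule theta_V[OF assms(1) M_add[OF assms(2,3)]])
    show "theta (Suc s) S f + theta (Suc s) S g \<in> V (Suc s)"
      by (rule PA_add[OF theta_V[OF assms(1,2)] theta_V[OF assms(1,3)]])
    fix i :: nat assume i: "i < 4"
    show "slice i (theta (Suc s) S (f + g)) = slice i (theta (Suc s) S f + theta (Suc s) S g)"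
      unfolding slice_add slice_theta[OF i] Suc by simp
  qed
qed simp

lemma theta_0 [simp]: "theta s S 0 = 0"
proof (induction s)
  case (Suc s)
  have "glue (\<lambda>i. 0) = 0" by (simp add: glue_def fun_eq_iff cong: if_cong)
  then show ?case by (simp only: theta.simps Suc if_cancel)
qed simp

definition homog :: "nat \<Rightarrow> mpoly \<Rightarrow> bool" where
  "homog d p \<longleftrightarrow> (\<forall>m\<in>Poly_Mapping.keys p. four m \<and> mdeg m = d)"

lemma homog_mult: "homog d p \<Longrightarrow> homog e q \<Longrightarrow> homog (d + e) (p * q)"
  unfolding homog_def using keys_mult[of p q] by (fastforce simp: keys_plus_nat mdeg_add)

lemma homog_add: "homog d p \<Longrightarrow> homog d q \<Longrightarrow> homog d (p + q)"
  unfolding homog_def using keys_add[of p q] by blast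

lemma homog_0 [simp]: "homog d 0"
  by (simp add: homog_def)

lemma homog_sum: "(\<And>x. x \<in> A \<Longrightarrow> homog d (g x)) \<Longrightarrow> homog d (sum g A)"
  by (induction A rule: infinite_finite_induct) (auto intro: homog_add)

abbreviation lform :: "bit mat \<Rightarrow> nat \<Rightarrow> mpoly" where
  "lform g j \<equiv> (\<Sum>i<4. const (g $$ (i, j)) * Var i)"

lemma homog_lform: "homog 1 (lform g j)"
proof (rule homog_sum)
  fix i :: nat assume i: "i \<in> {..<4}"
  show "homog 1 (const (g $$ (i, j)) * Var i)"
    using i by (cases "g $$ (i, j)") (auto simp: Var_mon homog_def)
qed

lemma gsubst_mult: "gsubst g (p * q) = gsubst g p * gsubst g q"
  and gsubst_sum: "gsubst g (sum h A) = (\<Sum>x\<in>A. gsubst g (h x))"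
  and gsubst_0 [simp]: "gsubst g 0 = 0" and gsubst_1 [simp]: "gsubst g 1 = 1"
  and gsubst_ex: "gsubst g (mon (ex j)) = lform g j"
  using subst_Var[of "lform g" j]
  by (simp_all add: gsubst_def subst_mult subst_sum Var_mon)

lemma homog_gsubst: "homog (mdeg m) (gsubst g (mon m))"
proof (induction m rule: mono_induct)
  case zero
  then show ?case by (simp add: homog_def)
next
  case (ex i m)
  then show ?case unfolding mon_add gsubst_mult gsubst_ex mdeg_add mdeg_ex
    by (intro homog_mult homog_lform)
qed

lemma gsubst_tot: "gsubst g (tot p) = tot (gsubst g p)"
proof -
  have "tot (lform g j) = lform g j + (lform g j)^2" for j
  proof -
    have "tot (const (g $$ (i, j)) * Var i) = const (g $$ (i, j)) * Var i + (const (g $$ (i, j)) * Var i)^2" for i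
      by (cases "g $$ (i, j)") (simp_all add: tot_Var)
    then show ?thesis by (simp add: tot_sum square_sum sum.distrib)
  qed
  then show ?thesis
    unfolding gsubst_def by (subst (1 2) tot_def) (simp add: subst_subst subst_add subst_power tot_def)
qed

lemma gact_dual4: "f \<in> dual4 n \<Longrightarrow> gact f g \<in> dual4 n"
  unfolding dual4_def gact_def
  using homog_gsubst by (auto simp: monos4_def homog_def dual4_def intro!: ev_dual4_0)

lemma gact_four: "four m \<Longrightarrow> gact f g m = ev f (gsubst g (mon m))"
  by (simp add: gact_def monos4_def)

lemma ev_gact: "(\<And>m. m \<in> Poly_Mapping.keys p \<Longrightarrow> four m) \<Longrightarrow> ev (gact f g) p = ev f (gsubst g p)"
proof -
  assume four: "\<And>m. m \<in> Poly_Mapping.keys p \<Longrightarrow> four m"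
  have "ev (gact f g) p = (\<Sum>m\<in>Poly_Mapping.keys p. gact f g m)"
    unfolding ev_def by (rule sum.cong) (auto simp: in_keys_iff)
  also have "\<dots> = (\<Sum>m\<in>Poly_Mapping.keys p. ev f (gsubst g (mon m)))"
    using four by (intro sum.cong) (auto simp: gact_four)
  also have "\<dots> = ev f (gsubst g p)"
    by (subst (2) mpoly_sum_mons[of p]) (simp add: gsubst_sum ev_sum)
  finally show ?thesis .
qed

lemma gact_add: "gact (f + h) g = gact f g + gact h g"
  by (auto simp: gact_def fun_eq_iff ev_plus)

lemma gact_0 [simp]: "gact 0 g = 0"
  by (auto simp: gact_def fun_eq_iff)

lemma four_tot: "four m \<Longrightarrow> k \<in> Poly_Mapping.keys (tot (mon m)) \<Longrightarrow> four k"
proof (induction m arbitrary: k rule: mono_induct)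
  case zero
  then show ?case by simp
next
  case (ex i m)
  have "tot (mon (ex i + m)) = mon (ex i) * tot (mon m) + mon (ex i + ex i) * tot (mon m)"
    by (simp add: mon_add tot_mult tot_ex power2_eq_square algebra_simps)
  then have "k \<in> Poly_Mapping.keys (mon (ex i) * tot (mon m)) \<union> Poly_Mapping.keys (mon (ex i + ex i) * tot (mon m))"
    using ex.prems by (auto dest!: keys_add[THEN subsetD])
  moreover have "four b" if "b \<in> Poly_Mapping.keys (tot (mon m))" for b
    using ex.IH[OF _ that] ex.prems(1) by (simp add: keys_plus_nat)
  ultimately show ?case using ex.prems(1) by (auto dest!: keys_mon_mult simp: keys_plus_nat subset_iff)
qed

lemma gact_PA:
  assumes f: "f \<in> PA n" shows "gact f g \<in> PA n"
  unfolding PA_iff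
proof (intro conjI allI impI)
  show "gact f g \<in> dual4 n" using f by (simp add: PA_iff gact_dual4)
  fix m assume m: "four m \<and> mdeg m < n"
  have "ev (gact f g) (tot (mon m)) = ev f (tot (gsubst g (mon m)))"
    using m four_tot by (subst ev_gact) (auto simp: gsubst_tot)
  also have "\<dots> = (\<Sum>k\<in>Poly_Mapping.keys (gsubst g (mon m)). ev f (tot (mon k)))"
    by (subst mpoly_sum_mons) (simp add: tot_sum ev_sum)
  also have "\<dots> = 0"
    using homog_gsubst[of m g] m f by (intro sum.neutral) (auto simp: homog_def PA_iff)
  finally show "ev (gact f g) (tot (mon m)) = 0" .
qed

definition tr :: "nat \<Rightarrow> nat \<Rightarrow> bit mat" where
  "tr a b = mat 4 4 (\<lambda>(i, j). if i = j \<or> i = b \<and> j = a then 1 else 0)"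

abbreviation act :: "nat \<Rightarrow> nat \<Rightarrow> (mono \<Rightarrow> bit) \<Rightarrow> mono \<Rightarrow> bit" where
  "act a b f \<equiv> gact f (tr a b)"

lemma gsubst_tr:
  assumes "a < 4" "b < 4" "a \<noteq> b" "j < 4"
  shows "gsubst (tr a b) (mon (ex j)) = (if j = a then mon (ex a) + mon (ex b) else mon (ex j))"
proof -
  have "lform (tr a b) j = (\<Sum>i<4. (if i = j then Var i else 0) + (if i = b then (if j = a then Var i else 0) else 0))"
    using assms by (intro sum.cong) (auto simp: tr_def)
  also have "\<dots> = (if j = a then mon (ex a) + mon (ex b) else mon (ex j))"
    using assms by (simp add: sum.distrib Var_mon)
  finally show ?thesis by (simp add: gsubst_ex)
qed

lemma slice_act:
  assumes f: "good f" and ab: "a < 4" "b < 4" "a \<noteq> b" and i: "i < 4"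
  shows "slice i (act a b f) = (if i = b then act a b (slice b f + slice a f) else act a b (slice i f))"
proof
  fix m
  show "slice i (act a b f) m = (if i = b then act a b (slice b f + slice a f) else act a b (slice i f)) m"
  proof (cases "four m")
    case False
    then show ?thesis by (auto simp: slice_def gact_def monos4_def keys_plus_nat)
  next
    case True
    define r where "r = gsubst (tr a b) (mon m)"
    define x where "x j = mon (ex j)" for j
    have l: "slice i (act a b f) m = ev f (gsubst (tr a b) (mon (X3 i)) * r^2)"
      using True four_X3 by (simp add: slice_def gact_four keys_plus_nat mon_add gsubst_mult r_def power2_eq_square)
    have r: "act a b h m = ev h r" for h
      using True by (simp add: gact_four r_def)
    note T = gsubst_tr[OF ab]
    obtain c d where q: "quad a b c d" using quad_exists2 ab by blast
    note q' = quadD[OF q]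
    consider "i = b" | "i = a" | c d where "quad a b c d" "i = c"
      using quad_cases[OF q, of i] i q quad_perm[OF q] by blast
    then show ?thesis
    proof cases
      case 1
      have "gsubst (tr a b) (mon (X3 b)) = (x a + x b) * x c * x d"
        using q' by (simp add: X3_quad[OF quad_perm(4)[OF q]] mon_add gsubst_mult T x_def mult.assoc)
      then have "gsubst (tr a b) (mon (X3 i)) * r^2 = x a * x c * x d * r^2 + x b * x c * x d * r^2"
        using 1 by (simp add: algebra_simps)
      then show ?thesis unfolding l using 1 q r
        by (simp add: ev_add ev_plus x_def good_ev(5)[OF f quad_perm(4)[OF q]] good_ev(5)[OF f quad_perm(9)[OF q]] add.commute)
    next
      case 2
      have "gsubst (tr a b) (mon (X3 a)) = x b * x c * x d"
        using q' by (simp add: X3_quad[OF quad_perm(9)[OF q]] mon_add gsubst_mult T x_def mult.assoc)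
      then show ?thesis unfolding l using 2 q' r
        by (simp add: x_def good_ev(5)[OF f quad_perm(9)[OF q]])
    next
      case (3 c d)
      note q = 3(1) and q' = quadD[OF 3(1)]
      have "gsubst (tr a b) (mon (X3 c)) = (x a + x b) * x b * x d"
        using q' by (simp add: X3_quad[OF quad_perm(1)[OF q]] mon_add gsubst_mult T x_def mult.assoc)
      then have "gsubst (tr a b) (mon (X3 i)) * r^2 = x a * x b * x d * r^2 + x d * (x b * r)^2"
        using 3 by (simp add: algebra_simps power2_eq_square)
      then show ?thesis unfolding l using 3 q' r
        by (simp add: ev_add x_def good_ev(5)[OF f quad_perm(1)[OF q]] good_ev(2)[OF f])
    qed
  qed
qed

lemma qv_act:
  assumes f: "f \<in> PA 3" and q: "quad a b c d"
  shows "qv (act a b f) a a = qv f a a + qv f b b"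
    "qv (act a b f) a b = qv f a b + qv f b b" "qv (act a b f) b a = qv f a b + qv f b b"
    "qv (act a b f) a c = qv f a c + qv f b c" "qv (act a b f) c a = qv f a c + qv f b c"
    "qv (act a b f) b b = qv f b b" "qv (act a b f) c c = qv f c c"
    "qv (act a b f) b c = qv f b c" "qv (act a b f) c b = qv f b c" "qv (act a b f) c d = qv f c d"
proof -
  note q' = quadD[OF q]
  have g: "act a b f \<in> PA 3" using f by (rule gact_PA)
  note T = gsubst_tr[OF q'(1,2,5)]
  have e: "qv (act a b f) i j = ev f (gsubst (tr a b) (mon (ex i)) * (gsubst (tr a b) (mon (ex i)) * gsubst (tr a b) (mon (ex j))))"
    if "i < 4" "j < 4" for i j
    using that by (simp add: qv_def gact_four keys_plus_nat mon_add gsubst_mult)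
  note s = val_same[OF f] and m = mon_add[symmetric]
  show 1: "qv (act a b f) a a = qv f a a + qv f b b"
    using q' by (simp add: e T distrib_left distrib_right ev_add m s qv_sym[OF f, of b a])
  show 2: "qv (act a b f) a b = qv f a b + qv f b b"
    using q' by (simp add: e T distrib_left distrib_right ev_add m s qv_sym[OF f, of b a])
  then show "qv (act a b f) b a = qv f a b + qv f b b"
    using qv_sym[OF g q'(1,2)] by simp
  show 3: "qv (act a b f) a c = qv f a c + qv f b c"
    using q' by (simp add: e T distrib_left distrib_right ev_add m s val_dist[OF q] val_dist[OF quad_perm(3)[OF q]])
  then show "qv (act a b f) c a = qv f a c + qv f b c"
    using qv_sym[OF g q'(1,3)] by simp
  show "qv (act a b f) b b = qv f b b" "qv (act a b f) c c = qv f c c" "qv (act a b f) c d = qv f c d"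
    using q' by (simp_all add: e T m s)
  show 4: "qv (act a b f) b c = qv f b c"
    using q' by (simp_all add: e T m s)
  then show "qv (act a b f) c b = qv f b c"
    using qv_sym[OF g q'(2,3)] by simp
qed

lemma rv_act:
  assumes f: "f \<in> PA 3" and q: "quad a b c d"
  shows "rv (act a b f) a = rv f a" "rv (act a b f) b = rv f b + rv f a"
    "rv (act a b f) c = rv f c + qv f b d"
proof -
  note q' = quadD[OF q]
  note T = gsubst_tr[OF q'(1,2,5)]
  note s = val_same[OF f] and m = mon_add[symmetric]
  have e: "act a b f (ex i + (ex j + ex k)) = ev f (gsubst (tr a b) (mon (ex i)) * (gsubst (tr a b) (mon (ex j)) * gsubst (tr a b) (mon (ex k))))"
    if "i < 4" "j < 4" "k < 4" for i j k
    using that by (simp add: gact_four keys_plus_nat mon_add gsubst_mult)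
  show "rv (act a b f) a = rv f a"
    using q' by (simp add: val_dist[OF quad_perm(9)[OF q], symmetric] e T m)
  show "rv (act a b f) b = rv f b + rv f a"
    unfolding val_dist[OF quad_perm(4)[OF q], symmetric] val_dist[OF quad_perm(9)[OF q], symmetric]
    using q' by (simp add: e T distrib_right ev_add m)
  show "rv (act a b f) c = rv f c + qv f b d"
    unfolding val_dist[OF quad_perm(1)[OF q], symmetric]
    using q' by (simp add: e T distrib_right ev_add m s)
qed

definition tog :: "nat \<Rightarrow> nat \<Rightarrow> nat set \<Rightarrow> nat set" where
  "tog a b S = (if a \<in> S then (if b \<in> S then S - {b} else insert b S) else S)"

lemma tog_subset: "b < 4 \<Longrightarrow> S \<subseteq> {..<4} \<Longrightarrow> tog a b S \<subseteq> {..<4}"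
  by (auto simp: tog_def)

lemma lin_tog:
  assumes "finite S"
  shows "lin (tog a b S) = (if a \<in> S then lin S + mon (ex b) else lin S)"
  using assms by (simp add: lin_def tog_def sum.remove[of S b] ac_simps)

lemma gsubst_lin:
  assumes "a < 4" "b < 4" "a \<noteq> b" "S \<subseteq> {..<4}"
  shows "gsubst (tr a b) (lin S) = (if a \<in> S then lin S + mon (ex b) else lin S)"
proof -
  have fin: "finite S" using assms finite_subset by blast
  have "gsubst (tr a b) (lin S) = (\<Sum>i\<in>S. mon (ex i) + (if i = a then mon (ex b) else 0))"
    unfolding lin_def gsubst_sum using assms by (intro sum.cong) (auto simp: gsubst_tr)
  then show ?thesis using fin by (simp add: sum.distrib lin_def)
qed

lemma homog_lin: "S \<subseteq> {..<4} \<Longrightarrow> homog 1 (lin S)"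
  unfolding lin_def by (rule homog_sum) (auto simp: homog_def)

lemma act_M:
  assumes ab: "a < 4" "b < 4" "a \<noteq> b" and S: "S \<subseteq> {..<4}" and f: "f \<in> M S"
  shows "act a b f \<in> M (tog a b S)"
proof -
  have fin: "finite S" using S finite_subset by blast
  have S': "tog a b S \<subseteq> {..<4}" using tog_subset ab S by blast
  have g: "gsubst (tr a b) (lin (tog a b S)) = lin S"
  proof (cases "a \<in> S")
    case True
    then have "a \<in> tog a b S" using ab by (simp add: tog_def)
    then show ?thesis using True unfolding gsubst_lin[OF ab S'] by (simp add: lin_tog[OF fin] add.assoc)
  next
    case False
    then have "tog a b S = S" by (simp add: tog_def)
    then show ?thesis using False by (simp add: gsubst_lin[OF ab S])
  qed
  have "(\<Sum>i\<in>tog a b S. act a b f (ex i + z)) = 0" for z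
  proof (cases "four z")
    case True
    have "(\<Sum>i\<in>tog a b S. act a b f (ex i + z)) = ev (act a b f) (lin (tog a b S) * mon z)"
      by (simp add: lin_def sum_distrib_right ev_sum flip: mon_add)
    also have "\<dots> = ev f (gsubst (tr a b) (lin (tog a b S) * mon z))"
    proof (rule ev_gact)
      fix m assume "m \<in> Poly_Mapping.keys (lin (tog a b S) * mon z)"
      moreover have "homog (mdeg z) (mon z)" using True by (simp add: homog_def)
      ultimately show "four m" using homog_mult[OF homog_lin[OF S'], of "mdeg z" "mon z"] unfolding homog_def by blast
    qed
    also have "\<dots> = 0" using f by (simp add: gsubst_mult g M_lin)
    finally show ?thesis .
  next
    case False
    then show ?thesis by (intro sum.neutral) (auto simp: gact_def monos4_def keys_plus_nat)
  qed
  then show ?thesis using f gact_PA by (auto simp: M_def)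
qed

lemma act_theta:
  assumes ab: "a < 4" "b < 4" "a \<noteq> b" and S: "S \<subseteq> {..<4}" and f: "f \<in> M S"
  shows "act a b (theta s S f) = theta s (tog a b S) (act a b f)"
proof (induction s)
  case (Suc s)
  have v: "theta (Suc s) S f \<in> V (Suc s)" by (rule theta_V[OF S f])
  show ?case
  proof (rule V_eqI)
    show "act a b (theta (Suc s) S f) \<in> V (Suc s)" using v by (rule gact_PA)
    show "theta (Suc s) (tog a b S) (act a b f) \<in> V (Suc s)"
      using ab S f by (intro theta_V tog_subset act_M)
    fix i :: nat assume i: "i < 4"
    show "slice i (act a b (theta (Suc s) S f)) = slice i (theta (Suc s) (tog a b S) (act a b f))"
      unfolding slice_act[OF V_good[OF v] ab i] slice_theta[OF i] slice_theta[OF ab(1)] slice_theta[OF ab(2)]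
      using ab i Suc by (auto simp: tog_def gact_add)
  qed
qed simp

section \<open>Generation of GL4 and dimensions of coinvariants\<close>

lemma tr_carrier [simp]: "tr a b \<in> carrier_mat 4 4" by (simp add: tr_def)

lemma tr_mult_index:
  assumes "a < 4" "b < 4" "a \<noteq> b" "g \<in> carrier_mat 4 4" "i < 4" "j < 4"
  shows "(tr a b * g) $$ (i, j) = g $$ (i, j) + (if i = b then g $$ (a, j) else 0)"
proof -
  have "(tr a b * g) $$ (i, j) = (\<Sum>l<4. tr a b $$ (i, l) * g $$ (l, j))"
    using assms by (simp add: tr_def scalar_prod_def atLeast0LessThan)
  also have "\<dots> = (\<Sum>l<4. (if l = i then g $$ (i, j) else 0) + (if l = a then (if i = b then g $$ (a, j) else 0) else 0))"
    using assms by (intro sum.cong) (auto simp: tr_def)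
  also have "\<dots> = g $$ (i, j) + (if i = b then g $$ (a, j) else 0)"
    using assms by (simp add: sum.distrib)
  finally show ?thesis .
qed

lemma tr_tr:
  assumes "a < 4" "b < 4" "a \<noteq> b" "g \<in> carrier_mat 4 4"
  shows "tr a b * (tr a b * g) = g"
proof (rule eq_matI)
  fix i j assume "i < dim_row g" "j < dim_col g"
  then have ij: "i < 4" "j < 4" using assms by auto
  have c: "tr a b * g \<in> carrier_mat 4 4" using assms by (simp add: mult_carrier_mat[OF tr_carrier])
  show "(tr a b * (tr a b * g)) $$ (i, j) = g $$ (i, j)"
    unfolding tr_mult_index[OF assms(1-3) c ij] tr_mult_index[OF assms ij]
      tr_mult_index[OF assms(1-4) assms(1) ij(2)] using assms(3) by simp
qed (use assms in \<open>auto simp: tr_def\<close>)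

definition linv :: "bit mat \<Rightarrow> bool" where
  "linv g \<longleftrightarrow> g \<in> carrier_mat 4 4 \<and> (\<exists>h\<in>carrier_mat 4 4. h * g = 1\<^sub>m 4)"

lemma linv_tr:
  assumes "a < 4" "b < 4" "a \<noteq> b" "linv g" shows "linv (tr a b * g)"
proof -
  obtain h where h: "h \<in> carrier_mat 4 4" "h * g = 1\<^sub>m 4" and g: "g \<in> carrier_mat 4 4"
    using assms by (auto simp: linv_def)
  have "(h * tr a b) * (tr a b * g) = h * (tr a b * (tr a b * g))"
    by (rule assoc_mult_mat[OF h(1) tr_carrier mult_carrier_mat[OF tr_carrier g]])
  also have "\<dots> = 1\<^sub>m 4" using assms g h by (simp add: tr_tr)
  finally show ?thesis
    using mult_carrier_mat[OF tr_carrier g] mult_carrier_mat[OF h(1) tr_carrier] unfolding linv_def by blast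
qed

lemma GL4_linv: "g \<in> GL4 \<Longrightarrow> linv g"
proof -
  assume "g \<in> GL4"
  then obtain h where g: "g \<in> carrier_mat 4 4" and h: "g * h = 1\<^sub>m 4" "h * g = 1\<^sub>m (dim_row h)"
    by (auto simp: GL4_def invertible_mat_def inverts_mat_def)
  have "dim_col h = 4" using arg_cong[OF h(1), of dim_col] by simp
  moreover have "dim_row h = 4" using arg_cong[OF h(2), of dim_col] g by simp
  ultimately show ?thesis using g h(2) unfolding linv_def by (intro conjI bexI[of _ h]) auto
qed

text \<open>Gaussian elimination: over the two element field the transvections alone generate.\<close>

lemma linv_induct:
  assumes one: "P (1\<^sub>m 4)"
    and step: "\<And>a b g. a < 4 \<Longrightarrow> b < 4 \<Longrightarrow> a \<noteq> b \<Longrightarrow> g \<in> carrier_mat 4 4 \<Longrightarrow> P g \<Longrightarrow> P (tr a b * g)"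
    and g: "linv g"
  shows "P g"
proof -
  define unitc where "unitc k g \<longleftrightarrow> (\<forall>i<4. \<forall>j<k. g $$ (i, j) = (if i = j then 1 else 0))" for k and g :: "bit mat"
  have undo: "P g" if "P (tr a b * g)" "a < 4" "b < 4" "a \<noteq> b" "g \<in> carrier_mat 4 4" for a b g
    using step[of a b "tr a b * g"] tr_tr[of a b g] that mult_carrier_mat[OF tr_carrier that(5)] by simp
  have unitc_tr: "unitc k (tr a b * g)"
    if "unitc k g" "k < 4" "k \<le> a" "a < 4" "b < 4" "a \<noteq> b" "g \<in> carrier_mat 4 4" for a b k g
    using that by (auto simp: unitc_def tr_mult_index)
  have main: "linv g \<Longrightarrow> unitc (4 - d) g \<Longrightarrow> P g" if "d \<le> 4" for d g
    using that
  proof (induction d arbitrary: g)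
    case 0
    then have "g = 1\<^sub>m 4" by (intro eq_matI) (auto simp: unitc_def linv_def)
    then show ?case using one by simp
  next
    case (Suc d)
    define k where "k = 4 - Suc d"
    have k: "k < 4" "4 - d = Suc k" using Suc.prems by (auto simp: k_def)
    have clear: "P g" if "linv g" "unitc k g" "g $$ (k, k) = 1" for g
      using that
    proof (induction "card {i. i < 4 \<and> i \<noteq> k \<and> g $$ (i, k) = 1}" arbitrary: g)
      case 0
      then have "{i. i < 4 \<and> i \<noteq> k \<and> g $$ (i, k) = 1} = {}" by simp
      then have "unitc (Suc k) g"
        using 0 by (auto simp: unitc_def less_Suc_eq)
      then show ?case using Suc.IH[of g] 0 Suc.prems k by simp
    next
      case (Suc n)
      then have "{i. i < 4 \<and> i \<noteq> k \<and> g $$ (i, k) = 1} \<noteq> {}" by force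
      then obtain i where i: "i < 4" "i \<noteq> k" "g $$ (i, k) = 1" by blast
      have c: "g \<in> carrier_mat 4 4" using Suc.prems by (simp add: linv_def)
      have "{j. j < 4 \<and> j \<noteq> k \<and> (tr k i * g) $$ (j, k) = 1} = {j. j < 4 \<and> j \<noteq> k \<and> g $$ (j, k) = 1} - {i}"
        using i k Suc.prems c by (auto simp: tr_mult_index split: if_splits)
      then have "n = card {j. j < 4 \<and> j \<noteq> k \<and> (tr k i * g) $$ (j, k) = 1}"
        using Suc.hyps(2) i by simp
      then have "P (tr k i * g)"
        using i k Suc.prems c by (intro Suc.hyps(1) linv_tr unitc_tr) (auto simp: tr_mult_index)
      then show ?case using undo[of k i g] i k c by simp
    qed
    have c: "g \<in> carrier_mat 4 4" using Suc.prems by (simp add: linv_def)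
    have u: "unitc k g" using Suc.prems by (simp add: k_def)
    obtain h where h: "h \<in> carrier_mat 4 4" "h * g = 1\<^sub>m 4" using Suc.prems by (auto simp: linv_def)
    have hg: "(\<Sum>l<4. h $$ (k, l) * g $$ (l, j)) = (if k = j then 1 else 0)" if "j < 4" for j
      using arg_cong[OF h(2), of "\<lambda>m. m $$ (k, j)"] h(1) c k that
      by (simp add: scalar_prod_def atLeast0LessThan)
    have "\<exists>r<4. k \<le> r \<and> g $$ (r, k) = 1"
    proof (rule ccontr)
      assume *: "\<not> ?thesis"
      have "h $$ (k, l) * g $$ (l, k) = 0" if "l < 4" for l
      proof (cases "k \<le> l")
        case True
        then show ?thesis using * that by auto
      next
        case False
        have "(\<Sum>m<4. h $$ (k, m) * g $$ (m, l)) = (\<Sum>m<4. if m = l then h $$ (k, l) else 0)"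
          using u False by (intro sum.cong) (auto simp: unitc_def)
        then have "h $$ (k, l) = 0" using hg[OF that] False that by simp
        then show ?thesis by simp
      qed
      then have "(\<Sum>l<4. h $$ (k, l) * g $$ (l, k)) = 0" by (intro sum.neutral) auto
      then show False using hg[OF k(1)] by simp
    qed
    then obtain r where r: "r < 4" "k \<le> r" "g $$ (r, k) = 1" by blast
    show ?case
    proof (cases "g $$ (k, k) = 1")
      case True
      then show ?thesis using clear Suc.prems u by blast
    next
      case False
      then have rk: "r \<noteq> k" "g $$ (k, k) = 0" using r by auto
      have "P (tr r k * g)"
        using r rk k u c Suc.prems by (intro clear linv_tr unitc_tr) (auto simp: tr_mult_index)
      then show ?thesis using undo[of r k g] r rk k c by simp
    qed
  qed
  show ?thesis by (rule main[of 4]) (use g in \<open>auto simp: unitc_def\<close>)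
qed

lemma gact_one:
  assumes "f \<in> dual4 n" shows "gact f (1\<^sub>m 4) = f"
proof
  fix m
  show "gact f (1\<^sub>m 4) m = f m"
  proof (cases "four m")
    case True
    have "lform (1\<^sub>m 4) j = Var j" if "j < 4" for j
    proof -
      have "lform (1\<^sub>m 4) j = (\<Sum>i<4. if i = j then Var j else 0)"
        using that by (intro sum.cong) auto
      then show ?thesis using that by simp
    qed
    then have "gsubst (1\<^sub>m 4) (mon m) = subst Var (mon m)"
      unfolding gsubst_def using True by (intro subst_cong_mon) auto
    also have "\<dots> = mon m"
    proof (induction m rule: mono_induct)
      case (ex i m)
      have "subst Var (mon (ex i)) = mon (ex i)" using subst_Var[of Var i] by (simp add: Var_mon)
      then show ?case using ex by (simp add: mon_add subst_mult)
    qed simp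
    finally show ?thesis using True by (simp add: gact_four)
  next
    case False
    then show ?thesis using assms by (auto simp: gact_def monos4_def dual4_def)
  qed
qed

lemma const_mult: "const (a * b) = const a * const b"
  by (cases a; cases b) simp_all

lemma const_sum: "const (sum h A) = (\<Sum>x\<in>A. const (h x))"
  by (induction A rule: infinite_finite_induct) (auto simp: const_add)

lemma gsubst_const [simp]: "gsubst g (const c) = const c"
  by (cases c) simp_all

lemma gact_mult:
  assumes g: "g \<in> carrier_mat 4 4" and h: "h \<in> carrier_mat 4 4"
  shows "gact (gact f g) h = gact f (g * h)"
proof
  fix m
  show "gact (gact f g) h m = gact f (g * h) m"
  proof (cases "four m")
    case True
    have lf: "gsubst g (lform h j) = lform (g * h) j" if j: "j < 4" for j
    proof -
      have "gsubst g (lform h j) = (\<Sum>i<4. const (h $$ (i, j)) * lform g i)"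
        by (simp add: gsubst_sum gsubst_mult gsubst_ex Var_mon)
      also have "\<dots> = (\<Sum>i<4. \<Sum>k<4. const (g $$ (k, i)) * const (h $$ (i, j)) * Var k)"
        by (simp add: sum_distrib_left ac_simps)
      also have "\<dots> = (\<Sum>k<4. \<Sum>i<4. const (g $$ (k, i)) * const (h $$ (i, j)) * Var k)"
        by (rule sum.swap)
      also have "\<dots> = lform (g * h) j"
      proof (rule sum.cong)
        fix k :: nat assume "k \<in> {..<4}"
        then have "(g * h) $$ (k, j) = (\<Sum>i<4. g $$ (k, i) * h $$ (i, j))"
          using g h j by (simp add: scalar_prod_def atLeast0LessThan)
        then show "(\<Sum>i<4. const (g $$ (k, i)) * const (h $$ (i, j)) * Var k) = const ((g * h) $$ (k, j)) * Var k"
          by (simp add: const_sum const_mult sum_distrib_right)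
      qed simp
      finally show ?thesis .
    qed
    have "gsubst g (gsubst h (mon m)) = subst (\<lambda>j. gsubst g (lform h j)) (mon m)"
      unfolding gsubst_def by (rule subst_subst)
    also have "\<dots> = gsubst (g * h) (mon m)"
      unfolding gsubst_def[of "g * h"] using True lf by (intro subst_cong_mon) auto
    finally have gg: "gsubst g (gsubst h (mon m)) = gsubst (g * h) (mon m)" .
    have "gact (gact f g) h m = ev (gact f g) (gsubst h (mon m))" using True by (simp add: gact_four)
    also have "\<dots> = ev f (gsubst g (gsubst h (mon m)))"
      by (rule ev_gact) (use homog_gsubst[of m h] in \<open>auto simp: homog_def\<close>)
    finally show ?thesis using True gg by (simp add: gact_four)
  next
    case False
    then show ?thesis by (simp add: gact_def monos4_def)
  qed
qed

lemma tr_GL4: "a < 4 \<Longrightarrow> b < 4 \<Longrightarrow> a \<noteq> b \<Longrightarrow> tr a b \<in> GL4"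
  using tr_tr[of a b "1\<^sub>m 4"] unfolding GL4_def invertible_mat_def inverts_mat_def
  by (auto simp: tr_def square_mat.simps intro!: exI[of _ "tr a b"])

lemma GL4_invariant:
  assumes inv: "\<And>a b f. a < 4 \<Longrightarrow> b < 4 \<Longrightarrow> a \<noteq> b \<Longrightarrow> f \<in> PA n \<Longrightarrow> \<phi> (act a b f) = \<phi> f"
    and "g \<in> GL4" "f \<in> PA n"
  shows "\<phi> (gact f g) = \<phi> f"
proof -
  have "\<forall>f\<in>PA n. \<phi> (gact f g) = \<phi> f"
  proof (rule linv_induct[where P = "\<lambda>g. \<forall>f\<in>PA n. \<phi> (gact f g) = \<phi> f"])
    show "\<forall>f\<in>PA n. \<phi> (gact f (1\<^sub>m 4)) = \<phi> f" using gact_one by (auto simp: PA_iff)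
    show "linv g" using assms by (simp add: GL4_linv)
    fix a b :: nat and g assume *: "a < 4" "b < 4" "a \<noteq> b" "g \<in> carrier_mat 4 4" "\<forall>f\<in>PA n. \<phi> (gact f g) = \<phi> f"
    show "\<forall>f\<in>PA n. \<phi> (gact f (tr a b * g)) = \<phi> f"
      using * inv gact_PA by (auto simp flip: gact_mult[OF tr_carrier])
  qed
  then show ?thesis using assms by blast
qed

interpretation fs: vector_space fscale by (rule vector_space_fscale)

definition rels :: "nat \<Rightarrow> (mono \<Rightarrow> bit) set" where
  "rels n = {gact f g - f | f g. f \<in> PA n \<and> g \<in> GL4}"

lemma fun_diff: "f - g = f + g" for f g :: "mono \<Rightarrow> bit"
  by (simp add: fun_eq_iff)

lemma rels_PA: "rels n \<subseteq> PA n"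
  unfolding rels_def by (auto simp: fun_diff PA_add gact_PA)

lemma act_rels: "a < 4 \<Longrightarrow> b < 4 \<Longrightarrow> a \<noteq> b \<Longrightarrow> f \<in> PA n \<Longrightarrow> act a b f + f \<in> fs.span (rels n)"
  using tr_GL4[of a b] by (intro fs.span_base) (auto simp: rels_def fun_diff[symmetric])

lemma subspace_bit:
  assumes "0 \<in> U" "\<And>f g. f \<in> U \<Longrightarrow> g \<in> U \<Longrightarrow> f + g \<in> U"
  shows "fs.subspace U"
proof -
  have "fscale c f = (if c = 1 then f else 0)" for c f
    by (cases c) (auto simp: fscale_def fun_eq_iff)
  then show ?thesis using assms by (intro fs.subspaceI) auto
qed

lemma finite_dual4: "finite (dual4 n)"
proof -
  have "finite (monos4 n)"
  proof (rule finite_subset)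
    let ?F = "{..<4::nat} \<rightarrow>\<^sub>E {..n}"
    show "finite ((\<lambda>h. \<Sum>i<4. Poly_Mapping.single i (h i)) ` ?F)" by (intro finite_imageI finite_PiE) auto
    show "monos4 n \<subseteq> (\<lambda>h. \<Sum>i<4. Poly_Mapping.single i (h i)) ` ?F"
    proof
      fix m assume "m \<in> monos4 n"
      then have m: "four m" "mdeg m = n" by (auto simp: monos4_def)
      let ?h = "restrict (Poly_Mapping.lookup m) {..<4}"
      have "m = (\<Sum>i<4. Poly_Mapping.single i (?h i))"
      proof (rule poly_mapping_eqI)
        fix j
        have "Poly_Mapping.lookup m j = 0" if "\<not> j < 4" using m that by (auto simp: in_keys_iff subset_iff)
        then show "Poly_Mapping.lookup m j = Poly_Mapping.lookup (\<Sum>i<4. Poly_Mapping.single i (?h i)) j"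
          by (simp add: lookup_sum lookup_single when_def sum.delta)
      qed
      moreover have "Poly_Mapping.lookup m i \<le> n" if "i < 4" for i
        using member_le_sum[of i "{..<4}" "Poly_Mapping.lookup m"] that m mdeg_eq[of m] by simp
      then have "?h \<in> ?F" by auto
      ultimately show "m \<in> (\<lambda>h. \<Sum>i<4. Poly_Mapping.single i (h i)) ` ?F" by blast
    qed
  qed
  then have "finite (monos4 n \<rightarrow>\<^sub>E (UNIV :: bit set))"
  proof (intro finite_PiE)
    have "x \<in> {0, 1}" for x :: bit by (cases x) simp_all
    then have "(UNIV :: bit set) \<subseteq> {0, 1}" by blast
    then show "finite (UNIV :: bit set)" by (rule finite_subset) simp
  qed
  moreover have "inj_on (\<lambda>f. restrict f (monos4 n)) (dual4 n)"
  proof (rule inj_onI)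
    fix f g :: "mono \<Rightarrow> bit" assume *: "f \<in> dual4 n" "g \<in> dual4 n" "restrict f (monos4 n) = restrict g (monos4 n)"
    show "f = g"
    proof
      fix m show "f m = g m"
        using * by (cases "m \<in> monos4 n") (auto simp: dual4_def dest!: fun_cong[where x = m])
    qed
  qed
  ultimately show ?thesis by (rule_tac inj_on_finite[where f = "\<lambda>f. restrict f (monos4 n)"]) auto
qed

lemma coinv_dim_0:
  assumes "PA n \<subseteq> fs.span (rels n)" shows "coinv_dim n = 0"
proof -
  have "fs.span (PA n) = fs.span (rels n)"
    using assms rels_PA by (intro antisym fs.span_minimal fs.span_mono) auto
  then have "fs.dim (PA n) = fs.dim (rels n)" by (metis fs.dim_span)
  then show ?thesis by (simp add: coinv_dim_def rels_def)
qed

lemma coinv_dim_1: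
  assumes gen: "PA n \<subseteq> fs.span (insert e (rels n))" and e: "e \<in> PA n"
    and add: "\<And>f g. f \<in> PA n \<Longrightarrow> g \<in> PA n \<Longrightarrow> \<phi> (f + g) = \<phi> f + (\<phi> g :: bit)"
    and inv: "\<And>a b f. a < 4 \<Longrightarrow> b < 4 \<Longrightarrow> a \<noteq> b \<Longrightarrow> f \<in> PA n \<Longrightarrow> \<phi> (act a b f) = \<phi> f"
    and phi: "\<phi> e = 1"
  shows "coinv_dim n = 1"
proof -
  let ?K = "{f \<in> PA n. \<phi> f = 0}"
  have "\<phi> 0 = 0" using add[of 0 0] by simp
  then have K: "fs.subspace ?K" by (intro subspace_bit) (auto simp: add PA_add)
  have "rels n \<subseteq> ?K"
    unfolding rels_def using GL4_invariant[of n \<phi>, OF inv]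
    by (auto simp: fun_diff add gact_PA PA_add)
  then have "fs.span (rels n) \<subseteq> ?K" by (rule fs.span_minimal[OF _ K])
  then have ne: "e \<notin> fs.span (rels n)" using phi by auto
  obtain B where B: "B \<subseteq> rels n" "fs.independent B" "rels n \<subseteq> fs.span B" "card B = fs.dim (rels n)"
    by (rule fs.basis_exists)
  have sB: "fs.span B = fs.span (rels n)"
    using B by (intro antisym fs.span_minimal fs.span_mono) auto
  have "finite (PA n)" using finite_dual4[of n] by (rule finite_subset[rotated]) (auto simp: PA_iff)
  then have fin: "finite B" using B(1) rels_PA by (meson finite_subset)
  have ind: "fs.independent (insert e B)" using ne B sB by (simp add: fs.independent_insert)
  have "fs.span (insert e B) = fs.span (PA n)"
  proof (rule antisym)
    show "fs.span (insert e B) \<subseteq> fs.span (PA n)"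
      using e B(1) rels_PA by (intro fs.span_mono) auto
    have "insert e (rels n) \<subseteq> fs.span (insert e B)"
      using B(3) fs.span_mono[of B "insert e B"] by (auto intro: fs.span_base)
    then have "fs.span (insert e (rels n)) \<subseteq> fs.span (insert e B)" by (intro fs.span_minimal) auto
    then show "fs.span (PA n) \<subseteq> fs.span (insert e B)"
      using gen by (intro fs.span_minimal) auto
  qed
  then have "fs.dim (PA n) = card (insert e B)"
    using fs.dim_eq_card[OF _ ind] by metis
  also have "\<dots> = Suc (card B)" using fin ne sB fs.span_base[of e B] by (subst card_insert_disjoint) auto
  finally show ?thesis using B(4) by (simp add: coinv_dim_def rels_def)
qed

section \<open>The invariant of a solution\<close>

text \<open>Degree 3 of the hit problem in three variables \<open>u, v, w\<close> has the unique nonzero \<open>GL_3\<close>-invariant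
  \<open>u^3 + v^3 + w^3 + u^2 v + u^2 w + v^2 w + u v w\<close>.  For \<open>f \<in> M S\<close> and \<open>p \<in> S\<close> the number \<open>kappa p f\<close> is its value
  on the basis of the variables other than \<open>x_p\<close> modulo \<open>lin S\<close>.\<close>

definition kappa :: "nat \<Rightarrow> (mono \<Rightarrow> bit) \<Rightarrow> bit" where
  "kappa p f = (\<Sum>i\<in>{..<4}-{p}. \<Sum>j\<in>{..<4}-{p}. if i \<le> j then qv f i j else 0) + rv f p"

lemma kappa_quad:
  assumes f: "f \<in> PA 3" and q: "quad p a b c"
  shows "kappa p f = qv f a a + (qv f b b + (qv f c c + (qv f a b + (qv f a c + (qv f b c + rv f p)))))"
proof -
  note q' = quadD[OF q]
  have "{..<4} - {p} = {a, b, c}" using q by (auto simp: quad_def)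
  then show ?thesis
    using q' qv_sym[OF f q'(3,2)] qv_sym[OF f q'(4,2)] qv_sym[OF f q'(4,3)]
    by (cases "a < b"; cases "a < c"; cases "b < c") (auto simp: kappa_def ac_simps)
qed

lemma kappa_add: "kappa p (f + g) = kappa p f + kappa p g"
proof -
  have "(\<Sum>i\<in>A. \<Sum>j\<in>A. if i \<le> j then qv (f + g) i j else 0) =
    (\<Sum>i\<in>A. \<Sum>j\<in>A. if i \<le> j then qv f i j else 0) + (\<Sum>i\<in>A. \<Sum>j\<in>A. if i \<le> j then qv g i j else 0)" for A
    unfolding sum.distrib[symmetric] by (intro sum.cong) auto
  then show ?thesis by (simp add: kappa_def ac_simps)
qed

lemma kappa_0 [simp]: "kappa p 0 = 0"
  using kappa_add[of p 0 0] by simp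

lemma kappa_act1:
  assumes f: "f \<in> PA 3" and q: "quad a b c d"
  shows "kappa a (act a b f) = kappa a f" and "kappa c (act a b f) = kappa c f"
proof -
  note g = gact_PA[OF f, of "tr a b"]
  note q2 = quad_perm(1)[OF q]
  show "kappa a (act a b f) = kappa a f"
    unfolding kappa_quad[OF f q] kappa_quad[OF g q]
    by (simp add: qv_act[OF f q] qv_act[OF f q2] rv_act[OF f q])
  have q3: "quad c a b d" using q by (rule quad_perm)
  show "kappa c (act a b f) = kappa c f"
    unfolding kappa_quad[OF f q3] kappa_quad[OF g q3]
    by (simp add: qv_act[OF f q] qv_act[OF f q2] rv_act[OF f q] ac_simps)
qed

lemma M_quad:
  assumes "S \<subseteq> {..<4}" "f \<in> M S" and q: "quad a b c d"
  shows "(if a \<in> S then qv f a j else 0) + ((if b \<in> S then qv f b j else 0) +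
      ((if c \<in> S then qv f c j else 0) + (if d \<in> S then qv f d j else 0))) = 0 \<or> \<not> j < 4"
    "(if a \<in> S then qv f a b else 0) + (if b \<in> S then qv f a b else 0) +
      (if c \<in> S then rv f d else 0) + (if d \<in> S then rv f c else 0) = 0"
proof -
  have "(\<Sum>i\<in>S. qv f i j) = (\<Sum>i<4. if i \<in> S then qv f i j else 0)"
    using assms(1) by (simp add: sum.If_cases Int_absorb1)
  then show "(if a \<in> S then qv f a j else 0) + ((if b \<in> S then qv f b j else 0) +
      ((if c \<in> S then qv f c j else 0) + (if d \<in> S then qv f d j else 0))) = 0 \<or> \<not> j < 4"
    using assms(2) unfolding M_iff[OF assms(1)] quad_sum[OF q] by auto
  show "(if a \<in> S then qv f a b else 0) + (if b \<in> S then qv f a b else 0) +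
      (if c \<in> S then rv f d else 0) + (if d \<in> S then rv f c else 0) = 0"
    using assms(2) q unfolding M_iff[OF assms(1)] by blast
qed

lemma kappa_indep:
  assumes S: "S \<subseteq> {..<4}" and f: "f \<in> M S" and p: "p \<in> S" "r \<in> S"
  shows "kappa p f = kappa r f"
proof (cases "p = r")
  case False
  then obtain k l where q: "quad p r k l" using quad_exists2[of p r] p S by auto
  note q' = quadD[OF q]
  have f3: "f \<in> PA 3" using f by (rule M_PA)
  note sym = qv_sym[OF f3]
  define e where "e = (if k \<in> S then 1 else 0 :: bit)"
  define e' where "e' = (if l \<in> S then 1 else 0 :: bit)"
  have j: "qv f p j + qv f r j + e * qv f k j + e' * qv f l j = 0" if "j < 4" for j
    using M_quad(1)[OF S f q, of j] p that by (simp add: e_def e'_def add.assoc split: if_splits)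
  have kl: "e * qv f k l + e' * qv f k l + rv f r + rv f p = 0"
    using p M_quad(2)[OF S f quad_perm(16)[OF q]]
    by (simp add: e_def e'_def ac_simps split: if_splits)
  have kp: "kappa p f = qv f r r + (qv f k k + (qv f l l + (qv f r k + (qv f r l + (qv f k l + rv f p)))))"
    by (rule kappa_quad[OF f3 q])
  have kr: "kappa r f = qv f p p + (qv f k k + (qv f l l + (qv f p k + (qv f p l + (qv f k l + rv f r)))))"
    by (rule kappa_quad[OF f3 quad_perm(3)[OF q]])
  define pp rr kk ll pr pk pl rk rl kl' where
    defs: "pp = qv f p p" "rr = qv f r r" "kk = qv f k k" "ll = qv f l l" "pr = qv f p r" "pk = qv f p k" "pl = qv f p l"
      "rk = qv f r k" "rl = qv f r l" "kl' = qv f k l"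
  have J: "pp + pr + e * pk + e' * pl = 0" "pr + rr + e * rk + e' * rl = 0"
    "pk + rk + e * kk + e' * kl' = 0" "pl + rl + e * kl' + e' * ll = 0"
    using j[OF q'(1)] j[OF q'(2)] j[OF q'(3)] j[OF q'(4)] sym q' by (simp_all add: defs)
  have KL: "e * kl' + e' * kl' + rv f r + rv f p = 0" using kl by (simp add: defs)
  have ee: "e * e = e" "e' * e' = e'" by (auto simp: e_def e'_def)
  have "kappa p f + kappa r f = pp + rr + rk + rl + pk + pl + rv f p + rv f r"
    unfolding kp kr defs by (simp add: ac_simps)
  also have "\<dots> = (pp + pr + e * pk + e' * pl) + (pr + rr + e * rk + e' * rl)
      + (pk + rk + e * kk + e' * kl') + (pl + rl + e * kl' + e' * ll)
      + (e * kl' + e' * kl' + rv f r + rv f p)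
      + e * (pk + rk + e * kk + e' * kl') + e' * (pl + rl + e * kl' + e' * ll)"
    using ee by (cases "k \<in> S"; cases "l \<in> S") (simp_all add: e_def e'_def ac_simps)
  also have "\<dots> = 0" unfolding J KL by simp
  finally show ?thesis by simp
qed simp

lemma M_single:
  assumes f: "f \<in> M {p}" and q: "quad p a b c"
  shows "j < 4 \<Longrightarrow> qv f p j = 0" "j < 4 \<Longrightarrow> qv f j p = 0" "rv f a = 0" "rv f b = 0" "rv f c = 0"
proof -
  note q' = quadD[OF q]
  have S: "{p} \<subseteq> {..<4}" using q' by auto
  have f3: "f \<in> PA 3" using f by (rule M_PA)
  show 1: "qv f p j = 0" if "j < 4" for j
    using M_quad(1)[OF S f q, of j] q' that by simp
  show "j < 4 \<Longrightarrow> qv f j p = 0" using 1 qv_sym[OF f3 _ q'(1)] by simp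
  show "rv f a = 0" "rv f b = 0" "rv f c = 0"
    using M_quad(2)[OF S f quad_perm(16)[OF q]] M_quad(2)[OF S f quad_perm(10)[OF q]]
      M_quad(2)[OF S f quad_perm(8)[OF q]] q' by simp_all
qed

lemma kappa_act:
  assumes ab: "a < 4" "b < 4" "a \<noteq> b" and S: "S \<subseteq> {..<4}" and f: "f \<in> M S"
    and p: "p \<in> S" and r: "r \<in> tog a b S"
  shows "kappa r (act a b f) = kappa p f"
proof -
  have f3: "f \<in> PA 3" using f by (rule M_PA)
  have g: "act a b f \<in> M (tog a b S)" by (rule act_M[OF ab S f])
  have S': "tog a b S \<subseteq> {..<4}" using tog_subset ab S by blast
  obtain c d where q: "quad a b c d" using quad_exists2 ab by blast
  have main: "kappa r (act a b f) = kappa p f" if "x \<in> S" "x \<in> tog a b S" "kappa x (act a b f) = kappa x f" for x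
    using kappa_indep[OF S f p that(1)] kappa_indep[OF S' g r that(2)] that(3) by simp
  show ?thesis
  proof (cases "a \<in> S")
    case True
    then show ?thesis using main[of a] kappa_act1(1)[OF f3 q] ab by (simp add: tog_def)
  next
    case False
    then have t: "tog a b S = S" by (simp add: tog_def)
    show ?thesis
    proof (cases "S = {b}")
      case True
      have q2: "quad b a c d" using q by (rule quad_perm)
      have fb: "f \<in> M {b}" using f True by simp
      note q' = quadD[OF q]
      have "kappa b (act a b f) = kappa b f"
        unfolding kappa_quad[OF f3 q2] kappa_quad[OF gact_PA[OF f3] q2]
        using M_single[OF fb q2] q' by (simp add: qv_act[OF f3 q] qv_act[OF f3 quad_perm(1)[OF q]] rv_act[OF f3 q])
      then show ?thesis using main[of b] t True by simp
    next
      case 2: False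
      then obtain x where x: "x \<in> S" "x \<noteq> b" "x \<noteq> a" using p False by blast
      then obtain y where "quad a b x y" using quad_exists3[of a b x] ab S by blast
      then show ?thesis using main[of x] kappa_act1(2)[OF f3] x t by simp
    qed
  qed
qed

text \<open>The basis dual to the coordinates \<open>qv\<close>, \<open>rv\<close>.\<close>

definition dq :: "nat \<Rightarrow> nat \<Rightarrow> mono \<Rightarrow> bit" where
  "dq i j m = (if m = ex i + (ex i + ex j) \<or> m = ex i + (ex j + ex j) then 1 else 0)"

definition dr :: "nat \<Rightarrow> mono \<Rightarrow> bit" where
  "dr i m = (if m = X3 i then 1 else 0)"

lemma ex_eq_iff:
  "ex k + (ex k + ex l) = ex i + (ex i + ex j) \<longleftrightarrow> k = i \<and> l = j"
proof
  assume eq: "ex k + (ex k + ex l) = ex i + (ex i + ex j)"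
  have v: "Poly_Mapping.lookup (ex k + (ex k + ex l)) x = Poly_Mapping.lookup (ex i + (ex i + ex j)) x" for x
    using eq by simp
  have "l = j" using v[of l] v[of j] by (auto simp: lookup_add lookup_single when_def split: if_splits)
  moreover have "k = i" using v[of k] v[of i] by (auto simp: lookup_add lookup_single when_def split: if_splits)
  ultimately show "k = i \<and> l = j" by simp
qed auto

lemma X3_neq: "i < 4 \<Longrightarrow> X3 i \<noteq> ex k + (ex k + ex l)"
proof
  assume i: "i < 4" and eq: "X3 i = ex k + (ex k + ex l)"
  have "Poly_Mapping.lookup (X3 i) k = Poly_Mapping.lookup (ex k + (ex k + ex l)) k" using eq by simp
  then show False using i by (auto simp: lookup_X3 lookup_add lookup_single when_def split: if_splits)
qed

lemma ex_rot: "ex i + (ex j + ex j) = ex j + (ex j + ex i)"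
  by (simp add: ac_simps)

lemma qv_dq: "qv (dq i j) k l = (if k = i \<and> l = j \<or> k = j \<and> l = i then 1 else 0)"
  unfolding qv_def dq_def ex_rot[of i j] ex_eq_iff by auto

lemma rv_dq: "k < 4 \<Longrightarrow> rv (dq i j) k = 0"
  unfolding rv_def dq_def ex_rot[of i j] by (simp add: X3_neq)

lemma qv_dr: "i < 4 \<Longrightarrow> qv (dr i) k l = 0"
  unfolding qv_def dr_def using X3_neq by metis

lemma X3_inj: "i < 4 \<Longrightarrow> j < 4 \<Longrightarrow> X3 i = X3 j \<longleftrightarrow> i = j"
  using X3_parity[of i 0 j 0] by auto

lemma rv_dr: "i < 4 \<Longrightarrow> k < 4 \<Longrightarrow> rv (dr i) k = (if k = i then 1 else 0)"
  unfolding rv_def dr_def by (simp add: X3_inj)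

lemma dq_PA: "i < 4 \<Longrightarrow> j < 4 \<Longrightarrow> dq i j \<in> PA 3"
  unfolding PA3_iff
proof (intro conjI allI impI)
  show "i < 4 \<Longrightarrow> j < 4 \<Longrightarrow> dq i j \<in> dual4 3"
    by (auto simp: dual4_def dq_def monos4_def keys_plus_nat mdeg_add)
  show "dq i j (ex k + (ex k + ex l)) = dq i j (ex k + (ex l + ex l))" for k l
    unfolding dq_def ex_rot[of i j] ex_rot[of k l] ex_eq_iff by auto
qed

lemma dr_PA: "i < 4 \<Longrightarrow> dr i \<in> PA 3"
  unfolding PA3_iff
proof (intro conjI allI impI)
  show "i < 4 \<Longrightarrow> dr i \<in> dual4 3"
    using four_X3 by (auto simp: dual4_def dr_def monos4_def mdeg_X3)
  show "i < 4 \<Longrightarrow> dr i (ex k + (ex k + ex l)) = dr i (ex k + (ex l + ex l))" for k l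
    using X3_neq[of i k l] X3_neq[of i l k] unfolding dr_def ex_rot[of k l] by auto
qed

lemma dq_M:
  assumes S: "S \<subseteq> {..<4}" and ab: "a < 4" "b < 4" "a \<notin> S" "b \<notin> S" shows "dq a b \<in> M S"
  unfolding M_iff[OF S]
proof (intro conjI allI impI)
  show "dq a b \<in> PA 3" using ab by (simp add: dq_PA)
  show "(\<Sum>i\<in>S. qv (dq a b) i j) = 0" for j
    using ab by (intro sum.neutral) (auto simp: qv_dq)
  fix x y z w assume "quad x y z w"
  from quadD(3,4)[OF this] show "(if x \<in> S then qv (dq a b) x y else 0) + (if y \<in> S then qv (dq a b) x y else 0) +
      (if z \<in> S then rv (dq a b) w else 0) + (if w \<in> S then rv (dq a b) z else 0) = 0"
    using ab by (auto simp: qv_dq rv_dq)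
qed

lemma dr_M: "p < 4 \<Longrightarrow> dr p \<in> M {p}"
proof -
  assume p: "p < 4"
  then have S: "{p} \<subseteq> {..<4}" by simp
  show ?thesis unfolding M_iff[OF S] using p by (auto simp: dr_PA qv_dr rv_dr dest: quadD)
qed

lemma fscale_simps [simp]: "fscale 0 f = 0" "fscale 1 f = f"
  by (auto simp: fscale_def fun_eq_iff)

lemma qv_fscale [simp]: "qv (fscale c f) i j = c * qv f i j" and rv_fscale [simp]: "rv (fscale c f) i = c * rv f i"
  by (simp_all add: qv_def rv_def fscale_def)

lemma fscale_PA: "f \<in> PA n \<Longrightarrow> fscale c f \<in> PA n"
  by (cases c) auto

lemma M_single_decomp:
  assumes f: "f \<in> M {p}" and q: "quad p a b c"
  shows "f = fscale (qv f a a) (dq a a) + (fscale (qv f b b) (dq b b) + (fscale (qv f c c) (dq c c) +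
    (fscale (qv f a b) (dq a b) + (fscale (qv f a c) (dq a c) + (fscale (qv f b c) (dq b c) + fscale (rv f p) (dr p))))))"
    (is "f = ?g")
proof (rule PA3_eqI)
  note q' = quadD[OF q]
  show f3: "f \<in> PA 3" using f by (rule M_PA)
  show "?g \<in> PA 3" using q' by (intro PA_add fscale_PA dq_PA dr_PA)
  show "qv f i j = qv ?g i j" if "i < 4" "j < 4" for i j
    using that unfolding quad_cases[OF q]
    by (elim disjE) (simp_all add: M_single[OF f q] q' qv_sym[OF f3 q'(3,2)] qv_sym[OF f3 q'(4,2)]
        qv_sym[OF f3 q'(4,3)] qv_dq qv_dr)
  show "rv f i = rv ?g i" if "i < 4" for i
    using that unfolding quad_cases[OF q]
    by (elim disjE) (simp_all add: M_single[OF f q] q' rv_dq rv_dr)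
qed

abbreviation W :: "nat \<Rightarrow> (mono \<Rightarrow> bit) set" where
  "W s \<equiv> fs.span (rels (dg s))"

lemma fun_add_self [simp]: "f + f = (0 :: mono \<Rightarrow> bit)" "f + (f + g) = (g :: mono \<Rightarrow> bit)"
  by (simp_all add: fun_eq_iff)

lemma act_dq1:
  assumes q: "quad a b c d"
  shows "act a b (dq b b) + dq b b = dq a a + dq a b"
proof (rule PA3_eqI)
  note q' = quadD[OF q]
  have f: "dq b b \<in> PA 3" using q' by (simp add: dq_PA)
  note qa = qv_act[OF f q] qv_act[OF f quad_perm(1)[OF q]] rv_act[OF f q] rv_act[OF f quad_perm(1)[OF q]]
  show "act a b (dq b b) + dq b b \<in> PA 3" "dq a a + dq a b \<in> PA 3"
    by (intro PA_add gact_PA dq_PA q')+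
  show "qv (act a b (dq b b) + dq b b) i j = qv (dq a a + dq a b) i j" if "i < 4" "j < 4" for i j
    using that unfolding quad_cases[OF q] by (elim disjE) (simp_all add: q' qa qv_dq)
  show "rv (act a b (dq b b) + dq b b) i = rv (dq a a + dq a b) i" if "i < 4" for i
    using that unfolding quad_cases[OF q] by (elim disjE) (simp_all add: q' qa qv_dq rv_dq)
qed

lemma act_dq2:
  assumes q: "quad a b c d"
  shows "act a b (dq b c) + dq b c = dq a c + dr d"
proof (rule PA3_eqI)
  note q' = quadD[OF q]
  have f: "dq b c \<in> PA 3" using q' by (simp add: dq_PA)
  note qa = qv_act[OF f q] qv_act[OF f quad_perm(1)[OF q]] rv_act[OF f q] rv_act[OF f quad_perm(1)[OF q]]
  show "act a b (dq b c) + dq b c \<in> PA 3" "dq a c + dr d \<in> PA 3"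
    by (intro PA_add gact_PA dq_PA dr_PA q')+
  show "qv (act a b (dq b c) + dq b c) i j = qv (dq a c + dr d) i j" if "i < 4" "j < 4" for i j
    using that unfolding quad_cases[OF q] by (elim disjE) (simp_all add: q' qa qv_dq qv_dr)
  show "rv (act a b (dq b c) + dq b c) i = rv (dq a c + dr d) i" if "i < 4" for i
    using that unfolding quad_cases[OF q] by (elim disjE) (simp_all add: q' qa qv_dq rv_dq rv_dr)
qed

lemma theta_rel:
  assumes ab: "a < 4" "b < 4" "a \<noteq> b" and S: "S \<subseteq> {..<4}" and f: "f \<in> M S"
  shows "theta s (tog a b S) (act a b f) + theta s S f \<in> W s"
  using act_rels[OF ab theta_V[OF S f, of s]] by (simp add: act_theta[OF ab S f])

lemma theta_single_dq:
  assumes q: "quad p a b c"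
  shows "theta s {p} (dq a b) + theta s {p} (dr p) \<in> W s" "theta s {p} (dq a a) + theta s {p} (dr p) \<in> W s"
proof -
  note q' = quadD[OF q]
  have S: "{p} \<subseteq> {..<4}" using q' by simp
  have t: "tog x y {p} = {p}" if "x \<noteq> p" for x y using that by (simp add: tog_def)
  have rel: "theta s {p} (act x y f + f) \<in> W s" if "x < 4" "y < 4" "x \<noteq> y" "x \<noteq> p" "f \<in> M {p}" for x y f
    using theta_rel[OF that(1-3) S that(5), of s] t[OF that(4)] theta_add[OF S _ that(5)]
      act_M[OF that(1-3) S that(5)] by simp
  have d: "dq i j \<in> M {p}" if "i < 4" "j < 4" "i \<noteq> p" "j \<noteq> p" for i j
    using dq_M[OF S] that by simp
  have "theta s {p} (dq a b + dr p) \<in> W s"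
    using rel[OF q'(2,4,9) q'(11) d[OF q'(4,3) q'(13,12)]] act_dq2[OF quad_perm(11)[OF q]] by simp
  then show 1: "theta s {p} (dq a b) + theta s {p} (dr p) \<in> W s"
    using theta_add[OF S d dr_M] q' by simp
  have "theta s {p} (dq a a + dq a b) \<in> W s"
    using rel[OF q'(2,3,8) q'(11) d[OF q'(3,3) q'(12,12)]] act_dq1[OF quad_perm(9)[OF q]] by simp
  then have "theta s {p} (dq a a) + theta s {p} (dq a b) \<in> W s"
    using theta_add[OF S d d] q' by simp
  from fs.span_add[OF this 1] show "theta s {p} (dq a a) + theta s {p} (dr p) \<in> W s"
    by (simp add: add.assoc)
qed

lemma theta_single:
  assumes f: "f \<in> M {p}" and p: "p < 4"
  shows "theta s {p} f + fscale (kappa p f) (theta s {p} (dr p)) \<in> W s"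
proof -
  obtain a b c where q: "quad p a b c" using quad_exists1 p by blast
  note q' = quadD[OF q]
  have S: "{p} \<subseteq> {..<4}" using p by simp
  let ?P = "\<lambda>f. f \<in> M {p} \<and> theta s {p} f + fscale (kappa p f) (theta s {p} (dr p)) \<in> W s"
  have add: "?P (f + g)" if "?P f" "?P g" for f g
  proof -
    have eq: "theta s {p} (f + g) + fscale (kappa p (f + g)) (theta s {p} (dr p)) =
      (theta s {p} f + fscale (kappa p f) (theta s {p} (dr p))) + (theta s {p} g + fscale (kappa p g) (theta s {p} (dr p)))"
      unfolding kappa_add theta_add[OF S conjunct1[OF that(1)] conjunct1[OF that(2)]] fs.scale_left_distrib
      by (simp add: ac_simps)
    show ?thesis unfolding eq using that by (auto intro: fs.span_add M_add)
  qed
  have scale: "?P (fscale c f)" if "?P f" for c f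
    using that by (cases c) (auto simp: fs.span_zero)
  have d1: "?P (dq i j)" if "quad p i j k" for i j k
  proof -
    note i' = quadD[OF that]
    have "dq i j \<in> M {p}" using dq_M[OF S, of i j] i' by simp
    moreover have "kappa p (dq i j) = 1"
      unfolding kappa_quad[OF dq_PA[OF i'(2,3)] that] using i' by (simp add: qv_dq rv_dq)
    ultimately show ?thesis using theta_single_dq(1)[OF that] by simp
  qed
  have d2: "?P (dq i i)" if "quad p i j k" for i j k
  proof -
    note i' = quadD[OF that]
    have "dq i i \<in> M {p}" using dq_M[OF S, of i i] i' by simp
    moreover have "kappa p (dq i i) = 1"
      unfolding kappa_quad[OF dq_PA[OF i'(2,2)] that] using i' by (simp add: qv_dq rv_dq)
    ultimately show ?thesis using theta_single_dq(2)[OF that] by simp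
  qed
  have d3: "?P (dr p)"
  proof -
    have "kappa p (dr p) = 1"
      unfolding kappa_quad[OF dr_PA[OF p] q] using q' by (simp add: qv_dr rv_dr)
    then show ?thesis using dr_M[OF p] by (simp add: fs.span_zero)
  qed
  have "?P f"
    by (subst M_single_decomp[OF f q], subst (2) M_single_decomp[OF f q], subst (3) M_single_decomp[OF f q])
       (rule add scale d1 d2 d3 q quad_perm[OF q])+
  then show ?thesis by blast
qed

lemma theta_kappa:
  assumes "S \<subseteq> {..<4}" "f \<in> M S" "p \<in> S"
  shows "theta s S f + fscale (kappa p f) (theta s {0} (dr 0)) \<in> W s"
proof -
  define Q where "Q S \<longleftrightarrow> S \<subseteq> {..<4} \<and> (\<forall>f\<in>M S. \<forall>p\<in>S. theta s S f + fscale (kappa p f) (theta s {0} (dr 0)) \<in> W s)" for S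
  have pull: "Q S" if "Q (tog a b S)" and ab: "a < 4" "b < 4" "a \<noteq> b" and S: "S \<subseteq> {..<4}" for a b S
    unfolding Q_def
  proof (intro conjI ballI S)
    fix f p assume f: "f \<in> M S" and p: "p \<in> S"
    have "\<exists>r. r \<in> tog a b S" using p ab by (auto simp: tog_def)
    then obtain r where r: "r \<in> tog a b S" ..
    have "theta s (tog a b S) (act a b f) + fscale (kappa p f) (theta s {0} (dr 0)) \<in> W s"
      using that(1) r act_M[OF ab S f] kappa_act[OF ab S f p r] unfolding Q_def by metis
    from fs.span_add[OF theta_rel[OF ab S f, of s] this]
    show "theta s S f + fscale (kappa p f) (theta s {0} (dr 0)) \<in> W s"
      by (simp add: ac_simps)
  qed
  have q0: "Q {0}" using theta_single[of _ 0] by (auto simp: Q_def)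
  have q1: "Q {a}" if "a < 4" for a
  proof (cases "a = 0")
    case False
    have "tog 0 a {0, a} = {0}" "tog a 0 {a} = {0, a}" using False by (auto simp: tog_def)
    then show ?thesis using pull[of 0 a "{0, a}"] pull[of a 0 "{a}"] q0 False that by simp
  qed (simp add: q0)
  have "Q S" if "a \<in> S" "S \<subseteq> {..<4}" for a S
    using that
  proof (induction "card S" arbitrary: S rule: less_induct)
    case less
    show ?case
    proof (cases "S = {a}")
      case True
      then show ?thesis using q1 less by simp
    next
      case False
      then obtain b where b: "b \<in> S" "b \<noteq> a" using less by blast
      have "finite S" using less finite_subset by blast
      then have "card (S - {b}) < card S" using b by (intro psubset_card_mono) auto
      then have "Q (S - {b})" using less b by (intro less(1)) auto
      moreover have "tog a b S = S - {b}" using b less by (simp add: tog_def)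
      ultimately show ?thesis using pull[of a b S] b less by auto
    qed
  qed
  then show ?thesis using assms unfolding Q_def by blast
qed

section \<open>Descent on the support\<close>

declare theta.simps(2) [simp del]

primrec slices :: "nat list \<Rightarrow> (mono \<Rightarrow> bit) \<Rightarrow> mono \<Rightarrow> bit" where
  "slices [] f = f"
| "slices (i # I) f = slices I (slice i f)"

lemma slices_append: "slices (I @ J) f = slices J (slices I f)"
  by (induction I arbitrary: f) simp_all

lemma slices_add: "slices I (f + g) = slices I f + slices I g"
  by (induction I arbitrary: f g) (simp_all add: slice_add)

lemma slices_0 [simp]: "slices I 0 = 0"
  by (induction I) (simp_all only: slices.simps slice_0)

lemma slices_V: "f \<in> V (length I + s) \<Longrightarrow> set I \<subseteq> {..<4} \<Longrightarrow> slices I f \<in> V s"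
proof (induction I arbitrary: f)
  case (Cons i I)
  then have "slice i f \<in> V (length I + s)" using V_slice[of f "length I + s" i] by simp
  then show ?case using Cons by simp
qed simp

lemma slices_move_front:
  assumes "f \<in> V (Suc (length J1 + length J2))" "set J1 \<subseteq> {..<4}" "i < 4"
  shows "slices (J1 @ i # J2) f = slices (i # J1 @ J2) f"
  using assms
proof (induction J1 arbitrary: f)
  case (Cons j J1)
  then have "slice j f \<in> V (Suc (length J1 + length J2))"
    using V_slice[of f "Suc (length J1 + length J2)" j] by simp
  then have "slices (J1 @ i # J2) (slice j f) = slices (J1 @ J2) (slice i (slice j f))"
    using Cons by simp
  also have "slice i (slice j f) = slice j (slice i f)"
    using Cons.prems V_slice_commute[of f "length J1 + length J2" i j] by simp
  finally show ?case by simp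
qed simp

lemma slices_mset:
  assumes "mset I = mset J" "f \<in> V (length I)" "set I \<subseteq> {..<4}"
  shows "slices I f = slices J f"
  using assms
proof (induction I arbitrary: J f)
  case (Cons i I)
  have "i \<in> set J" using Cons.prems(1) by (metis list.set_intros(1) set_mset_mset)
  then obtain J1 J2 where J: "J = J1 @ i # J2" by (meson split_list)
  have m: "mset I = mset (J1 @ J2)" using Cons.prems(1) J by simp
  have len: "length I = length J1 + length J2" using arg_cong[OF m, of size] by simp
  have "set I = set J1 \<union> set J2" using arg_cong[OF m, of set_mset] by simp
  then have "slices J f = slices (i # J1 @ J2) f"
    unfolding J using Cons.prems len by (intro slices_move_front) auto
  also have "\<dots> = slices I (slice i f)"
    using Cons.IH[OF m, of "slice i f"] Cons.prems V_slice[of f "length I" i] by simp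
  finally show ?case by simp
qed simp

lemma slice_aab:
  assumes f: "f \<in> V (Suc (Suc (Suc s)))" and ab: "a < 4" "b < 4"
  shows "slice b (slice a (slice a f)) = slice b (slice b (slice a f))"
proof (cases "a = b")
  case False
  have good: "good (slice i (slice i f))" if "i < 4" for i
    using f that V_slice V_good by blast
  have "slice b (slice a (slice a f)) = slice a (slice b (slice b f))"
    using Glue_iff[of "\<lambda>i. slice i (slice i f)", OF good] V_Glue_diag[OF f] ab False by blast
  also have "\<dots> = slice b (slice a (slice b f))"
    using V_slice_commute[of "slice b f" s a b] V_slice[OF f] ab by simp
  also have "slice a (slice b f) = slice b (slice a f)"
    using V_slice_commute[OF f] ab by simp
  finally show ?thesis .
qed simp

lemma slices_replace:
  assumes f: "f \<in> V (Suc (length J))" and J: "set J \<subseteq> {..<4}" and ab: "a \<in> set J" "b \<in> set J"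
  shows "slices (a # J) f = slices (b # J) f"
proof (cases "a = b")
  case False
  define R where "R = remove1 b (remove1 a J)"
  have "mset J = add_mset a (mset (remove1 a J))" using ab by simp
  moreover have "b \<in> set (remove1 a J)" using ab False by (simp add: in_set_remove1)
  then have "mset (remove1 a J) = add_mset b (mset R)"
    unfolding R_def mset_remove1[of b] by (metis insert_DiffM set_mset_mset)
  ultimately have mJ: "mset J = mset (a # b # R)" by simp
  have len: "length J = Suc (Suc (length R))" using arg_cong[OF mJ, of size] by simp
  have ab4: "a < 4" "b < 4" using ab J by auto
  have "slices (a # J) f = slices (a # a # b # R) f"
    using f J ab4 mJ by (intro slices_mset) auto
  also have "\<dots> = slices R (slice b (slice a (slice a f)))" by simp
  also have "\<dots> = slices R (slice b (slice b (slice a f)))"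
    using slice_aab[of f "length R" a b] f len ab4 by simp
  also have "\<dots> = slices (a # b # b # R) f" by simp
  also have "\<dots> = slices (b # J) f"
    using f J ab4 mJ by (intro slices_mset[symmetric]) auto
  finally show ?thesis .
qed simp

lemma slices_normal:
  assumes "f \<in> V (length I)" "set I \<subseteq> {..<4}" "a \<in> set I"
  shows "slices I f = slices (replicate (length I - card (set I)) a @ sorted_list_of_set (set I)) f"
  using assms
proof (induction "length I" arbitrary: I f)
  case (Suc n)
  show ?case
  proof (cases "distinct I")
    case True
    then have "mset I = mset (sorted_list_of_set (set I))"
      by (intro set_eq_iff_mset_eq_distinct[THEN iffD1]) auto
    then have "slices I f = slices (sorted_list_of_set (set I)) f"
      using Suc.prems by (intro slices_mset)
    then show ?thesis using True by (simp add: distinct_card)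
  next
    case False
    then obtain xs y ys zs where I: "I = xs @ [y] @ ys @ [y] @ zs" using not_distinct_decomp by blast
    define J where "J = xs @ ys @ [y] @ zs"
    have J: "mset I = mset (y # J)" "set J = set I" "length J = n" "y \<in> set J"
      using Suc.hyps(2) by (auto simp: I J_def)
    have f: "f \<in> V (Suc (length J))" using Suc.prems(1) Suc.hyps(2) J(3) by simp
    have a4: "a < 4" using Suc.prems by auto
    have "slices I f = slices (y # J) f" using J(1) Suc.prems by (intro slices_mset)
    also have "\<dots> = slices (a # J) f" using f J Suc.prems by (intro slices_replace) auto
    also have "\<dots> = slices (replicate (length J - card (set J)) a @ sorted_list_of_set (set J)) (slice a f)"
      using Suc.hyps(1)[of J "slice a f"] J V_slice[OF f a4] Suc.prems by simp
    also have "\<dots> = slices (replicate (Suc (length J - card (set J))) a @ sorted_list_of_set (set J)) f"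
      by simp
    also have "Suc (length J - card (set J)) = length I - card (set I)"
      using card_length[of J] J Suc.hyps(2) by simp
    finally show ?thesis by (simp add: J(2))
  qed
qed simp

text \<open>By \<open>slices_normal\<close> an iterated slice only depends on the set of its indices; \<open>cl s S\<close> is an arbitrary
  index list of length \<open>s\<close> with underlying set \<open>S\<close>.\<close>

definition cl :: "nat \<Rightarrow> nat set \<Rightarrow> nat list" where
  "cl s S = replicate (s - card S) (Min S) @ sorted_list_of_set S"

lemma cl:
  assumes "S \<subseteq> {..<4}" "S \<noteq> {}" "card S \<le> s"
  shows "length (cl s S) = s" "set (cl s S) = S"
proof -
  have fin: "finite S" using assms finite_subset by blast
  then show "length (cl s S) = s" using assms by (simp add: cl_def)
  have "Min S \<in> S" using fin assms by simp
  then show "set (cl s S) = S" using fin by (auto simp: cl_def)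
qed

definition Fs :: "nat \<Rightarrow> nat set \<Rightarrow> (mono \<Rightarrow> bit) \<Rightarrow> mono \<Rightarrow> bit" where
  "Fs s S f = slices (cl s S) f"

lemma slices_Fs:
  assumes "f \<in> V (length I)" "set I \<subseteq> {..<4}" "I \<noteq> []"
  shows "slices I f = Fs (length I) (set I) f"
  unfolding Fs_def cl_def by (rule slices_normal) (use assms in auto)

lemma Fs_add: "Fs s S (f + g) = Fs s S f + Fs s S g"
  by (simp add: Fs_def slices_add)

lemma Fs_0 [simp]: "Fs s S 0 = 0"
  by (simp add: Fs_def)

lemma Fs_sum: "Fs s S (sum g A) = (\<Sum>x\<in>A. Fs s S (g x))"
  by (induction A rule: infinite_finite_induct) (simp_all add: Fs_add del: zero_fun_apply plus_fun_apply)

lemma Fs_PA: "f \<in> V s \<Longrightarrow> S \<subseteq> {..<4} \<Longrightarrow> S \<noteq> {} \<Longrightarrow> card S \<le> s \<Longrightarrow> Fs s S f \<in> PA 3"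
  using slices_V[of f "cl s S" 0] cl[of S s] by (simp add: Fs_def)

lemma slices_theta: "set I \<subseteq> {..<4} \<Longrightarrow> slices I (theta (length I) S g) = (if set I \<subseteq> S then g else 0)"
proof (induction I)
  case (Cons i I)
  then show ?case using slice_theta[of i "length I" S g] by (simp del: theta.simps(2))
qed simp

lemma Fs_theta: "T \<subseteq> {..<4} \<Longrightarrow> T \<noteq> {} \<Longrightarrow> card T \<le> s \<Longrightarrow> Fs s T (theta s S g) = (if T \<subseteq> S then g else 0)"
  using slices_theta[of "cl s T" S g] cl[of T s] by (simp add: Fs_def)

lemma Fs_rel:
  assumes f: "f \<in> V (Suc s)" and S: "S \<subseteq> {..<4}" "S \<noteq> {}" "card S \<le> s"
  shows "(\<Sum>i<4. Fs (Suc s) (insert i S) f (ex i + z)) = 0"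
proof -
  let ?J = "cl s S"
  note c = cl[OF S]
  have "slices ?J f \<in> V (Suc 0)" using slices_V[of f ?J "Suc 0"] f S c by simp
  then have "Glue (\<lambda>i. slice i (slices ?J f))" by (rule V_Glue)
  moreover have "slice i (slices ?J f) = Fs (Suc s) (insert i S) f" if "i < 4" for i
  proof -
    have "slices (?J @ [i]) f = Fs (length (?J @ [i])) (set (?J @ [i])) f"
      using f c S that by (intro slices_Fs) auto
    then show ?thesis using c by (simp add: slices_append)
  qed
  ultimately show ?thesis by (simp add: Glue_def)
qed

lemma Glue_diag: "(\<And>i. i < 4 \<Longrightarrow> g i \<in> V t) \<Longrightarrow> Glue g \<Longrightarrow> Glue (\<lambda>i. slices (replicate t i) (g i))"
proof (induction t arbitrary: g)
  case (Suc t)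
  have "Glue (\<lambda>i. slice i (g i))"
    using Glue_iff[of g] V_good Suc.prems by blast
  then have "Glue (\<lambda>i. slices (replicate t i) (slice i (g i)))"
    using Suc.prems(1) V_slice by (intro Suc.IH) auto
  then show ?case by simp
qed simp

lemma Fs_rel_empty:
  assumes f: "f \<in> V (Suc s)"
  shows "(\<Sum>i<4. Fs (Suc s) {i} f (ex i + z)) = 0"
proof -
  have "Glue (\<lambda>i. slices (replicate s i) (slice i f))"
    using f V_slice V_Glue by (intro Glue_diag) auto
  moreover have "slices (replicate s i) (slice i f) = Fs (Suc s) {i} f" if "i < 4" for i
    using slices_Fs[of f "replicate (Suc s) i"] f that by (cases "s = 0") auto
  ultimately show ?thesis by (simp add: Glue_def)
qed

lemma Fs_eq_0:
  assumes f: "f \<in> V (Suc s)" and 0: "\<And>S. S \<subseteq> {..<4} \<Longrightarrow> S \<noteq> {} \<Longrightarrow> card S \<le> Suc s \<Longrightarrow> Fs (Suc s) S f = 0"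
  shows "f = 0"
proof -
  have "(\<And>I. length I = n \<Longrightarrow> set I \<subseteq> {..<4} \<Longrightarrow> slices I f = 0) \<Longrightarrow> f \<in> V n \<Longrightarrow> f = 0" for n f
  proof (induction n arbitrary: f)
    case 0
    then show ?case using 0(1)[of "[]"] by simp
  next
    case (Suc n)
    show ?case
    proof (rule V_eqI)
      show "f \<in> V (Suc n)" by (rule Suc.prems)
      show "0 \<in> V (Suc n)" by simp
      fix i :: nat assume i: "i < 4"
      have "slices I (slice i f) = 0" if "length I = n" "set I \<subseteq> {..<4}" for I
        using Suc.prems(1)[of "i # I"] that i by (simp del: zero_fun_apply)
      from Suc.IH[OF this V_slice[OF Suc.prems(2) i]] have "slice i f = 0" .
      then show "slice i f = slice i 0" by (simp del: zero_fun_apply)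
    qed
  qed
  moreover have "slices I f = 0" if "length I = Suc s" "set I \<subseteq> {..<4}" for I
  proof -
    have "I \<noteq> []" using that by auto
    then show ?thesis using slices_Fs[of f I] that f 0[of "set I"] card_length[of I] by auto
  qed
  ultimately show ?thesis using f by blast
qed

definition nes :: "nat set set" where "nes = Pow {..<4} - {{}}"

lemma nes_iff: "S \<in> nes \<longleftrightarrow> S \<subseteq> {..<4} \<and> S \<noteq> {}" by (auto simp: nes_def)

lemma finite_nes [simp]: "finite nes" by (simp add: nes_def)

definition U :: "nat \<Rightarrow> (mono \<Rightarrow> bit) set" where
  "U s = {(\<Sum>S\<in>nes. theta s S (m S)) | m. \<forall>S. m S \<in> M S}"

lemma U_0 [simp]: "0 \<in> U s"
  unfolding U_def by (rule CollectI, rule exI[of _ "\<lambda>S. 0"]) simp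

lemma U_add:
  assumes "f \<in> U s" "g \<in> U s" shows "f + g \<in> U s"
proof -
  obtain m m' where m: "f = (\<Sum>S\<in>nes. theta s S (m S))" "\<And>S. m S \<in> M S"
    and m': "g = (\<Sum>S\<in>nes. theta s S (m' S))" "\<And>S. m' S \<in> M S"
    using assms by (auto simp: U_def)
  have "f + g = (\<Sum>S\<in>nes. theta s S (m S + m' S))"
    unfolding m(1) m'(1) sum.distrib[symmetric]
    by (intro sum.cong theta_add[symmetric] refl m(2) m'(2)) (auto simp: nes_iff)
  moreover have "\<And>S. m S + m' S \<in> M S" using m(2) m'(2) by (rule M_add)
  ultimately show ?thesis unfolding U_def by (intro CollectI exI[of _ "\<lambda>S. m S + m' S"]) simp
qed

lemma U_theta:
  assumes "S \<in> nes" "g \<in> M S" shows "theta s S g \<in> U s"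
proof -
  let ?m = "\<lambda>T. if T = S then g else 0"
  have "(\<Sum>T\<in>nes. theta s T (?m T)) = (\<Sum>T\<in>nes. if T = S then theta s S g else 0)"
    by (intro sum.cong) auto
  then have "theta s S g = (\<Sum>T\<in>nes. theta s T (?m T))" using assms by simp
  then show ?thesis unfolding U_def using assms by (intro CollectI exI[of _ ?m]) auto
qed

lemma U_sum: "(\<And>x. x \<in> A \<Longrightarrow> g x \<in> U s) \<Longrightarrow> sum g A \<in> U s"
  by (induction A rule: infinite_finite_induct) (auto intro: U_add)

lemma sum_PA: "(\<And>x. x \<in> A \<Longrightarrow> g x \<in> PA n) \<Longrightarrow> sum g A \<in> PA n"
  by (induction A rule: infinite_finite_induct) (auto intro: PA_add)

definition Sk :: "nat \<Rightarrow> nat set set" where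
  "Sk k = {S. S \<subseteq> {..<4} \<and> card S = k}"

lemma finite_Sk [simp]: "finite (Sk k)"
  by (rule finite_subset[of _ "Pow {..<4}"]) (auto simp: Sk_def)

lemma Sk_nes: "0 < k \<Longrightarrow> S \<in> Sk k \<Longrightarrow> S \<in> nes"
  by (auto simp: Sk_def nes_iff)

lemma U_descent:
  assumes "f \<in> V (Suc s)" "k \<le> Suc s"
    "\<And>S. S \<in> Sk k \<Longrightarrow> S \<noteq> {} \<Longrightarrow> Fs (Suc s) S f \<in> M S"
    "\<And>S. S \<subseteq> {..<4} \<Longrightarrow> k < card S \<Longrightarrow> card S \<le> Suc s \<Longrightarrow> Fs (Suc s) S f = 0"
  shows "f \<in> U (Suc s)"
  using assms
proof (induction k arbitrary: f)
  case 0
  have "f = 0"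
  proof (rule Fs_eq_0[OF 0(1)])
    fix S :: "nat set" assume S: "S \<subseteq> {..<4}" "S \<noteq> {}" "card S \<le> Suc s"
    then have "0 < card S" using finite_subset by (auto simp: card_gt_0_iff)
    then show "Fs (Suc s) S f = 0" using 0(4) S by blast
  qed
  then show ?case by (rule ssubst) (rule U_0)
next
  case (Suc k)
  define g where "g = (\<Sum>S\<in>Sk (Suc k). theta (Suc s) S (Fs (Suc s) S f))"
  have mem: "Fs (Suc s) S f \<in> M S" "S \<in> nes" "S \<subseteq> {..<4}" if "S \<in> Sk (Suc k)" for S
    using Suc.prems(3) that Sk_nes[of "Suc k" S] by (auto simp: nes_iff)
  have gU: "g \<in> U (Suc s)" unfolding g_def using mem by (intro U_sum U_theta)
  have gV: "g \<in> V (Suc s)" unfolding g_def using mem by (intro sum_PA theta_V)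
  have above: "Fs (Suc s) T (f + g) = 0" if T: "T \<subseteq> {..<4}" "k < card T" "card T \<le> Suc s" for T
  proof -
    have Tne: "T \<noteq> {}" using T by auto
    have sub: "S = T" if "S \<in> Sk (Suc k)" "T \<subseteq> S" for S
    proof -
      have S: "finite S" "card S = Suc k" using that finite_subset by (auto simp: Sk_def)
      then have "card T = card S" using card_mono[OF S(1) that(2)] T by simp
      then show ?thesis using card_subset_eq[OF S(1) that(2)] by simp
    qed
    have "Fs (Suc s) T g = (\<Sum>S\<in>Sk (Suc k). if T \<subseteq> S then Fs (Suc s) S f else 0)"
      unfolding g_def Fs_sum using T Tne by (intro sum.cong) (auto simp: Fs_theta)
    also have "\<dots> = (\<Sum>S\<in>Sk (Suc k). if S = T then Fs (Suc s) T f else 0)"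
      using sub by (intro sum.cong) auto
    also have "\<dots> = (if T \<in> Sk (Suc k) then Fs (Suc s) T f else 0)" by simp
    also have "\<dots> = Fs (Suc s) T f"
      using Suc.prems(4)[of T] T by (auto simp: Sk_def)
    finally show ?thesis by (simp add: Fs_add)
  qed
  have "f + g \<in> U (Suc s)"
  proof (rule Suc.IH)
    show fg: "f + g \<in> V (Suc s)" using Suc.prems(1) gV by (rule PA_add)
    show "k \<le> Suc s" using Suc.prems by simp
    show "Fs (Suc s) S (f + g) \<in> M S" if S: "S \<in> Sk k" "S \<noteq> {}" for S
      unfolding M_def
    proof (intro CollectI conjI allI)
      have S4: "S \<subseteq> {..<4}" "card S \<le> s" "finite S" using S Suc.prems(2) finite_subset by (auto simp: Sk_def)
      show "Fs (Suc s) S (f + g) \<in> PA 3" using fg S4 S by (intro Fs_PA) auto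
      fix z
      have "(\<Sum>i\<in>S. Fs (Suc s) S (f + g) (ex i + z)) = (\<Sum>i<4. Fs (Suc s) (insert i S) (f + g) (ex i + z))"
      proof (rule sum.mono_neutral_cong_left)
        show "\<forall>i\<in>{..<4} - S. Fs (Suc s) (insert i S) (f + g) (ex i + z) = 0"
        proof
          fix i assume "i \<in> {..<4} - S"
          then have "Fs (Suc s) (insert i S) (f + g) = 0"
            using S4 S by (intro above) (auto simp: Sk_def)
          then show "Fs (Suc s) (insert i S) (f + g) (ex i + z) = 0" by simp
        qed
      qed (use S4 in \<open>auto simp: insert_absorb\<close>)
      also have "\<dots> = 0" using fg S4 S by (intro Fs_rel)
      finally show "(\<Sum>i\<in>S. Fs (Suc s) S (f + g) (ex i + z)) = 0" .
    qed
  qed (rule above)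
  then have "(f + g) + g \<in> U (Suc s)" using gU by (rule U_add)
  then show ?case by (simp add: add.assoc)
qed

text \<open>Adding the relations for all index sets \<open>T\<close> with fewer than \<open>k\<close> elements: a set \<open>S\<close> with \<open>i \<in> S\<close> arises
  as \<open>insert i T\<close> from \<open>S\<close> and from \<open>S - {i}\<close>, so only the sets with \<open>k\<close> elements survive.\<close>

lemma Fs_rel_sum:
  assumes f: "f \<in> V (Suc s)" and k: "k \<le> Suc s"
  shows "(\<Sum>S\<in>Sk k. \<Sum>i\<in>S. Fs (Suc s) S f (ex i + z)) = 0"
proof -
  define g where "g S i = Fs (Suc s) S f (ex i + z)" for S i
  define A where "A = {T. T \<subseteq> {..<4::nat} \<and> card T < k}"
  have fA: "finite A" by (rule finite_subset[of _ "Pow {..<4}"]) (auto simp: A_def)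
  have rel: "(\<Sum>i<4. g (insert i T) i) = 0" if "T \<in> A" for T
    using that k Fs_rel[OF f, of T z] Fs_rel_empty[OF f, of z] by (cases "T = {}") (auto simp: A_def g_def)
  have each: "(\<Sum>T\<in>A. g (insert i T) i) = (\<Sum>S\<in>{S \<in> Sk k. i \<in> S}. g S i)" if i: "i < 4" for i
  proof -
    have "(\<Sum>T\<in>A. g (insert i T) i) = (\<Sum>T\<in>{T\<in>A. i \<in> T}. g (insert i T) i) + (\<Sum>T\<in>{T\<in>A. i \<notin> T}. g (insert i T) i)"
      by (subst sum.union_disjoint[symmetric]) (use fA in \<open>auto intro!: sum.cong\<close>)
    also have "(\<Sum>T\<in>{T\<in>A. i \<in> T}. g (insert i T) i) = (\<Sum>T\<in>{T\<in>A. i \<in> T}. g T i)"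
      by (intro sum.cong) (auto simp: insert_absorb)
    also have "(\<Sum>T\<in>{T\<in>A. i \<notin> T}. g (insert i T) i) = (\<Sum>S\<in>{T\<in>A. i \<in> T} \<union> {S \<in> Sk k. i \<in> S}. g S i)"
    proof (rule sum.reindex_bij_witness[of _ "\<lambda>S. S - {i}" "insert i"])
      fix T assume T: "T \<in> {T\<in>A. i \<notin> T}"
      then have "finite T" using finite_subset by (auto simp: A_def)
      then show "insert i T \<in> {T\<in>A. i \<in> T} \<union> {S \<in> Sk k. i \<in> S}"
        using T i by (auto simp: A_def Sk_def)
    next
      fix S assume S: "S \<in> {T\<in>A. i \<in> T} \<union> {S \<in> Sk k. i \<in> S}"
      then have "finite S" using finite_subset by (auto simp: A_def Sk_def)
      then have "card (S - {i}) < card S" using S by (intro psubset_card_mono) auto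
      then show "S - {i} \<in> {T\<in>A. i \<notin> T}" using S by (auto simp: A_def Sk_def)
    qed (auto simp: insert_absorb)
    also have "\<dots> = (\<Sum>T\<in>{T\<in>A. i \<in> T}. g T i) + (\<Sum>S\<in>{S \<in> Sk k. i \<in> S}. g S i)"
      using fA by (intro sum.union_disjoint) (auto simp: A_def Sk_def)
    finally show ?thesis by simp
  qed
  have "(\<Sum>S\<in>Sk k. \<Sum>i\<in>S. g S i) = (\<Sum>S\<in>Sk k. \<Sum>i<4. if i \<in> S then g S i else 0)"
    by (intro sum.cong sum.mono_neutral_cong_left) (auto simp: Sk_def)
  also have "\<dots> = (\<Sum>i<4. \<Sum>S\<in>Sk k. if i \<in> S then g S i else 0)" by (rule sum.swap)
  also have "\<dots> = (\<Sum>i<4. \<Sum>S\<in>{S \<in> Sk k. i \<in> S}. g S i)"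
    by (intro sum.cong refl sum.inter_filter[symmetric]) simp
  also have "\<dots> = (\<Sum>i<4. \<Sum>T\<in>A. g (insert i T) i)" using each by simp
  also have "\<dots> = (\<Sum>T\<in>A. \<Sum>i<4. g (insert i T) i)" by (rule sum.swap)
  also have "\<dots> = 0" using rel by simp
  finally show ?thesis by (simp add: g_def)
qed

lemma Sk_4: "Sk 4 = {{..<4}}"
  using card_subset_eq[of "{..<4::nat}"] by (auto simp: Sk_def)

lemma card_le4: "S \<subseteq> {..<4::nat} \<Longrightarrow> card S \<le> 4"
  using card_mono[of "{..<4::nat}" S] by simp

lemma V_eq_U_ge4:
  assumes f: "f \<in> V (Suc s)" and s: "3 \<le> s" shows "f \<in> U (Suc s)"
proof (rule U_descent[OF f, of 4])
  show "4 \<le> Suc s" using s by simp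
  have "(\<Sum>i<4. Fs (Suc s) {..<4} f (ex i + z)) = 0" for z
    using Fs_rel_sum[OF f, of 4 z] s by (simp add: Sk_4)
  then have "Fs (Suc s) {..<4} f \<in> M {..<4}"
    using Fs_PA[OF f, of "{..<4}"] s by (simp add: M_def lessThan_empty_iff)
  then show "Fs (Suc s) S f \<in> M S" if "S \<in> Sk 4" for S using that by (simp add: Sk_4)
  show "Fs (Suc s) S f = 0" if "S \<subseteq> {..<4}" "4 < card S" for S
    using that card_le4[of S] by simp
qed

section \<open>The case s >= 3\<close>

definition mkf :: "(nat \<Rightarrow> nat \<Rightarrow> bit) \<Rightarrow> (nat \<Rightarrow> bit) \<Rightarrow> mono \<Rightarrow> bit" where
  "mkf q r = (\<Sum>i<4. \<Sum>j\<le>i. fscale (q i j) (dq i j)) + (\<Sum>i<4. fscale (r i) (dr i))"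

lemma qv_sum: "qv (sum g A) i j = (\<Sum>x\<in>A. qv (g x) i j)" and rv_sum: "rv (sum g A) i = (\<Sum>x\<in>A. rv (g x) i)"
  by (induction A rule: infinite_finite_induct) auto

lemma mkf_PA: "mkf q r \<in> PA 3"
  unfolding mkf_def by (intro PA_add sum_PA fscale_PA dq_PA dr_PA) auto

lemma qv_mkf:
  assumes "k < 4" "l < 4" and sym: "\<And>i j. i < 4 \<Longrightarrow> j < 4 \<Longrightarrow> q i j = q j i"
  shows "qv (mkf q r) k l = q k l"
proof -
  have "qv (mkf q r) k l = (\<Sum>i<4. \<Sum>j\<le>i. q i j * (if k = i \<and> l = j \<or> k = j \<and> l = i then 1 else 0))"
    by (simp add: mkf_def qv_sum qv_dq qv_dr)
  also have "\<dots> = (\<Sum>i<4. \<Sum>j\<le>i. if j = min k l then (if i = max k l then q k l else 0) else 0)"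
    using assms by (intro sum.cong refl) (auto simp: min_def max_def)
  also have "\<dots> = (\<Sum>i<4. if i = max k l then q k l else 0)"
    by (intro sum.cong refl) auto
  also have "\<dots> = q k l" using assms by simp
  finally show ?thesis .
qed

lemma rv_mkf: "k < 4 \<Longrightarrow> rv (mkf q r) k = r k"
proof -
  assume k: "k < 4"
  have "rv (mkf q r) k = (\<Sum>i<4. r i * (if k = i then 1 else 0))"
    using k by (simp add: mkf_def rv_sum rv_dq rv_dr)
  also have "\<dots> = (\<Sum>i<4. if i = k then r k else 0)" by (intro sum.cong) auto
  finally show ?thesis using k by simp
qed

lemma glue_val:
  assumes h: "\<And>i. i < 4 \<Longrightarrow> h i \<in> PA 3" and g: "\<And>z. (\<Sum>i<4. h i (ex i + z)) = 0"
  shows "quad a b c d \<Longrightarrow> qv (h a) a b + (qv (h b) a b + (rv (h c) d + rv (h d) c)) = 0"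
    and "j < 4 \<Longrightarrow> (\<Sum>i<4. qv (h i) i j) = 0"
proof -
  assume q: "quad a b c d"
  note q' = quadD[OF q]
  have "(\<Sum>i<4. h i (ex i + (ex a + ex b))) = qv (h a) a b + (qv (h b) a b + (rv (h c) d + rv (h d) c))"
    unfolding quad_sum[OF q] using val_same[OF h[OF q'(1)] q'(1,2)] val_same[OF h[OF q'(2)] q'(2,1)]
      qv_sym[OF h[OF q'(2)] q'(2,1)] val_dist[OF quad_perm(12)[OF q]] val_dist[OF quad_perm(18)[OF q]] by simp
  then show "qv (h a) a b + (qv (h b) a b + (rv (h c) d + rv (h d) c)) = 0" using g by simp
next
  assume j: "j < 4"
  have "(\<Sum>i<4. h i (ex i + (ex j + ex j))) = (\<Sum>i<4. qv (h i) i j)"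
    using h j by (intro sum.cong) (auto simp: val_same)
  then show "(\<Sum>i<4. qv (h i) i j) = 0" using g by simp
qed

abbreviation co :: "nat \<Rightarrow> nat set" where
  "co d \<equiv> {..<4} - {d}"

lemma co_quad: "quad a b c d \<Longrightarrow> co d = {a, b, c}"
  by (auto simp: quad_def)

lemma Sk_3: "Sk 3 = co ` {..<4}"
proof
  show "Sk 3 \<subseteq> co ` {..<4}"
  proof
    fix S assume "S \<in> Sk 3"
    then have S: "S \<subseteq> {..<4}" "card S = 3" by (auto simp: Sk_def)
    then have "card ({..<4} - S) = 1" by (subst card_Diff_subset) (auto intro: finite_subset)
    then obtain d where d: "{..<4} - S = {d}" by (rule card_1_singletonE)
    then have "S = co d" "d < 4" using S by auto
    then show "S \<in> co ` {..<4}" by blast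
  qed
qed (auto simp: Sk_def)

lemma sum_Sk_3: "(\<Sum>S\<in>Sk 3. g S) = (\<Sum>d<4. g (co d))"
  unfolding Sk_3 by (subst sum.reindex) (auto simp: inj_on_def)

lemma M_co:
  assumes d: "d < 4" and f: "f \<in> PA 3"
    and 1: "\<And>j. j < 4 \<Longrightarrow> (\<Sum>i\<in>co d. qv f i j) = 0"
    and 2: "\<And>a b c. quad a b c d \<Longrightarrow> qv f a d = rv f b + rv f c"
    and 3: "rv f d = 0"
  shows "f \<in> M (co d)"
proof -
  have S: "co d \<subseteq> {..<4}" by auto
  show ?thesis unfolding M_iff[OF S]
  proof (intro conjI allI impI f 1)
    fix x y z w assume q: "quad x y z w"
    note q' = quadD[OF q]
    show "(if x \<in> co d then qv f x y else 0) + (if y \<in> co d then qv f x y else 0) +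
      (if z \<in> co d then rv f w else 0) + (if w \<in> co d then rv f z else 0) = 0"
      using d unfolding quad_cases[OF q]
    proof (elim disjE)
      assume "d = x"
      then show ?thesis using 2[of y w z] quad_perm[OF q] q' qv_sym[OF f q'(1,2)] by simp
    next
      assume "d = y"
      then show ?thesis using 2[of x w z] quad_perm[OF q] q' by simp
    qed (use q' 3 in auto)
  qed
qed

text \<open>At \<open>s = 3\<close> there is no slice indexed by all four variables.  The functional \<open>h\<close> below plays its role:
  it is determined by \<open>h (x_d z) = (\<Sum>i\<in>co d. G d (x_i z))\<close>.\<close>

lemma V3_eq_U:
  assumes f: "f \<in> V (Suc (Suc (Suc 0)))" shows "f \<in> U (Suc (Suc (Suc 0)))"
proof -
  define G where "G d = Fs (Suc (Suc (Suc 0))) (co d) f" for d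
  have G: "G d \<in> PA 3" if d: "d < 4" for d
  proof -
    obtain a b c where "quad d a b c" using quad_exists1[OF d] by blast
    then have "co d \<noteq> {}" by (auto simp: quad_def)
    then show ?thesis unfolding G_def using d by (intro Fs_PA[OF f]) auto
  qed
  have rel: "(\<Sum>i<4. Fs (Suc (Suc (Suc 0))) (insert i {a, b}) f (ex i + z)) = 0" "insert a {a, b} = {a, b}"
     "insert b {a, b} = {a, b}" "insert c {a, b} = co d" "insert d {a, b} = co c"
     "\<And>i. i < 4 \<Longrightarrow> Fs (Suc (Suc (Suc 0))) (insert i {a, b}) f \<in> PA 3"
    if q: "quad a b c d" for a b c d z
  proof -
    note q' = quadD[OF q]
    show "(\<Sum>i<4. Fs (Suc (Suc (Suc 0))) (insert i {a, b}) f (ex i + z)) = 0"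
      using q' by (intro Fs_rel f) auto
    show "insert c {a, b} = co d" using co_quad[OF q] by auto
    show "insert d {a, b} = co c" using co_quad[OF quad_perm(1)[OF q]] by auto
    show "Fs (Suc (Suc (Suc 0))) (insert i {a, b}) f \<in> PA 3" if "i < 4" for i
      using q' that card_insert_le_m1[of 3 "{a, b}" i] by (intro Fs_PA f) (auto simp: card_insert_if)
  qed auto
  have E1: "rv (G d) d = rv (G c) c" if q: "quad a b c d" for a b c d
    using glue_val(1)[OF rel(6)[OF q] rel(1)[OF q] q] rel(2-5)[OF q] by (simp add: G_def)
  define k where "k = rv (G 0) 0"
  have k: "rv (G d) d = k" if d: "d < 4" for d
  proof (cases "d = 0")
    case False
    then obtain a b where "quad d 0 a b" using quad_exists2[of d 0] d by auto
    then show ?thesis using E1[of a b d 0] quad_perm unfolding k_def by metis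
  qed (simp add: k_def)
  define q where "q i j = (\<Sum>e\<in>co j. qv (G j) e i)" for i j
  have q1: "q c d = qv (G d) c c + (qv (G d) a c + qv (G d) b c)" if "quad a b c d" for a b c d
    unfolding q_def co_quad[OF that] using quadD[OF that] by (simp add: ac_simps)
  have E2: "q c d = qv (G c) c d + (rv (G c) a + rv (G c) b)" if Q: "quad a b c d" for a b c d
  proof -
    note Q' = quadD[OF Q]
    let ?F = "Fs (Suc (Suc (Suc 0))) {a, b} f"
    let ?h = "\<lambda>i. Fs (Suc (Suc (Suc 0))) (insert i {a, b}) f"
    have h: "?h a = ?F" "?h b = ?F" "?h c = G d" "?h d = G c" using rel(2-5)[OF Q] by (simp_all add: G_def)
    have g1: "qv (?h x) x y + (qv (?h y) x y + (rv (?h z) w + rv (?h w) z)) = 0" if "quad x y z w" for x y z w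
      by (rule glue_val(1)[where h = ?h]) (use rel[OF Q] that in auto)
    have g2: "(\<Sum>i<4. qv (?h i) i j) = 0" if "j < 4" for j
      by (rule glue_val(2)[where h = ?h]) (use rel[OF Q] that in auto)
    have 1: "qv ?F a c + (qv ?F b c + (qv (G d) c c + qv (G c) d c)) = 0"
      using g2[OF Q'(3)] unfolding quad_sum[OF Q] h .
    have 2: "qv ?F a c + (qv (G d) a c + (rv ?F d + rv (G c) b)) = 0"
      using g1[OF quad_perm(2)[OF Q]] unfolding h .
    have 3: "qv ?F b c + (qv (G d) b c + (rv ?F d + rv (G c) a)) = 0"
      using g1[OF quad_perm(8)[OF Q]] unfolding h .
    have "q c d + (qv (G c) c d + (rv (G c) a + rv (G c) b)) =
      (qv ?F a c + (qv ?F b c + (qv (G d) c c + qv (G c) d c))) +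
      (qv ?F a c + (qv (G d) a c + (rv ?F d + rv (G c) b))) +
      (qv ?F b c + (qv (G d) b c + (rv ?F d + rv (G c) a)))"
      unfolding q1[OF Q] qv_sym[OF G[OF Q'(3)] Q'(4,3)] by (simp add: ac_simps)
    also have "\<dots> = 0" unfolding 1 2 3 by simp
    finally show ?thesis by simp
  qed
  have tot: "(\<Sum>d<4. \<Sum>i\<in>co d. G d (ex i + z)) = 0" for z
    using Fs_rel_sum[OF f, of 3 z] by (simp add: sum_Sk_3 G_def)
  have E3: "q c d = qv (G d) c d + (rv (G d) a + rv (G d) b)" if Q: "quad a b c d" for a b c d
  proof -
    note Q' = quadD[OF Q]
    have val: "(\<Sum>i\<in>co d. G d (ex i + (ex c + ex d))) = qv (G d) c d + (rv (G d) a + rv (G d) b)" if Q: "quad a b c d" for a b c d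
    proof -
      note Q' = quadD[OF Q]
      show ?thesis unfolding co_quad[OF Q]
        using Q' val_same(1)[OF G[OF Q'(4)] Q'(3,4)] val_dist[OF quad_perm(4)[OF Q], of "G d"]
          val_dist[OF quad_perm(9)[OF Q], of "G d"] val_dist[of a c d b "G d"] quad_perm[OF Q] by (simp add: ac_simps)
    qed
    have val2: "(\<Sum>i\<in>co a. G a (ex i + (ex c + ex d))) = rv (G a) a" if Q: "quad a b c d" for a b c d
    proof -
      note Q' = quadD[OF Q]
      have "co a = {b, c, d}" by (rule co_quad[OF quad_perm(9)[OF Q]])
      then show ?thesis
        using Q' val_same(1)[OF G[OF Q'(1)] Q'(3,4)] val_same(2)[OF G[OF Q'(1)] Q'(4,3)] qv_sym[OF G[OF Q'(1)] Q'(3,4)]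
          val_dist[OF quad_perm(9)[OF Q], of "G a"] by simp
    qed
    have swap: "ex d + ex c = ex c + ex d" by (rule add.commute)
    have "rv (G a) a + (rv (G b) b + ((qv (G c) d c + (rv (G c) a + rv (G c) b)) + (qv (G d) c d + (rv (G d) a + rv (G d) b)))) = 0"
      using tot[of "ex c + ex d"] val[OF Q] val[OF quad_perm(1)[OF Q]] val2[OF Q] val2[OF quad_perm(3)[OF Q]]
      unfolding quad_sum[OF Q] swap by simp
    then show ?thesis unfolding E2[OF Q] using k Q' qv_sym[OF G[OF Q'(3)] Q'(4,3)] by simp
  qed
  have sym: "q i j = q j i" if ij: "i < 4" "j < 4" for i j
  proof (cases "i = j")
    case False
    then obtain a b where "quad i j a b" using quad_exists2 ij by blast
    then have Q: "quad a b i j" "quad a b j i" by (auto dest: quad_perm)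
    note Q' = quadD[OF Q(1)]
    show ?thesis unfolding E2[OF Q(1)] E3[OF Q(2)] using qv_sym[OF G[OF Q'(3)] Q'(4,3)] by simp
  qed simp
  define h where "h = mkf q (\<lambda>i. k)"
  have h3: "h \<in> PA 3" unfolding h_def by (rule mkf_PA)
  have qh: "qv h i j = q i j" if "i < 4" "j < 4" for i j
    unfolding h_def using that sym by (rule qv_mkf)
  have rh: "rv h i = k" if "i < 4" for i
    unfolding h_def using that by (simp add: rv_mkf)
  have qsum: "(\<Sum>d<4. q j d) = 0" if "j < 4" for j
  proof -
    have "(\<Sum>d<4. q j d) = (\<Sum>d<4. \<Sum>i\<in>co d. G d (ex i + (ex j + ex j)))"
      unfolding q_def using that G by (intro sum.cong) (auto simp: val_same)
    then show ?thesis using tot by simp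
  qed
  have hM: "h \<in> M {..<4}"
    unfolding M_iff[OF order.refl]
  proof (intro conjI allI impI h3)
    show "(\<Sum>i<4. qv h i j) = 0" if "j < 4" for j
      using qsum[OF that] that by (simp add: qh sym[of _ j])
    show "(if a \<in> {..<4} then qv h a b else 0) + (if b \<in> {..<4} then qv h a b else 0) +
       (if c \<in> {..<4} then rv h d else 0) + (if d \<in> {..<4} then rv h c else 0) = 0" if "quad a b c d" for a b c d
      using quadD[OF that] by (simp add: rh)
  qed
  let ?g = "theta (Suc (Suc (Suc 0))) {..<4} h"
  have ne: "{..<4::nat} \<noteq> {}" by (simp add: lessThan_empty_iff)
  have gU: "?g \<in> U (Suc (Suc (Suc 0)))" using hM ne by (intro U_theta) (auto simp: nes_iff)
  have gV: "?g \<in> V (Suc (Suc (Suc 0)))" using hM by (intro theta_V) auto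
  have "f + ?g \<in> U (Suc (Suc (Suc 0)))"
  proof (rule U_descent[of _ _ 3])
    show fg: "f + ?g \<in> V (Suc (Suc (Suc 0)))" using f gV by (rule PA_add)
    show "Fs (Suc (Suc (Suc 0))) S (f + ?g) \<in> M S" if S: "S \<in> Sk 3" "S \<noteq> {}" for S
    proof -
      obtain d where d: "S = co d" "d < 4" using S(1) unfolding Sk_3 by auto
      have e: "Fs (Suc (Suc (Suc 0))) S (f + ?g) = G d + h"
        unfolding Fs_add d(1) G_def using S d by (subst Fs_theta) auto
      show ?thesis unfolding e unfolding d(1)
      proof (rule M_co[OF d(2)])
        show "G d + h \<in> PA 3" using G d h3 by (intro PA_add)
        show "(\<Sum>i\<in>co d. qv (G d + h) i j) = 0" if j: "j < 4" for j
        proof -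
          have "(\<Sum>i\<in>co d. qv (G d + h) i j) = q j d + (\<Sum>i\<in>co d. q j i)"
            using j by (simp add: sum.distrib q_def[of j d] qh sym[of _ j])
          also have "\<dots> = (\<Sum>i<4. q j i)" using d by (subst sum.remove[of "{..<4}" d]) auto
          finally show ?thesis using qsum[OF j] by simp
        qed
        show "qv (G d + h) a d = rv (G d + h) b + rv (G d + h) c" if Q: "quad a b c d" for a b c
          using E3[OF quad_perm(8)[OF Q]] quadD[OF Q] E3[of b c a d] quad_perm[OF Q] by (simp add: qh rh)
        show "rv (G d + h) d = 0" using k rh d by simp
      qed
    qed
    show "Fs (Suc (Suc (Suc 0))) S (f + ?g) = 0" if "3 < card S" "card S \<le> Suc (Suc (Suc 0))" for S
      using that by simp
  qed simp
  from U_add[OF this gU] show ?thesis by (simp add: add.assoc)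
qed

lemma PA3_eq_0:
  assumes "f \<in> PA 3" "\<And>i z. i < 4 \<Longrightarrow> f (ex i + z) = 0" shows "f = 0"
  by (rule dual4_3_eqI) (use assms in \<open>auto simp: PA_iff dual4_def\<close>)

lemma theta_indep:
  assumes m: "\<And>S. m S \<in> M S" and sum: "(\<Sum>S\<in>nes. theta s S (m S)) = 0" and s: "3 \<le> s" and S: "S \<in> nes"
  shows "m S = 0"
proof -
  have up: "(\<Sum>T\<in>{T \<in> nes. S \<subseteq> T}. m T) = 0" if S: "S \<in> nes" "card S \<le> 3" for S
  proof -
    have "0 = (\<Sum>T\<in>nes. Fs s S (theta s T (m T)))"
      using sum Fs_sum[of s S "\<lambda>S. theta s S (m S)" nes] by simp
    also have "\<dots> = (\<Sum>T\<in>nes. if S \<subseteq> T then m T else 0)"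
      using S s by (intro sum.cong) (auto simp: Fs_theta nes_iff)
    also have "\<dots> = (\<Sum>T\<in>{T \<in> nes. S \<subseteq> T}. m T)"
      by (rule sum.inter_filter[symmetric]) simp
    finally show ?thesis by simp
  qed
  have full: "m {..<4} = 0"
  proof (rule PA3_eq_0)
    show "m {..<4} \<in> PA 3" using m M_PA by blast
    fix d z assume d: "(d::nat) < 4"
    then obtain a b c where "quad d a b c" using quad_exists1 by blast
    then have ne: "co d \<noteq> {}" by (auto simp: quad_def)
    have "{T \<in> nes. co d \<subseteq> T} = {co d, {..<4}}" using ne d by (auto simp: nes_iff)
    moreover have "co d \<noteq> {..<4}" using d by auto
    ultimately have "m (co d) + m {..<4} = 0" using up[of "co d"] ne d by (simp add: nes_iff)
    then have "m {..<4} = m (co d)" by (metis add.right_neutral fun_add_self(2))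
    then have "(\<Sum>i\<in>co d. m {..<4} (ex i + z)) = 0" using m[of "co d"] by (simp add: M_def)
    moreover have "(\<Sum>i<4. m {..<4} (ex i + z)) = 0" using m[of "{..<4}"] by (simp add: M_def)
    ultimately show "m {..<4} (ex d + z) = 0" using d by (subst (asm) (2) sum.remove[of _ d]) auto
  qed
  show ?thesis using S
  proof (induction "4 - card S" arbitrary: S rule: less_induct)
    case less
    have S4: "S \<subseteq> {..<4}" "S \<noteq> {}" using less.prems by (auto simp: nes_iff)
    show ?case
    proof (cases "S = {..<4}")
      case True
      then show ?thesis using full by simp
    next
      case False
      then have lt: "card S < 4" using psubset_card_mono[of "{..<4}" S] S4 by auto
      have "m T = 0" if "T \<in> {T \<in> nes. S \<subseteq> T} - {S}" for T
      proof (rule less.hyps)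
        have "card S < card T" using that finite_subset[of T "{..<4}"] by (intro psubset_card_mono) (auto simp: nes_iff)
        then show "4 - card T < 4 - card S" using lt by simp
      qed (use that in auto)
      then have "(\<Sum>T\<in>{T \<in> nes. S \<subseteq> T}. m T) = m S"
        using less.prems by (subst sum.remove[of _ S]) (auto simp del: zero_fun_apply plus_fun_apply)
      then show ?thesis using up[OF less.prems] lt by (simp del: zero_fun_apply)
    qed
  qed
qed

definition coord :: "nat \<Rightarrow> (mono \<Rightarrow> bit) \<Rightarrow> nat set \<Rightarrow> mono \<Rightarrow> bit" where
  "coord s f = (SOME m. (\<forall>S. m S \<in> M S) \<and> f = (\<Sum>S\<in>nes. theta s S (m S)))"

lemma coord:
  assumes "f \<in> U s"
  shows "coord s f S \<in> M S" "f = (\<Sum>S\<in>nes. theta s S (coord s f S))"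
proof -
  have "\<exists>m. (\<forall>S. m S \<in> M S) \<and> f = (\<Sum>S\<in>nes. theta s S (m S))" using assms by (auto simp: U_def)
  from someI_ex[OF this] show "coord s f S \<in> M S" "f = (\<Sum>S\<in>nes. theta s S (coord s f S))"
    unfolding coord_def[symmetric] by blast+
qed

lemma coord_eq:
  assumes m: "\<And>S. m S \<in> M S" and f: "f = (\<Sum>S\<in>nes. theta s S (m S))" and s: "3 \<le> s" and S: "S \<in> nes"
  shows "coord s f S = m S"
proof -
  have fU: "f \<in> U s" unfolding U_def using m f by blast
  note c = coord[OF fU]
  have "(\<Sum>S\<in>nes. theta s S (coord s f S + m S)) = (\<Sum>S\<in>nes. theta s S (coord s f S) + theta s S (m S))"
    by (intro sum.cong theta_add refl c(1) m) (auto simp: nes_iff)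
  also have "\<dots> = f + f" unfolding sum.distrib using c(2) f by simp
  finally have "(\<Sum>S\<in>nes. theta s S (coord s f S + m S)) = 0" by simp
  then have "coord s f S + m S = 0"
    by (rule theta_indep[OF M_add[OF c(1) m] _ s S])
  then show ?thesis by (simp add: fun_eq_iff)
qed

definition phi :: "nat \<Rightarrow> (mono \<Rightarrow> bit) \<Rightarrow> bit" where
  "phi s f = (\<Sum>S\<in>nes. kappa (Min S) (coord s f S))"

lemma phi_add:
  assumes f: "f \<in> U s" and g: "g \<in> U s" and s: "3 \<le> s"
  shows "phi s (f + g) = phi s f + phi s g"
proof -
  note cf = coord[OF f] and cg = coord[OF g]
  have "f + g = (\<Sum>S\<in>nes. theta s S (coord s f S)) + (\<Sum>S\<in>nes. theta s S (coord s g S))"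
    using cf(2) cg(2) by simp
  also have "\<dots> = (\<Sum>S\<in>nes. theta s S (coord s f S + coord s g S))"
    unfolding sum.distrib[symmetric]
    by (intro sum.cong theta_add[symmetric] refl cf(1) cg(1)) (auto simp: nes_iff)
  finally have "coord s (f + g) S = coord s f S + coord s g S" if "S \<in> nes" for S
    by (rule coord_eq[OF M_add[OF cf(1) cg(1)] _ s that])
  then show ?thesis by (simp add: phi_def kappa_add sum.distrib)
qed

lemma tog_tog: "a \<noteq> b \<Longrightarrow> tog a b (tog a b S) = S"
  by (auto simp: tog_def)

lemma tog_nes: "a \<noteq> b \<Longrightarrow> b < 4 \<Longrightarrow> S \<in> nes \<Longrightarrow> tog a b S \<in> nes"
  by (auto simp: tog_def nes_iff)

lemma gact_sum: "gact (sum h A) g = (\<Sum>x\<in>A. gact (h x) g)"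
  by (induction A rule: infinite_finite_induct) (simp_all add: gact_add del: zero_fun_apply plus_fun_apply)

lemma phi_act:
  assumes f: "f \<in> U s" and s: "3 \<le> s" and ab: "a < 4" "b < 4" "a \<noteq> b"
  shows "phi s (act a b f) = phi s f"
proof -
  note c = coord[OF f]
  define m where "m S = (if S \<in> nes then act a b (coord s f (tog a b S)) else 0)" for S
  have m: "m S \<in> M S" for S
  proof (cases "S \<in> nes")
    case True
    then have "act a b (coord s f (tog a b S)) \<in> M (tog a b (tog a b S))"
      using tog_nes[OF ab(3,2) True] by (intro act_M ab c(1)) (auto simp: nes_iff)
    then show ?thesis using True ab by (simp add: m_def tog_tog)
  qed (simp add: m_def)
  have "act a b f = act a b (\<Sum>S\<in>nes. theta s S (coord s f S))" using c(2) by simp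
  also have "\<dots> = (\<Sum>S\<in>nes. theta s (tog a b S) (act a b (coord s f S)))"
    unfolding gact_sum by (intro sum.cong refl act_theta ab c(1)) (auto simp: nes_iff)
  also have "\<dots> = (\<Sum>S\<in>nes. theta s S (m S))"
    using ab tog_nes by (intro sum.reindex_bij_witness[of _ "tog a b" "tog a b"]) (auto simp: tog_tog m_def)
  finally have "coord s (act a b f) S = m S" if "S \<in> nes" for S
    using m that by (intro coord_eq s)
  then have "phi s (act a b f) = (\<Sum>S\<in>nes. kappa (Min S) (act a b (coord s f (tog a b S))))"
    by (simp add: phi_def m_def)
  also have "\<dots> = (\<Sum>S\<in>nes. kappa (Min (tog a b S)) (coord s f (tog a b S)))"
  proof (rule sum.cong)
    fix S assume S: "S \<in> nes"
    then have t: "tog a b S \<in> nes" using ab tog_nes by blast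
    have mi: "Min T \<in> T" if "T \<in> nes" for T
      using that finite_subset[of T "{..<4}"] by (intro Min_in) (auto simp: nes_iff)
    show "kappa (Min S) (act a b (coord s f (tog a b S))) = kappa (Min (tog a b S)) (coord s f (tog a b S))"
      using mi[OF S] mi[OF t] t ab by (intro kappa_act[OF ab _ c(1)]) (auto simp: nes_iff tog_tog)
  qed simp
  also have "\<dots> = phi s f"
    unfolding phi_def using ab tog_nes by (intro sum.reindex_bij_witness[of _ "tog a b" "tog a b"]) (auto simp: tog_tog)
  finally show ?thesis .
qed

abbreviation f0 :: "nat \<Rightarrow> mono \<Rightarrow> bit" where
  "f0 s \<equiv> theta s {0} (dr 0)"

lemma kappa_dr: "p < 4 \<Longrightarrow> kappa p (dr p) = 1"
proof -
  assume p: "p < 4"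
  then obtain a b c where q: "quad p a b c" using quad_exists1 by blast
  show ?thesis unfolding kappa_quad[OF dr_PA[OF p] q] using p by (simp add: qv_dr rv_dr)
qed

lemma f0_V: "f0 s \<in> V s"
  using dr_M[of 0] by (intro theta_V) auto

lemma phi_f0: "3 \<le> s \<Longrightarrow> phi s (f0 s) = 1"
proof -
  assume s: "3 \<le> s"
  let ?m = "\<lambda>S. if S = {0} then dr 0 else 0"
  have n: "{0} \<in> nes" by (simp add: nes_iff)
  have "(\<Sum>S\<in>nes. theta s S (?m S)) = (\<Sum>S\<in>nes. if S = {0} then f0 s else 0)"
    by (intro sum.cong) auto
  also have "\<dots> = f0 s" using n by simp
  finally have "coord s (f0 s) S = ?m S" if "S \<in> nes" for S
    using that dr_M[of 0] by (intro coord_eq s) (auto simp del: zero_fun_apply)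
  then have "phi s (f0 s) = (\<Sum>S\<in>nes. if S = {0} then 1 else 0)"
    unfolding phi_def by (intro sum.cong) (auto simp: kappa_dr)
  then show ?thesis using n by simp
qed

lemma theta_span:
  assumes "S \<in> nes" "g \<in> M S"
  shows "theta s S g \<in> fs.span (insert (f0 s) (rels (dg s)))"
proof -
  obtain p where p: "p \<in> S" using assms by (auto simp: nes_iff)
  let ?Y = "fs.span (insert (f0 s) (rels (dg s)))"
  have "theta s S g + fscale (kappa p g) (f0 s) \<in> W s"
    using assms p by (intro theta_kappa) (auto simp: nes_iff)
  then have "theta s S g + fscale (kappa p g) (f0 s) \<in> ?Y"
    using fs.span_mono[of "rels (dg s)" "insert (f0 s) (rels (dg s))"] by blast
  moreover have "fscale (kappa p g) (f0 s) \<in> ?Y"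
    by (intro fs.span_scale fs.span_base) simp
  ultimately have "theta s S g + fscale (kappa p g) (f0 s) + fscale (kappa p g) (f0 s) \<in> ?Y"
    by (rule fs.span_add)
  then show ?thesis by (simp add: add.assoc)
qed

lemma U_span: "f \<in> U s \<Longrightarrow> f \<in> fs.span (insert (f0 s) (rels (dg s)))"
  by (subst coord(2)[of f s], assumption) (intro fs.span_sum theta_span coord(1))

lemma coinv_ge3:
  assumes s: "3 \<le> s" shows "coinv_dim (dg s) = 1"
proof -
  have VU: "f \<in> U s" if "f \<in> V s" for f
  proof (cases "s = 3")
    case True
    then show ?thesis using V3_eq_U[of f] that by (simp add: numeral_3_eq_3)
  next
    case False
    then obtain t where "s = Suc t" "3 \<le> t" using s by (cases s) auto
    then show ?thesis using V_eq_U_ge4[of f t] that by simp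
  qed
  show ?thesis
  proof (rule coinv_dim_1[of _ "f0 s" "phi s"])
    show "V s \<subseteq> fs.span (insert (f0 s) (rels (dg s)))" using VU U_span by blast
    show "phi s (f + g) = phi s f + phi s g" if "f \<in> V s" "g \<in> V s" for f g
      using VU that s by (intro phi_add) auto
    show "phi s (act a b f) = phi s f" if "a < 4" "b < 4" "a \<noteq> b" "f \<in> V s" for a b f
      using VU that s by (intro phi_act) auto
  qed (use s in \<open>auto simp: f0_V phi_f0\<close>)
qed

section \<open>The cases s = 1 and s = 2\<close>

lemma U_W:
  assumes f0: "f0 s \<in> W s" and f: "f \<in> U s" shows "f \<in> W s"
proof -
  have "insert (f0 s) (rels (dg s)) \<subseteq> W s" using f0 by (auto intro: fs.span_base)
  then have "fs.span (insert (f0 s) (rels (dg s))) \<subseteq> W s" by (intro fs.span_minimal) auto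
  then show ?thesis using U_span[OF f] by blast
qed

lemma quad_0123: "quad 0 1 2 3"
  by (auto simp: quad_def)

lemma kappa_dq33: "p < 3 \<Longrightarrow> kappa p (dq 3 3) = 1"
proof -
  assume "p < 3"
  then consider "p = 0" | "p = 1" | "p = 2" by linarith
  then show ?thesis
  proof cases
    case 1
    then show ?thesis using kappa_quad[OF dq_PA quad_0123, of 3 3] by (simp add: qv_dq rv_dq)
  next
    case 2
    then show ?thesis using kappa_quad[OF dq_PA quad_perm(3)[OF quad_0123], of 3 3] by (simp add: qv_dq rv_dq)
  next
    case 3
    then show ?thesis using kappa_quad[OF dq_PA quad_perm(12)[OF quad_0123], of 3 3] by (simp add: qv_dq rv_dq)
  qed
qed

lemma dq33: "S \<subseteq> {0, 1, 2} \<Longrightarrow> S \<subseteq> {..<4} \<and> dq 3 3 \<in> M S"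
  by (intro conjI dq_M) auto

lemma theta_dq33: "S \<subseteq> {0, 1, 2} \<Longrightarrow> p \<in> S \<Longrightarrow> theta s S (dq 3 3) + f0 s \<in> W s"
proof -
  assume S: "S \<subseteq> {0, 1, 2}" "p \<in> S"
  then have "p < 3" by auto
  then show ?thesis using theta_kappa[of S "dq 3 3" p s] dq33[OF S(1)] S kappa_dq33[of p] by simp
qed

lemma f0_W_1: "f0 (Suc 0) \<in> W (Suc 0)"
proof -
  let ?t = "\<lambda>S. theta (Suc 0) S (dq 3 3)"
  have v: "?t S \<in> V (Suc 0)" if "S \<subseteq> {0, 1, 2}" for S
    using dq33[OF that] by (intro theta_V) auto
  have "?t {0} + (?t {1} + ?t {0, 1}) = 0"
  proof (rule V_eqI)
    show "?t {0} + (?t {1} + ?t {0, 1}) \<in> V (Suc 0)" by (intro PA_add v) auto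
    fix i :: nat assume i: "i < 4"
    show "slice i (?t {0} + (?t {1} + ?t {0, 1})) = slice i 0"
      unfolding slice_add slice_theta[OF i] slice_0
      by (cases "i = 0"; cases "i = 1") (simp_all del: zero_fun_apply plus_fun_apply)
  qed simp
  moreover have "(?t {0} + f0 (Suc 0)) + ((?t {1} + f0 (Suc 0)) + (?t {0, 1} + f0 (Suc 0))) \<in> W (Suc 0)"
    by (intro fs.span_add theta_dq33[of _ 0] theta_dq33[of _ 1]) auto
  moreover have "(?t {0} + f0 (Suc 0)) + ((?t {1} + f0 (Suc 0)) + (?t {0, 1} + f0 (Suc 0))) =
    (?t {0} + (?t {1} + ?t {0, 1})) + f0 (Suc 0)"
    by (simp add: ac_simps del: zero_fun_apply plus_fun_apply theta.simps)
  ultimately show ?thesis by (metis add_0)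
qed

lemma f0_W_2: "f0 (Suc (Suc 0)) \<in> W (Suc (Suc 0))"
proof -
  let ?t = "\<lambda>s S. theta s S (dq 3 3)"
  let ?s = "Suc (Suc 0)"
  let ?f = "f0 ?s"
  have v: "?t s S \<in> V s" if "S \<subseteq> {0, 1, 2}" for S s
    using dq33[OF that] by (intro theta_V) auto
  let ?sum = "\<lambda>g. g {0} + (g {1} + (g {2} + (g {0, 1} + (g {0, 2} + (g {1, 2} + g {0, 1, 2})))))"
  have V1: "?sum (\<lambda>S. if i \<in> S then ?t (Suc 0) S else 0) = 0" if i: "i < 4" for i :: nat
  proof (rule V_eqI)
    show "?sum (\<lambda>S. if i \<in> S then ?t (Suc 0) S else 0) \<in> V (Suc 0)"
      using v[of _ "Suc 0"] PA_0 by (intro PA_add) (simp_all del: zero_fun_apply)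
    fix j :: nat assume j: "j < 4"
    have s: "slice j (if P then ?t (Suc 0) S else 0) = (if P \<and> j \<in> S then dq 3 3 else 0)" for P S
      by (simp add: slice_theta[OF j] del: zero_fun_apply)
    consider "i = 0" | "i = 1" | "i = 2" | "i = 3" using i by linarith
    then show "slice j (?sum (\<lambda>S. if i \<in> S then ?t (Suc 0) S else 0)) = slice j 0"
      unfolding slice_add s slice_0
      by cases (cases "j = 0"; cases "j = 1"; cases "j = 2"; simp del: zero_fun_apply plus_fun_apply)+
  qed simp
  have "?sum (?t ?s) = 0"
  proof (rule V_eqI)
    show "?sum (?t ?s) \<in> V ?s" by (intro PA_add v) auto
    fix i :: nat assume i: "i < 4"
    show "slice i (?sum (?t ?s)) = slice i 0"
      unfolding slice_add slice_theta[OF i] slice_0 by (rule V1[OF i])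
  qed simp
  moreover have "?sum (\<lambda>S. ?t ?s S + ?f) \<in> W ?s"
  proof -
    have m: "?t ?s S + ?f \<in> W ?s" if "S \<subseteq> {0, 1, 2}" "S \<noteq> {}" for S
      using that theta_dq33 by blast
    show ?thesis
      by (rule fs.span_add[OF m fs.span_add[OF m fs.span_add[OF m fs.span_add[OF m
              fs.span_add[OF m fs.span_add[OF m m]]]]]]) simp_all
  qed
  moreover have "?sum (\<lambda>S. ?t ?s S + ?f) = ?sum (?t ?s) + ?f"
    by (simp add: ac_simps del: zero_fun_apply plus_fun_apply theta.simps)
  ultimately show ?thesis by (metis add_0)
qed

definition phi1 :: "(mono \<Rightarrow> bit) \<Rightarrow> bit" where
  "phi1 f = (\<Sum>i<4. qv (slice i f) i i)"

lemma phi1_add: "phi1 (f + g) = phi1 f + phi1 g"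
  by (simp add: phi1_def slice_add sum.distrib del: plus_fun_apply)

lemma phi1_act:
  assumes f: "f \<in> V (Suc 0)" and ab: "a < 4" "b < 4" "a \<noteq> b"
  shows "phi1 (act a b f) = phi1 f"
proof -
  obtain c d where q: "quad a b c d" using quad_exists2 ab by blast
  note q' = quadD[OF q]
  have s: "slice i f \<in> PA 3" if "i < 4" for i using V_slice[OF f that] by simp
  have sl: "slice i (act a b f) = (if i = b then act a b (slice b f + slice a f) else act a b (slice i f))" if "i < 4" for i
    by (rule slice_act[OF V_good[OF f] ab that])
  have sum: "slice b f + slice a f \<in> PA 3" by (intro PA_add s ab)
  show ?thesis
    unfolding phi1_def quad_sum[OF q] sl[OF q'(1)] sl[OF q'(2)] sl[OF q'(3)] sl[OF q'(4)]
    using q' by (simp add: qv_act[OF s[OF q'(1)] q] qv_act[OF sum q] qv_act[OF s[OF q'(3)] q]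
        qv_act[OF s[OF q'(4)] quad_perm(1)[OF q]])
qed

lemma M_pairI:
  assumes f: "f \<in> PA 3" and q: "quad a b c d" and 1: "\<And>j. j < 4 \<Longrightarrow> qv f a j = qv f b j"
    and 2: "rv f a = rv f b" "qv f a c = rv f d" "qv f a d = rv f c"
  shows "f \<in> M {a, b}"
proof -
  note q' = quadD[OF q]
  have S: "{a, b} \<subseteq> {..<4}" using q' by simp
  note rab = 2(1)
  have K: "qv f a u = rv f v" "qv f b u = rv f v" if "quad a b u v" for u v
  proof -
    note t = quadD[OF that]
    have "u = c \<or> u = d" using quad_cases[OF q, of u] t(3,12,14) by simp
    moreover have "v = c \<or> v = d" using quad_cases[OF q, of v] t(4,13,15) by simp
    ultimately have "u = c \<and> v = d \<or> u = d \<and> v = c" using t(10) by auto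
    then show "qv f a u = rv f v" using 2 by auto
    then show "qv f b u = rv f v" using 1[of u] quadD(3)[OF that] by simp
  qed
  show ?thesis unfolding M_iff[OF S]
  proof (intro conjI allI impI f)
    show "(\<Sum>i\<in>{a, b}. qv f i j) = 0" if "j < 4" for j
      using 1[OF that] q' by simp
    fix x y z w assume r: "quad x y z w"
    note r' = quadD[OF r]
    have sym: "qv f y x = qv f x y" by (rule qv_sym[OF f r'(2,1)])
    have ax: "a = x \<or> a = y \<or> a = z \<or> a = w" and bx: "b = x \<or> b = y \<or> b = z \<or> b = w"
      using q' quad_cases[OF r] by blast+
    have ab: "a \<noteq> b" by (rule q'(5))
    consider "a = x" "b = y" | "a = y" "b = x" | "a = z" "b = w" | "a = w" "b = z"
      | "a = x" "b = z"
      | "a = z" "b = x"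
      | "a = x" "b = w"
      | "a = w" "b = x"
      | "a = y" "b = z"
      | "a = z" "b = y"
      | "a = y" "b = w"
      | "a = w" "b = y"
      using ax bx ab by (elim disjE) simp_all
    then show "(if x \<in> {a, b} then qv f x y else 0) + (if y \<in> {a, b} then qv f x y else 0) +
        (if z \<in> {a, b} then rv f w else 0) + (if w \<in> {a, b} then rv f z else 0) = 0"
    proof cases
      case 1
      show ?thesis unfolding 1 using r' by simp
    next
      case 2
      show ?thesis unfolding 2 using r' by simp
    next
      case 3
      show ?thesis using r' rab unfolding 3 by simp
    next
      case 4
      show ?thesis using r' rab unfolding 4 by simp
    next
      case 5
      have "quad x z y w" using r by (rule quad_perm)
      then have "qv f x y = rv f w" using K(1)[of y w] sym 5 by simp
      then show ?thesis unfolding 5 using r' by simp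
    next
      case 6
      have "quad z x y w" using r by (rule quad_perm)
      then have "qv f x y = rv f w" using K(2)[of y w] sym 6 by simp
      then show ?thesis unfolding 6 using r' by simp
    next
      case 7
      have "quad x w y z" using r by (rule quad_perm)
      then have "qv f x y = rv f z" using K(1)[of y z] sym 7 by simp
      then show ?thesis unfolding 7 using r' by simp
    next
      case 8
      have "quad w x y z" using r by (rule quad_perm)
      then have "qv f x y = rv f z" using K(2)[of y z] sym 8 by simp
      then show ?thesis unfolding 8 using r' by simp
    next
      case 9
      have "quad y z x w" using r by (rule quad_perm)
      then have "qv f x y = rv f w" using K(1)[of x w] sym 9 by simp
      then show ?thesis unfolding 9 using r' by simp
    next
      case 10
      have "quad z y x w" using r by (rule quad_perm)
      then have "qv f x y = rv f w" using K(2)[of x w] sym 10 by simp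
      then show ?thesis unfolding 10 using r' by simp
    next
      case 11
      have "quad y w x z" using r by (rule quad_perm)
      then have "qv f x y = rv f z" using K(1)[of x z] sym 11 by simp
      then show ?thesis unfolding 11 using r' by simp
    next
      case 12
      have "quad w y x z" using r by (rule quad_perm)
      then have "qv f x y = rv f z" using K(2)[of x z] sym 12 by simp
      then show ?thesis unfolding 12 using r' by simp
    qed
  qed
qed

lemma M_singleI:
  assumes f: "f \<in> PA 3" and a: "a < 4" and 1: "\<And>j. j < 4 \<Longrightarrow> qv f a j = 0"
    and 2: "\<And>j. j < 4 \<Longrightarrow> j \<noteq> a \<Longrightarrow> rv f j = 0"
  shows "f \<in> M {a}"
proof -
  have S: "{a} \<subseteq> {..<4}" using a by simp
  show ?thesis unfolding M_iff[OF S]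
  proof (intro conjI allI impI f)
    show "(\<Sum>i\<in>{a}. qv f i j) = 0" if "j < 4" for j using 1[OF that] by simp
    fix x y z w assume r: "quad x y z w"
    note r' = quadD[OF r]
    consider "a = x" | "a = y" | "a = z" | "a = w"
      using a unfolding quad_cases[OF r] by (elim disjE) simp_all
    then show "(if x \<in> {a} then qv f x y else 0) + (if y \<in> {a} then qv f x y else 0) +
        (if z \<in> {a} then rv f w else 0) + (if w \<in> {a} then rv f z else 0) = 0"
    proof cases
      case c: 1
      show ?thesis using 1[OF r'(2)] r' unfolding c by simp
    next
      case c: 2
      show ?thesis using 1[OF r'(1)] qv_sym[OF f r'(1,2)] r' unfolding c by simp
    next
      case c: 3
      show ?thesis using 2[OF r'(4)] r' unfolding c by simp
    next
      case c: 4
      show ?thesis using 2[OF r'(3)] r' unfolding c by simp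
    qed
  qed
qed

lemma pair_sum:
  fixes B :: "nat \<Rightarrow> nat \<Rightarrow> 'b::comm_monoid_add"
  assumes a: "a < 4" and sym: "\<And>i. i < 4 \<Longrightarrow> i \<noteq> a \<Longrightarrow> B i a = B a i"
  shows "(\<Sum>i<4. \<Sum>j<4. if j < i \<and> (a = i \<or> a = j) then B i j else 0) = (\<Sum>j\<in>{..<4} - {a}. B a j)"
proof -
  have "(\<Sum>i<4. \<Sum>j<4. if j < i \<and> (a = i \<or> a = j) then B i j else 0) =
    (\<Sum>i<4. (if i = a then (\<Sum>j<4. if j < a then B a j else 0) else 0) + (if a < i then B i a else 0))"
  proof (rule sum.cong)
    fix i :: nat assume "i \<in> {..<4}"
    show "(\<Sum>j<4. if j < i \<and> (a = i \<or> a = j) then B i j else 0) =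
      (if i = a then (\<Sum>j<4. if j < a then B a j else 0) else 0) + (if a < i then B i a else 0)"
    proof (cases "i = a")
      case False
      then have "(\<Sum>j<4. if j < i \<and> (a = i \<or> a = j) then B i j else 0) = (\<Sum>j<4. if j = a then (if a < i then B i a else 0) else 0)"
        by (intro sum.cong) auto
      then show ?thesis using False a by simp
    next
      case True
      show ?thesis unfolding True by simp
    qed
  qed simp
  also have "\<dots> = (\<Sum>j<4. if j < a then B a j else 0) + (\<Sum>i<4. if a < i then B i a else 0)"
    using a by (simp add: sum.distrib)
  also have "\<dots> = (\<Sum>j<4. if j \<in> {..<4} - {a} then B a j else 0)"
    unfolding sum.distrib[symmetric] using sym by (intro sum.cong) auto
  also have "\<dots> = (\<Sum>j\<in>{..<4} - {a}. B a j)"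
    by (subst sum.inter_restrict[symmetric]) (auto intro: sum.cong)
  finally show ?thesis .
qed

text \<open>The unknowns \<open>w\<close> move the weight \<open>y\<close> between adjacent edges of the complete graph on four vertices, so
  that only the total weight is an obstruction.\<close>

lemma edge_solution:
  fixes y :: "nat \<Rightarrow> nat \<Rightarrow> bit"
  assumes sym: "\<And>i j. y i j = y j i" and 0: "y 0 1 = y 0 2 + (y 0 3 + (y 1 2 + (y 1 3 + y 2 3)))"
  shows "\<exists>w. \<forall>i j k l. quad i j k l \<longrightarrow> y i j = w j l + (w j k + (w i l + w i k))"
proof -
  define w where "w i j = (if i = 0 \<and> j = 2 then y 0 3 else if i = 1 \<and> j = 3 then y 1 2
    else if i = 1 \<and> j = 2 then y 1 3 else if i = 2 \<and> j = 1 then y 2 3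
    else if i = 0 \<and> j = 3 then y 0 2 + y 2 3 else 0)" for i j :: nat
  have c4: "i = 0 \<or> i = 1 \<or> i = 2 \<or> i = 3" if "i < 4" for i :: nat using that by linarith
  have "y i j = w j l + (w j k + (w i l + w i k))" if q: "quad i j k l" for i j k l
  proof -
    note q' = quadD[OF q]
    note s = sym[of 1 0] sym[of 2 0] sym[of 3 0] sym[of 2 1] sym[of 3 1] sym[of 3 2]
    from c4[OF q'(1)] c4[OF q'(2)] c4[OF q'(3)] c4[OF q'(4)] show ?thesis
      using q'(5-10) by (elim disjE) (simp_all add: w_def s 0 ac_simps)
  qed
  then show ?thesis by blast
qed

lemma V1_phi1_U:
  assumes f: "f \<in> V (Suc 0)" and phi: "phi1 f = 0" shows "f \<in> U (Suc 0)"
proof -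
  define G where "G i = slice i f" for i
  have G: "G i \<in> PA 3" if "i < 4" for i unfolding G_def using V_slice[OF f that] by simp
  have rel: "(\<Sum>i<4. G i (ex i + z)) = 0" for z using V_Glue[OF f] by (simp add: G_def Glue_def)
  define b where "b i j = qv (G i) i j" for i j
  define t where "t i j = rv (G i) j" for i j
  define y where "y i j = b i j + b j i" for i j
  have yt: "y i j = t k l + t l k" if q: "quad i j k l" for i j k l
  proof -
    note q' = quadD[OF q]
    have "qv (G i) i j + (qv (G j) i j + (rv (G k) l + rv (G l) k)) = 0"
      by (rule glue_val(1)[where h = G]) (use G rel q in auto)
    then have "y i j + (t k l + t l k) = 0"
      by (simp only: y_def b_def t_def qv_sym[OF G[OF q'(2)] q'(2,1)] add.assoc)
    then show ?thesis by (simp only: bit_add_eq_0_iff)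
  qed
  have bs: "(\<Sum>i<4. b i j) = 0" if "j < 4" for j
    unfolding b_def by (rule glue_val(2)[where h = G]) (use G rel that in auto)
  have "(\<Sum>i<4. b i i) = 0" using phi by (simp add: phi1_def b_def G_def)
  then have diag: "b 0 0 + (b 1 1 + (b 2 2 + b 3 3)) = 0" unfolding quad_sum[OF quad_0123] .
  have col: "b 0 0 + (b 1 0 + (b 2 0 + b 3 0)) = 0" "b 0 1 + (b 1 1 + (b 2 1 + b 3 1)) = 0"
    "b 0 2 + (b 1 2 + (b 2 2 + b 3 2)) = 0" "b 0 3 + (b 1 3 + (b 2 3 + b 3 3)) = 0"
    using bs[of 0] bs[of 1] bs[of 2] bs[of 3] unfolding quad_sum[OF quad_0123] by simp_all
  have "y 0 1 + (y 0 2 + (y 0 3 + (y 1 2 + (y 1 3 + y 2 3)))) = (b 0 0 + (b 1 1 + (b 2 2 + b 3 3))) +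
    (b 0 0 + (b 1 0 + (b 2 0 + b 3 0))) + (b 0 1 + (b 1 1 + (b 2 1 + b 3 1))) +
    (b 0 2 + (b 1 2 + (b 2 2 + b 3 2))) + (b 0 3 + (b 1 3 + (b 2 3 + b 3 3)))"
    by (simp add: y_def ac_simps)
  also have "\<dots> = 0" unfolding diag col by simp
  finally obtain w where w: "\<And>i j k l. quad i j k l \<Longrightarrow> y i j = w j l + (w j k + (w i l + w i k))"
    using edge_solution[of y] by (auto simp: y_def add.commute)
  define c1 where "c1 i j = b i j + (\<Sum>k\<in>{..<4} - {i, j}. w j k)" for i j
  define c3 where "c3 i j = t i j + (\<Sum>k\<in>{..<4} - {i, j}. w k j)" for i j
  define qB where "qB i j x z = (if x \<in> {i, j} then (if z \<in> {i, j} then c1 i j else (\<Sum>l\<in>{..<4} - {i, j, z}. w z l))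
    else (if z \<in> {i, j} then (\<Sum>l\<in>{..<4} - {i, j, x}. w x l) else 0))" for i j x z
  define rB where "rB i j x = (if x \<in> {i, j} then c3 i j else (\<Sum>k\<in>{..<4} - {i, j, x}. w k x))" for i j x
  define B where "B i j = mkf (qB i j) (rB i j)" for i j
  have set4: "{..<4} = {i, j, k, l}" if "quad i j k l" for i j k l using that by (simp add: quad_def)
  have c1: "c1 i j = b i j + (w j k + w j l)" if q: "quad i j k l" for i j k l
    using quadD[OF q] unfolding c1_def set4[OF q] by (simp add: insert_Diff_if)
  have c3: "c3 i j = t i j + (w k j + w l j)" if q: "quad i j k l" for i j k l
    using quadD[OF q] unfolding c3_def set4[OF q] by (simp add: insert_Diff_if)
  have qB: "qB i j i j = c1 i j" "qB i j j i = c1 i j" "qB i j i i = c1 i j" "qB i j j j = c1 i j"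
      "qB i j i k = w k l" "qB i j k i = w k l" "qB i j j k = w k l" "qB i j k j = w k l"
      "qB i j k k = 0" "qB i j k l = 0" if q: "quad i j k l" for i j k l
    using quadD[OF q] unfolding qB_def set4[OF q] by (simp_all add: insert_Diff_if)
  have rB: "rB i j i = c3 i j" "rB i j j = c3 i j" "rB i j k = w l k" if q: "quad i j k l" for i j k l
    using quadD[OF q] unfolding rB_def set4[OF q] by (simp_all add: insert_Diff_if)
  have BPA: "B i j \<in> PA 3" for i j unfolding B_def by (rule mkf_PA)
  have qvB: "qv (B i j) x z = qB i j x z" if "x < 4" "z < 4" for i j x z
    unfolding B_def using that by (rule qv_mkf) (auto simp: qB_def)
  have rvB: "rv (B i j) x = rB i j x" if "x < 4" for i j x
    unfolding B_def using that by (rule rv_mkf)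
  have symc: "c1 i j = c1 j i" "c3 i j = c3 j i" if q: "quad i j k l" for i j k l
  proof -
    have "c1 i j + c1 j i = y i j + (w j l + (w j k + (w i l + w i k)))"
      unfolding c1[OF q] c1[OF quad_perm(3)[OF q]] y_def by (simp add: ac_simps)
    then show "c1 i j = c1 j i" using w[OF q] by simp
    have "c3 i j + c3 j i = (t i j + t j i) + (w l j + (w l i + (w k j + w k i)))"
      unfolding c3[OF q] c3[OF quad_perm(3)[OF q]] by (simp add: ac_simps)
    also have "\<dots> = 0" using w[OF quad_perm(16)[OF q]] yt[OF quad_perm(16)[OF q]] by (simp add: ac_simps)
    finally show "c3 i j = c3 j i" by simp
  qed
  have symB: "B i j = B j i" if ij: "i < 4" "j < 4" "i \<noteq> j" for i j
  proof -
    obtain k l where q: "quad i j k l" using quad_exists2 ij by blast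
    have "qB i j = qB j i" "rB i j = rB j i"
      using symc[OF q] by (auto simp: fun_eq_iff qB_def rB_def insert_commute)
    then show ?thesis by (simp add: B_def)
  qed
  have BM: "B i j \<in> M {i, j}" if ij: "i < 4" "j < 4" "i \<noteq> j" for i j
  proof -
    obtain k l where q: "quad i j k l" using quad_exists2 ij by blast
    note q' = quadD[OF q] and q2 = quad_perm(1)[OF q]
    show ?thesis
    proof (rule M_pairI[OF BPA q])
      show "qv (B i j) i x = qv (B i j) j x" if "x < 4" for x
        using that q' by (simp add: qvB qB_def)
      show "rv (B i j) i = rv (B i j) j" "qv (B i j) i k = rv (B i j) l" "qv (B i j) i l = rv (B i j) k"
        using q' by (simp_all add: qvB rvB qB[OF q] rB[OF q] qB[OF q2] rB[OF q2])
    qed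
  qed
  let ?s = "Suc 0"
  define g where "g = (\<Sum>i<4. \<Sum>j<4. if j < i then theta ?s {i, j} (B i j) else 0)"
  have gU: "g \<in> U ?s" unfolding g_def
    by (intro U_sum) (auto intro!: U_theta BM simp: nes_iff simp del: zero_fun_apply)
  have gV: "g \<in> V ?s" unfolding g_def
    by (intro sum_PA) (auto intro!: theta_V BM simp del: zero_fun_apply)
  have Fg: "Fs ?s {a} (f + g) = G a + (\<Sum>j\<in>co a. B a j)" if a: "a < 4" for a
  proof -
    have "Fs ?s {a} f = G a" using slices_Fs[of f "[a]"] f a by (simp add: G_def)
    moreover have "Fs ?s {a} g = (\<Sum>i<4. \<Sum>j<4. if j < i \<and> (a = i \<or> a = j) then B i j else 0)"
      unfolding g_def Fs_sum using a
      by (intro sum.cong refl) (auto simp: Fs_theta simp del: zero_fun_apply)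
    ultimately show ?thesis
      using pair_sum[of a B, OF a] symB a unfolding Fs_add by (metis (no_types, lifting))
  qed
  have "f + g \<in> U ?s"
  proof (rule U_descent[of _ _ 1])
    show fg: "f + g \<in> V ?s" using f gV by (rule PA_add)
    show "Fs ?s S (f + g) \<in> M S" if S: "S \<in> Sk 1" for S
    proof -
      have "card S = 1" "S \<subseteq> {..<4}" using S by (auto simp: Sk_def)
      then obtain a where a: "S = {a}" "a < 4" by (auto elim: card_1_singletonE)
      have "G a + (\<Sum>j\<in>co a. B a j) \<in> M {a}"
      proof (rule M_singleI[OF _ a(2)])
        show "G a + (\<Sum>j\<in>co a. B a j) \<in> PA 3" using a by (intro PA_add G sum_PA BPA)
        show "qv (G a + (\<Sum>j\<in>co a. B a j)) a j = 0" if j: "j < 4" for j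
        proof (cases "j = a")
          case True
          obtain x v z where q: "quad a x v z" using quad_exists1 a by blast
          note q' = quadD[OF q]
          note q2 = quad_perm(2)[OF q] and q3 = quad_perm(5)[OF q]
          have "qv (G a + (\<Sum>j\<in>co a. B a j)) a a = b a a + (c1 a x + (c1 a v + c1 a z))"
            using q' unfolding co_quad[OF quad_perm(9)[OF q]]
            by (simp add: qvB qB[OF q] qB[OF q2] qB[OF q3] b_def)
          also have "\<dots> = (b a a + (b x a + (b v a + b z a))) + (y a x + (w x z + (w x v + (w a z + w a v))))
             + (y a v + (w v z + (w v x + (w a z + w a x)))) + (y a z + (w z v + (w z x + (w a v + w a x))))"
            unfolding c1[OF q] c1[OF q2] c1[OF q3] y_def by (simp add: ac_simps)
          also have "\<dots> = 0"
            using bs[OF a(2)] w[OF q] w[OF q2] w[OF quad_perm(6)[OF q]] unfolding quad_sum[OF q] by simp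
          finally show ?thesis using True by simp
        next
          case False
          then obtain k l where q: "quad a j k l" using quad_exists2[OF a(2) j] by blast
          note q' = quadD[OF q]
          note q2 = quad_perm(2)[OF q] and q3 = quad_perm(5)[OF q]
          show ?thesis
            using q' unfolding co_quad[OF quad_perm(9)[OF q]]
            by (simp add: qvB qB[OF q] qB[OF q2] qB[OF q3] b_def c1[OF q] ac_simps)
        qed
        show "rv (G a + (\<Sum>j\<in>co a. B a j)) j = 0" if j: "j < 4" "j \<noteq> a" for j
        proof -
          obtain k l where q: "quad a j k l" using quad_exists2[OF a(2) j(1)] j by blast
          note q' = quadD[OF q]
          note q2 = quad_perm(2)[OF q] and q3 = quad_perm(5)[OF q]
          show ?thesis
            using q' unfolding co_quad[OF quad_perm(9)[OF q]]
            by (simp add: rvB rB[OF q] rB[OF q2] rB[OF q3] t_def c3[OF q] ac_simps)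
        qed
      qed
      then show ?thesis using Fg a by simp
    qed
  qed simp_all
  from U_add[OF this gU] show ?thesis by (simp add: add.assoc)
qed

definition G2 :: "(mono \<Rightarrow> bit) \<Rightarrow> nat \<Rightarrow> nat \<Rightarrow> mono \<Rightarrow> bit" where
  "G2 f x y = Fs (Suc (Suc 0)) {x, y} f"

lemma V2_pairs:
  assumes f: "f \<in> V (Suc (Suc 0))"
  shows "x < 4 \<Longrightarrow> y < 4 \<Longrightarrow> G2 f x y \<in> PA 3" "G2 f x y = G2 f y x"
    "quad a b c d \<Longrightarrow> e < 4 \<Longrightarrow> qv (G2 f a e) a b + (qv (G2 f b e) a b + (rv (G2 f c e) d + rv (G2 f d e) c)) = 0"
    "e < 4 \<Longrightarrow> j < 4 \<Longrightarrow> (\<Sum>i<4. qv (G2 f i e) i j) = 0"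
    "quad a b c d \<Longrightarrow> qv (G2 f a a) a b + (qv (G2 f b b) a b + (rv (G2 f c c) d + rv (G2 f d d) c)) = 0"
proof -
  show P: "G2 f x y \<in> PA 3" if "x < 4" "y < 4" for x y
    unfolding G2_def using that by (intro Fs_PA f) (auto simp: card_insert_if)
  show "G2 f x y = G2 f y x" by (simp add: G2_def insert_commute)
  have e: "(\<Sum>i<4. G2 f i i (ex i + z)) = 0" for z
    using Fs_rel_empty[OF f, of z] by (simp add: G2_def)
  have r: "(\<Sum>i<4. G2 f i e (ex i + z)) = 0" if "e < 4" for e z
    using Fs_rel[OF f, of "{e}" z] that by (simp add: G2_def)
  show "qv (G2 f a e) a b + (qv (G2 f b e) a b + (rv (G2 f c e) d + rv (G2 f d e) c)) = 0" if "quad a b c d" "e < 4"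
    by (rule glue_val(1)[where h = "\<lambda>i. G2 f i e"]) (use P r that in auto)
  show "(\<Sum>i<4. qv (G2 f i e) i j) = 0" if "e < 4" "j < 4"
    by (rule glue_val(2)[where h = "\<lambda>i. G2 f i e"]) (use P r that in auto)
  show "qv (G2 f a a) a b + (qv (G2 f b b) a b + (rv (G2 f c c) d + rv (G2 f d d) c)) = 0" if "quad a b c d"
    by (rule glue_val(1)[where h = "\<lambda>i. G2 f i i"]) (use P e that in auto)
qed

lemma V2_pair_relation:
  assumes f: "f \<in> V (Suc (Suc 0))" and q: "quad a b c d"
  shows "qv (G2 f a b) a a + qv (G2 f a b) a b =
    (qv (G2 f c b) c a + rv (G2 f c b) d) + (qv (G2 f d b) d a + rv (G2 f d b) c)"
proof -
  define G where "G = G2 f"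
  note q' = quadD[OF q]
  note P = V2_pairs[OF f, folded G_def]
  have 1: "qv (G a b) a b + (qv (G b b) a b + (rv (G c b) d + rv (G d b) c)) = 0"
    using P(3)[OF q q'(2)] .
  have 2: "qv (G a b) a a + (qv (G b b) b a + (qv (G c b) c a + qv (G d b) d a)) = 0"
    using P(4)[OF q'(2,1)] unfolding quad_sum[OF q] .
  have "qv (G a b) a a + qv (G a b) a b + ((qv (G c b) c a + rv (G c b) d) + (qv (G d b) d a + rv (G d b) c)) =
    (qv (G a b) a b + (qv (G b b) a b + (rv (G c b) d + rv (G d b) c))) +
    (qv (G a b) a a + (qv (G b b) b a + (qv (G c b) c a + qv (G d b) d a)))"
    unfolding qv_sym[OF P(1)[OF q'(2,2)] q'(2,1)] by (simp add: ac_simps)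
  then have "qv (G a b) a a + qv (G a b) a b = (qv (G c b) c a + rv (G c b) d) + (qv (G d b) d a + rv (G d b) c)"
    unfolding 1 2 by simp
  then show ?thesis by (simp add: G_def)
qed

lemma V2_pair_M:
  assumes f: "f \<in> V (Suc (Suc 0))"
  assumes p2: "\<And>a b c d. quad a b c d \<Longrightarrow> qv (G2 f a b) a c = rv (G2 f a b) d"
    and q: "quad a b c d"
  shows "G2 f a b \<in> M {a, b}"
proof -
  define G where "G = G2 f"
  note p = p2[folded G_def]
  note q' = quadD[OF q] and qp = quad_perm[OF q]
  note P = V2_pairs[OF f, folded G_def]
  have GP: "G a b \<in> PA 3" by (rule P(1)[OF q'(1,2)])
  note s = P(2)
  have A: "qv (G a b) a a = qv (G a b) a b" if q: "quad a b c d" for a b c d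
    using V2_pair_relation[OF f q, folded G_def] p[OF quad_perm(14)[OF q]] p[OF quad_perm(20)[OF q]] by simp
  have ba: "qv (G a b) b b = qv (G a b) a b"
    using A[OF qp(3)] s[of b a] qv_sym[OF GP q'(2,1)] by simp
  have bc: "qv (G a b) b c = rv (G a b) d" "qv (G a b) b d = rv (G a b) c"
    using p[OF qp(3)] p[OF qp(7)] s[of b a] by simp_all
  have D: "rv (G c d) c = rv (G c d) d" if q: "quad a b c d" for a b c d
  proof -
    note q' = quadD[OF q] and qp = quad_perm[OF q]
    have T: "qv (G a a) a b + (qv (G b b) a b + (rv (G c c) d + rv (G d d) c)) = 0"
      "qv (G a a) a b + (qv (G b a) a b + (rv (G c a) d + rv (G d a) c)) = 0"
      "qv (G a b) a b + (qv (G b b) a b + (rv (G c b) d + rv (G d b) c)) = 0"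
      "qv (G a c) a b + (qv (G b c) a b + (rv (G c c) d + rv (G d c) c)) = 0"
      "qv (G a d) a b + (qv (G b d) a b + (rv (G c d) d + rv (G d d) c)) = 0"
      using P(5)[OF q] P(3)[OF q q'(1)] P(3)[OF q q'(2)] P(3)[OF q q'(3)] P(3)[OF q q'(4)] by simp_all
    have z: "qv (G a c) a b = rv (G a c) d" "qv (G a d) a b = rv (G a d) c"
      "qv (G b c) a b = rv (G b c) d" "qv (G b d) a b = rv (G b d) c"
      using p[OF qp(2)] p[OF qp(5)] p[OF qp(8)] p[OF qp(10)] qv_sym[OF P(1)[OF q'(2,3)] q'(2,1)]
        qv_sym[OF P(1)[OF q'(2,4)] q'(2,1)] by simp_all
    have "rv (G c d) c + rv (G c d) d =
      (qv (G a a) a b + (qv (G b b) a b + (rv (G c c) d + rv (G d d) c))) +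
      (qv (G a a) a b + (qv (G b a) a b + (rv (G c a) d + rv (G d a) c))) +
      (qv (G a b) a b + (qv (G b b) a b + (rv (G c b) d + rv (G d b) c))) +
      (qv (G a c) a b + (qv (G b c) a b + (rv (G c c) d + rv (G d c) c))) +
      (qv (G a d) a b + (qv (G b d) a b + (rv (G c d) d + rv (G d d) c)))"
      unfolding z s[of b a] s[of c a] s[of d a] s[of c b] s[of d b] s[of d c] by (simp add: ac_simps)
    also have "\<dots> = 0" unfolding T by simp
    finally show ?thesis by simp
  qed
  show ?thesis unfolding G_def[symmetric]
  proof (rule M_pairI[OF GP q])
    show "rv (G a b) a = rv (G a b) b" by (rule D[OF qp(16)])
    show "qv (G a b) a c = rv (G a b) d" "qv (G a b) a d = rv (G a b) c" using p[OF q] p[OF qp(1)] by simp_all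
    show "qv (G a b) a j = qv (G a b) b j" if "j < 4" for j
      using that A[OF q] ba bc p[OF q] p[OF qp(1)] qv_sym[OF GP q'(2,1)] unfolding quad_cases[OF q] by auto
  qed
qed

lemma triangle_solution:
  fixes P :: "nat \<Rightarrow> nat \<Rightarrow> nat \<Rightarrow> bit"
  assumes q: "quad b x y w"
    and 0: "P w y x = P x y w + (P y x w + (P x w y + (P w x y + P y w x)))"
  shows "\<exists>sg pi. \<forall>a c d. quad a b c d \<longrightarrow> P a c d = sg d + pi c"
proof -
  note q' = quadD[OF q]
  define pi where "pi i = (if i = y then P x y w + P y x w else if i = w then P x w y + P w x y else 0)" for i
  define sg where "sg i = (if i = w then P y x w else if i = y then P w x y else P y w x + (P x w y + P w x y))" for i
  have "P a c d = sg d + pi c" if r: "quad a b c d" for a c d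
  proof -
    note r' = quadD[OF r]
    have "a = x \<or> a = y \<or> a = w" "c = x \<or> c = y \<or> c = w" "d = x \<or> d = y \<or> d = w"
      using r' quad_cases[OF q] by blast+
    moreover have "a \<noteq> c" "a \<noteq> d" "c \<noteq> d" by (rule r')+
    ultimately consider "a = x" "c = y" "d = w" | "a = x" "c = w" "d = y" | "a = y" "c = x" "d = w"
      | "a = y" "c = w" "d = x" | "a = w" "c = x" "d = y" | "a = w" "c = y" "d = x"
      by metis
    then show ?thesis
    proof cases
      case c: 1
      show ?thesis unfolding c sg_def pi_def using q' by simp
    next
      case c: 2
      show ?thesis unfolding c sg_def pi_def using q' by simp
    next
      case c: 3
      show ?thesis unfolding c sg_def pi_def using q' by simp
    next
      case c: 4
      show ?thesis unfolding c sg_def pi_def using q' by (simp add: ac_simps)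
    next
      case c: 5
      show ?thesis unfolding c sg_def pi_def using q' by simp
    next
      case c: 6
      show ?thesis unfolding c sg_def pi_def 0 using q' by (simp add: ac_simps)
    qed
  qed
  then show ?thesis by blast
qed

lemma V2_phi1_U:
  assumes f: "f \<in> V (Suc (Suc 0))" and phi: "\<And>b. b < 4 \<Longrightarrow> phi1 (slice b f) = 0"
  shows "f \<in> U (Suc (Suc 0))"
proof -
  let ?s = "Suc (Suc 0)"
  define G where "G = G2 f"
  note P = V2_pairs[OF f, folded G_def]
  have ph: "(\<Sum>i<4. qv (G i b) i i) = 0" if b: "b < 4" for b
  proof -
    have "slice i (slice b f) = G i b" if "i < 4" for i
      using slices_Fs[of f "[b, i]"] f b that by (simp add: G_def G2_def insert_commute)
    then show ?thesis using phi[OF b] by (simp add: phi1_def)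
  qed
  have "\<forall>b. \<exists>sg pi. b < 4 \<longrightarrow> (\<forall>a c d. quad a b c d \<longrightarrow> qv (G a b) a c + rv (G a b) d = sg d + pi c)"
  proof
    fix b
    show "\<exists>sg pi. b < 4 \<longrightarrow> (\<forall>a c d. quad a b c d \<longrightarrow> qv (G a b) a c + rv (G a b) d = sg d + pi c)"
    proof (cases "b < 4")
      case b: True
      obtain x y w where q: "quad b x y w" using quad_exists1[OF b] by blast
      let ?P = "\<lambda>a c d. qv (G a b) a c + rv (G a b) d"
      have X: "qv (G x b) x x + qv (G x b) x b = ?P y x w + ?P w x y"
        using V2_pair_relation[OF f quad_perm(3)[OF q]] unfolding G_def .
      have Y: "qv (G y b) y y + qv (G y b) y b = ?P x y w + ?P w y x"
        using V2_pair_relation[OF f quad_perm(12)[OF q]] unfolding G_def .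
      have Z: "qv (G w b) w w + qv (G w b) w b = ?P x w y + ?P y w x"
        using V2_pair_relation[OF f quad_perm(18)[OF q]] unfolding G_def .
      have S: "qv (G b b) b b + (qv (G x b) x x + (qv (G y b) y y + qv (G w b) w w)) = 0"
        "qv (G b b) b b + (qv (G x b) x b + (qv (G y b) y b + qv (G w b) w b)) = 0"
        using ph[OF b] P(4)[OF b b] unfolding quad_sum[OF q] by simp_all
      have "?P w y x + (?P x y w + (?P y x w + (?P x w y + (?P w x y + ?P y w x)))) =
        (?P y x w + ?P w x y) + (?P x y w + ?P w y x) + (?P x w y + ?P y w x)"
        by (simp add: ac_simps)
      also have "\<dots> = (qv (G b b) b b + (qv (G x b) x x + (qv (G y b) y y + qv (G w b) w w))) +
        (qv (G b b) b b + (qv (G x b) x b + (qv (G y b) y b + qv (G w b) w b)))"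
        unfolding X[symmetric] Y[symmetric] Z[symmetric] by (simp add: ac_simps)
      also have "\<dots> = 0" unfolding S by simp
      finally show ?thesis using triangle_solution[OF q, of ?P] by simp
    qed simp
  qed
  then obtain sg pi where sp: "\<And>a b c d. quad a b c d \<Longrightarrow> qv (G a b) a c + rv (G a b) d = sg b d + pi b c"
    using quadD(2) by metis
  define qR where "qR d i j = (if i = d \<and> j = d then 0 else
    (\<Sum>e\<in>{..<4} - {i, j, d}. if i = d \<or> j = d then pi e d else sg e d))" for d i j
  define R where "R d = mkf (qR d) (\<lambda>i. if i = d then 0 else pi i d)" for d
  have RPA: "R d \<in> PA 3" for d unfolding R_def by (rule mkf_PA)
  have set4: "{..<4} = {i, j, k, l}" if "quad i j k l" for i j k l using that by (simp add: quad_def)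
  have qR: "qR d a b = sg c d" "qR d a a = sg b d + sg c d" "qR d a d = pi b d + pi c d"
    "qR d d a = pi b d + pi c d" "qR d d d = 0" if q: "quad a b c d" for a b c d
    using quadD[OF q] unfolding qR_def set4[OF q] by (simp_all add: insert_Diff_if)
  have qvR: "qv (R d) i j = qR d i j" if "i < 4" "j < 4" for d i j
    unfolding R_def using that by (rule qv_mkf) (auto simp: qR_def insert_commute)
  have rvR: "rv (R d) i = (if i = d then 0 else pi i d)" if "i < 4" for d i
    unfolding R_def using that by (rule rv_mkf)
  have RM: "R d \<in> M (co d)" if d: "d < 4" for d
  proof (rule M_co[OF d RPA])
    obtain a b c where "quad d a b c" using quad_exists1[OF d] by blast
    then have q: "quad a b c d" by (rule quad_perm)
    note q' = quadD[OF q] and qp = quad_perm[OF q]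
    show "(\<Sum>i\<in>co d. qv (R d) i j) = 0" if j: "j < 4" for j
      using j unfolding co_quad[OF q] quad_cases[OF q]
      by (elim disjE) (simp_all add: q' qvR qR[OF q] qR[OF qp(2)] qR[OF qp(3)] qR[OF qp(8)]
          qR[OF qp(12)] qR[OF qp(14)] ac_simps)
    show "qv (R d) a d = rv (R d) b + rv (R d) c" if q: "quad a b c d" for a b c
      using quadD[OF q] by (simp add: qvR rvR qR[OF q])
    show "rv (R d) d = 0" using d by (simp add: rvR)
  qed
  define g where "g = (\<Sum>d<4. theta ?s (co d) (R d))"
  have ne: "co d \<noteq> {}" if d: "d < 4" for d
  proof -
    obtain a b c where "quad d a b c" using quad_exists1[OF d] by blast
    then show ?thesis by (auto simp: quad_def)
  qed
  have gU: "g \<in> U ?s" unfolding g_def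
    by (intro U_sum U_theta) (use ne RM in \<open>auto simp: nes_iff\<close>)
  have gV: "g \<in> V ?s" unfolding g_def
    by (intro sum_PA theta_V) (use RM in auto)
  have fg: "f + g \<in> V ?s" using f gV by (rule PA_add)
  have Fg: "Fs ?s {a, b} (f + g) = G a b + (R c + R d)" if q: "quad a b c d" for a b c d
  proof -
    note q' = quadD[OF q]
    have "Fs ?s {a, b} g = (\<Sum>e<4. if {a, b} \<subseteq> co e then R e else 0)"
      unfolding g_def Fs_sum using q' by (intro sum.cong refl Fs_theta) auto
    also have "\<dots> = R c + R d"
      unfolding quad_sum[OF q] using q' by (simp del: zero_fun_apply plus_fun_apply)
    finally show ?thesis by (simp add: Fs_add G_def G2_def del: plus_fun_apply)
  qed
  have p: "qv (Fs ?s {a, b} (f + g)) a c = rv (Fs ?s {a, b} (f + g)) d" if q: "quad a b c d" for a b c d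
  proof -
    note q' = quadD[OF q] and qp = quad_perm[OF q]
    have "qv (Fs ?s {a, b} (f + g)) a c + rv (Fs ?s {a, b} (f + g)) d =
      (qv (G a b) a c + rv (G a b) d) + (sg b d + pi b c)"
      unfolding Fg[OF q] using q' qR(1)[OF qp(2)] qR(3)[OF qp(1)] by (simp add: qvR rvR ac_simps)
    then show ?thesis unfolding sp[OF q] by simp
  qed
  have "f + g \<in> U ?s"
  proof (rule U_descent[OF fg, of 2])
    show "Fs ?s S (f + g) \<in> M S" if S: "S \<in> Sk 2" for S
    proof -
      have "card S = 2" "S \<subseteq> {..<4}" using S by (auto simp: Sk_def)
      then obtain a b where ab: "S = {a, b}" "a \<noteq> b" "a < 4" "b < 4" by (auto simp: card_2_iff)
      then obtain c d where q: "quad a b c d" using quad_exists2 by blast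
      show ?thesis unfolding ab(1) by (rule V2_pair_M[OF fg p[folded G2_def] q, unfolded G2_def])
    qed
  qed simp_all
  from U_add[OF this gU] show ?thesis by (simp add: add.assoc)
qed

lemma coinv_1: "coinv_dim (dg (Suc 0)) = 1"
proof -
  define h where "h i = (if i = 0 then dq 0 1 else if i = 1 then dq 1 1 else if i = 2 then dr 3 else 0)" for i :: nat
  have hP: "h i \<in> V 0" for i by (auto simp: h_def dq_PA dr_PA simp del: zero_fun_apply)
  have "(\<Sum>i<4. h i (ex i + z)) = 0" for z
  proof (cases "four z \<and> mdeg z = 2")
    case True
    then obtain a b where ab: "a < 4" "b < 4" "z = ex a + ex b" using mono_deg2 by metis
    show ?thesis
    proof (cases "a = b")
      case True
      have "(\<Sum>i<4. h i (ex i + (ex b + ex b))) = (\<Sum>i<4. qv (h i) i b)"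
        using hP ab by (intro sum.cong) (auto simp: val_same)
      then show ?thesis unfolding ab(3) True quad_sum[OF quad_0123]
        by (simp add: h_def qv_dq qv_dr)
    next
      case False
      then obtain c d where q: "quad a b c d" using quad_exists2 ab by blast
      note q' = quadD[OF q]
      have hP': "h i \<in> PA 3" for i using hP by simp
      have "(\<Sum>i<4. h i (ex i + (ex a + ex b))) = qv (h a) a b + (qv (h b) a b + (rv (h c) d + rv (h d) c))"
        unfolding quad_sum[OF q] using val_same[OF hP' q'(1,2)] val_same[OF hP' q'(2,1)]
          qv_sym[OF hP' q'(2,1)] val_dist[OF quad_perm(12)[OF q]] val_dist[OF quad_perm(18)[OF q]] by simp
      also have "\<dots> = 0"
      proof -
        have c4: "i = 0 \<or> i = 1 \<or> i = 2 \<or> i = 3" if "i < 4" for i :: nat using that by linarith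
        from c4[OF q'(1)] c4[OF q'(2)] c4[OF q'(3)] c4[OF q'(4)] show ?thesis
          using q'(5-10) by (elim disjE) (simp_all add: h_def qv_dq qv_dr rv_dq rv_dr)
      qed
      finally show ?thesis using ab by simp
    qed
  next
    case False
    moreover have "h i \<in> dual4 3" for i using hP by (simp add: PA_iff)
    ultimately show ?thesis
      by (intro sum.neutral) (auto intro!: dual4_0 simp: keys_plus_nat mdeg_add)
  qed
  then have gl: "Glue h" by (simp add: Glue_def)
  have eV: "glue h \<in> V (Suc 0)" using hP gl by (intro glue_V)
  have pe: "phi1 (glue h) = 1"
    unfolding phi1_def quad_sum[OF quad_0123] by (simp add: slice_glue h_def qv_dq qv_dr del: zero_fun_apply)
  show ?thesis
  proof (rule coinv_dim_1[of _ "glue h" phi1])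
    show "V (Suc 0) \<subseteq> fs.span (insert (glue h) (rels (dg (Suc 0))))"
    proof
      fix f assume f: "f \<in> V (Suc 0)"
      let ?Y = "fs.span (insert (glue h) (rels (dg (Suc 0))))"
      have c: "fscale (phi1 f) (glue h) \<in> V (Suc 0)" using eV by (rule fscale_PA)
      have z: "phi1 0 = 0" using phi1_add[of 0 0] by simp
      then have "phi1 (fscale (phi1 f) (glue h)) = phi1 f" using pe by (cases "phi1 f") simp_all
      then have "phi1 (f + fscale (phi1 f) (glue h)) = 0" by (simp add: phi1_add)
      from U_W[OF f0_W_1 V1_phi1_U[OF PA_add[OF f c] this]]
      have "f + fscale (phi1 f) (glue h) \<in> W (Suc 0)" .
      then have "f + fscale (phi1 f) (glue h) \<in> ?Y"
        using fs.span_mono[of "rels (dg (Suc 0))"] by blast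
      moreover have "fscale (phi1 f) (glue h) \<in> ?Y" by (intro fs.span_scale fs.span_base) simp
      ultimately have "f + fscale (phi1 f) (glue h) + fscale (phi1 f) (glue h) \<in> ?Y" by (rule fs.span_add)
      then show "f \<in> ?Y" by (simp add: add.assoc)
    qed
  qed (use eV pe in \<open>auto simp: phi1_add phi1_act\<close>)
qed

lemma coinv_2: "coinv_dim (dg (Suc (Suc 0))) = 0"
proof (rule coinv_dim_0, rule subsetI)
  let ?s = "Suc (Suc 0)"
  fix f assume f: "f \<in> V ?s"
  define psi where "psi b h = phi1 (slice b h)" for b h
  have psi_add: "psi b (g + h) = psi b g + psi b h" for b g h
    by (simp add: psi_def slice_add phi1_add)
  have psi_act: "psi i (act a b h + h) = (if i = b then psi a h else 0)"
    if h: "h \<in> V ?s" and ab: "a < 4" "b < 4" "a \<noteq> b" "i < 4" for a b i h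
  proof -
    have sl: "slice j h \<in> V (Suc 0)" if "j < 4" for j using V_slice[OF h that] .
    show ?thesis
      using phi1_act[OF sl[OF ab(4)] ab(1-3)] phi1_act[OF PA_add[OF sl[OF ab(2)] sl[OF ab(1)]] ab(1-3)]
      by (simp add: psi_def slice_add phi1_add slice_act[OF V_good[OF h] ab] del: plus_fun_apply)
  qed
  show "f \<in> W ?s"
  proof (cases "\<forall>b<4. psi b f = 0")
    case True
    then show ?thesis by (intro U_W[OF f0_W_2] V2_phi1_U[OF f]) (simp add: psi_def)
  next
    case False
    then obtain a where a: "a < 4" "psi a f = 1" by auto
    have "\<exists>r\<in>W ?s \<inter> V ?s. \<forall>i<4. psi i r = (if i = b then 1 else 0)" if b: "b < 4" for b
    proof (cases "b = a")
      case False
      then show ?thesis using a b f psi_act[OF f a(1) b]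
        by (intro bexI[of _ "act a b f + f"]) (auto intro: act_rels PA_add gact_PA)
    next
      case True
      obtain c where c: "c < 4" "c \<noteq> a" using a quad_exists1[of a] quadD by metis
      let ?h = "act a c f + f"
      have h: "?h \<in> V ?s" using f by (intro PA_add gact_PA)
      show ?thesis using a c f h psi_act[OF f a(1) c(1)] psi_act[OF h c(1) a(1)] True
        by (intro bexI[of _ "act c a ?h + ?h"]) (auto intro: act_rels PA_add gact_PA)
    qed
    then obtain r where r: "\<And>b. b < 4 \<Longrightarrow> r b \<in> W ?s \<and> r b \<in> V ?s \<and> (\<forall>i<4. psi i (r b) = (if i = b then 1 else 0))"
      by (metis IntE)
    define t where "t = (\<Sum>b<4. fscale (psi b f) (r b))"
    have tW: "t \<in> W ?s" unfolding t_def using r by (intro fs.span_sum fs.span_scale) auto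
    have tV: "t \<in> V ?s" unfolding t_def using r by (intro sum_PA fscale_PA) auto
    have psi0: "psi i 0 = 0" for i using psi_add[of i 0 0] by simp
    have "psi i (sum g A) = (\<Sum>x\<in>A. psi i (g x))" for i g and A :: "nat set"
      by (induction A rule: infinite_finite_induct) (simp_all add: psi0 psi_add del: zero_fun_apply plus_fun_apply)
    moreover have "psi i (fscale c h) = c * psi i h" for i c h by (cases c) (simp_all add: psi0)
    ultimately have pt: "psi i t = (\<Sum>b<4. psi b f * psi i (r b))" for i by (simp add: t_def)
    have "psi i t = psi i f" if i: "i < 4" for i
    proof -
      have "psi i t = (\<Sum>b<4. if b = i then psi i f else 0)"
        unfolding pt using r i by (intro sum.cong) auto
      then show ?thesis using i by simp
    qed
    then have "phi1 (slice i (f + t)) = 0" if "i < 4" for i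
      using that by (simp add: psi_add del: plus_fun_apply flip: psi_def)
    then have "f + t \<in> U ?s" by (rule V2_phi1_U[OF PA_add[OF f tV]])
    then have "f + t \<in> W ?s" by (rule U_W[OF f0_W_2])
    from fs.span_add[OF this tW] show ?thesis by (simp add: add.assoc)
  qed
qed

theorem theorem2p1p1:
  fixes s :: nat
  assumes "0 < s"
  shows "coinv_dim (2^(s+2) + 2^(s+1) - 3) = (if s = 2 then 0 else 1)"
proof -
  have "dg s = 2^(s+2) + 2^(s+1) - 3" using dg_eq[of s] by (simp add: power_add)
  then have d: "coinv_dim (2^(s+2) + 2^(s+1) - 3) = coinv_dim (dg s)" by simp
  consider "s = 1" | "s = 2" | "3 \<le> s" using assms by linarith
  then show ?thesis
  proof cases
    case 1
    then show ?thesis unfolding d using coinv_1 by (simp flip: One_nat_def)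
  next
    case 2
    then show ?thesis unfolding d using coinv_2 by (simp add: numeral_2_eq_2)
  next
    case 3
    then show ?thesis unfolding d using coinv_ge3 by simp
  qed
qed

end
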